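(* Let $\mathbb{E} = \langle B,t;\,t^{-1}Ht = K,\,\varphi\rangle$ be an HNN-extension such that $H$ and $K$ are normal in $B$ and $L\varphi = L$, where $L = H\cap K$. Let $\mathcal{C}$ be a root class of groups closed under taking quotient groups, and suppose that the subgroups $H$ and $K$ are finite. Then $\mathbb{E}$ is residually a $\mathcal{C}$-group if and only if $B$ is residually a $\mathcal{C}$-group and $\mathfrak{U},\mathfrak{V}\in\mathcal{C}$.
   Context: Classes of groups are closed under isomorphism. Maps are written on the right and composed from left to right. $\mathbb{E} = \langle B,t;\,t^{-1}Ht = K,\,\varphi\rangle$ denotes the HNN-extension of a group $B$ with stable letter $t$ and subgroups $H,K\leqslant B$ associated according to an isomorphism $\varphi\colon H\to K$ (so $t^{-1}ht = h\varphi$ for $h\in H$); $B$ is identified with its image in $\mathbb{E}$. For a group $X$ with normal subgroup $Y$, $\operatorname{Aut}_X(Y)\leqslant\operatorname{Aut}Y$ is the group of restrictions to $Y$ of all inner automorphisms of $X$; $\operatorname{sgp}\{\cdot\}$ denotes the generated subgroup. With $H,K$ normal in $B$, $L=H\cap K$ and $L\varphi=L$, put $\mathfrak{H}=\operatorname{Aut}_B(H)$, $\mathfrak{K}=\varphi\operatorname{Aut}_B(K)\varphi^{-1}$, $\mathfrak{U}=\operatorname{sgp}\{\mathfrak{H},\mathfrak{K}\}$ (subgroups of $\operatorname{Aut}H$); and $\mathfrak{L}=\operatorname{Aut}_B(L)$, $\mathfrak{F}=\operatorname{sgp}\{\varphi|_L\}$, $\mathfrak{V}=\operatorname{sgp}\{\mathfrak{L},\mathfrak{F}\}$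 (subgroups of $\operatorname{Aut}L$). A group $X$ is residually a $\mathcal{C}$-group if every non-trivial element of $X$ has non-trivial image under some homomorphism of $X$ onto a group from $\mathcal{C}$. A class $\mathcal{C}$ is a root class if it contains non-trivial groups, is closed under taking subgroups, and satisfies any of the following (equivalent) conditions: (1) for every group $X$ and every subnormal series $1\leqslant Z\leqslant Y\leqslant X$ with $X/Y,Y/Z\in\mathcal{C}$ there is a normal subgroup $T$ of $X$ with $X/T\in\mathcal{C}$ and $T\leqslant Z$; (2) $\mathcal{C}$ is closed under unrestricted wreath products; (3) $\mathcal{C}$ is closed under extensions and, for any $X,Y\in\mathcal{C}$, contains the unrestricted direct product $\prod_{y\in Y}X_y$ with each $X_y\cong X$. *)

theory Defs
  imports "HOL-Algebra.Bij" "HOL-Algebra.Generated_Groups" "HOL-Library.Infinite_Typeclass"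
begin

section \<open>HNN-extensions\<close>

text \<open>
  The group $\langle B, t;\ t^{-1} h t = h\varphi\ (h \in H) \rangle$ consists of words in the elements
  of \<open>B\<close> and the letters $t$, $t^{-1}$, modulo the congruence generated by the multiplication
  table of \<open>B\<close>, by $t t^{-1} = t^{-1} t = 1$ and by the relations $t^{-1} h t = h\varphi$.
  The second associated subgroup is \<open>\<phi> ` H\<close>.
\<close>

datatype 'b hnn_letter = Base 'b | Stable | Stable_Inv

definition hnn_words :: "('b, 'm) monoid_scheme \<Rightarrow> 'b hnn_letter list set" where
  "hnn_words B = lists (Base ` carrier B \<union> {Stable, Stable_Inv})"

inductive hnn_cong ::
  "('b, 'm) monoid_scheme \<Rightarrow> 'b set \<Rightarrow> ('b \<Rightarrow> 'b) \<Rightarrow> 'b hnn_letter list \<Rightarrow> 'b hnn_letter list \<Rightarrow> bool"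
  for B :: "('b, 'm) monoid_scheme" and H :: "'b set" and \<phi> :: "'b \<Rightarrow> 'b"
where
  hnn_refl: "w \<in> hnn_words B \<Longrightarrow> hnn_cong B H \<phi> w w"
| hnn_sym: "hnn_cong B H \<phi> u v \<Longrightarrow> hnn_cong B H \<phi> v u"
| hnn_trans: "hnn_cong B H \<phi> u v \<Longrightarrow> hnn_cong B H \<phi> v w \<Longrightarrow> hnn_cong B H \<phi> u w"
| hnn_append: "hnn_cong B H \<phi> u u' \<Longrightarrow> hnn_cong B H \<phi> v v' \<Longrightarrow> hnn_cong B H \<phi> (u @ v) (u' @ v')"
| hnn_base_one: "hnn_cong B H \<phi> [Base \<one>\<^bsub>B\<^esub>] []"
| hnn_base_mult: "a \<in> carrier B \<Longrightarrow> b \<in> carrier B \<Longrightarrow>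
    hnn_cong B H \<phi> [Base a, Base b] [Base (a \<otimes>\<^bsub>B\<^esub> b)]"
| hnn_stable_right_inv: "hnn_cong B H \<phi> [Stable, Stable_Inv] []"
| hnn_stable_left_inv: "hnn_cong B H \<phi> [Stable_Inv, Stable] []"
| hnn_stable_conj: "h \<in> H \<Longrightarrow> hnn_cong B H \<phi> [Stable_Inv, Base h, Stable] [Base (\<phi> h)]"

definition hnn_class ::
  "('b, 'm) monoid_scheme \<Rightarrow> 'b set \<Rightarrow> ('b \<Rightarrow> 'b) \<Rightarrow> 'b hnn_letter list \<Rightarrow> 'b hnn_letter list set" where
  "hnn_class B H \<phi> w = {w'. hnn_cong B H \<phi> w w'}"

definition hnn_extension ::
  "('b, 'm) monoid_scheme \<Rightarrow> 'b set \<Rightarrow> ('b \<Rightarrow> 'b) \<Rightarrow> 'b hnn_letter list set monoid" where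
  "hnn_extension B H \<phi> =
    \<lparr>carrier = hnn_class B H \<phi> ` hnn_words B,
     monoid.mult = (\<lambda>P Q. \<Union>u\<in>P. \<Union>v\<in>Q. hnn_class B H \<phi> (u @ v)),
     one = hnn_class B H \<phi> []\<rparr>"


section \<open>Automorphism groups of the associated subgroups\<close>

text \<open>
  The product of \<^const>\<open>AutoGroup\<close> is composition from right to left. For the opposite convention
  the generated subgroups below are the same sets, with the opposite multiplication; inversion is
  then an isomorphism between the two groups.
\<close>

definition conj_auts :: "('b, 'm) monoid_scheme \<Rightarrow> 'b set \<Rightarrow> ('b \<Rightarrow> 'b) set" where
  "conj_auts X Y = (\<lambda>x. \<lambda>y\<in>Y. inv\<^bsub>X\<^esub> x \<otimes>\<^bsub>X\<^esub> y \<otimes>\<^bsub>X\<^esub> x) ` carrier X"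

definition generated_auts :: "('b, 'm) monoid_scheme \<Rightarrow> 'b set \<Rightarrow> ('b \<Rightarrow> 'b) set \<Rightarrow> ('b \<Rightarrow> 'b) monoid" where
  "generated_auts X Y S =
    (AutoGroup (X\<lparr>carrier := Y\<rparr>))\<lparr>carrier := generate (AutoGroup (X\<lparr>carrier := Y\<rparr>)) S\<rparr>"

text \<open>
  For maps written on the right, $\varphi\alpha\varphi^{-1}$ with $\alpha \in \mathrm{Aut}\,K$ is the
  automorphism of \<open>H\<close> that applies \<open>\<phi>\<close> first.
\<close>

definition hnn_U ::
  "('b, 'm) monoid_scheme \<Rightarrow> 'b set \<Rightarrow> 'b set \<Rightarrow> ('b \<Rightarrow> 'b) \<Rightarrow> ('b \<Rightarrow> 'b) monoid" where
  "hnn_U B H K \<phi> = generated_auts B H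
    (conj_auts B H \<union> (\<lambda>\<alpha>. \<lambda>h\<in>H. inv_into H \<phi> (\<alpha> (\<phi> h))) ` conj_auts B K)"

definition hnn_V ::
  "('b, 'm) monoid_scheme \<Rightarrow> 'b set \<Rightarrow> ('b \<Rightarrow> 'b) \<Rightarrow> ('b \<Rightarrow> 'b) monoid" where
  "hnn_V B L \<phi> = generated_auts B L
    (conj_auts B L \<union> generate (AutoGroup (B\<lparr>carrier := L\<rparr>)) {restrict \<phi> L})"


section \<open>Classes of groups\<close>

text \<open>
  A class of groups is a predicate on the groups with elements in a type \<open>'u\<close>, which plays the
  role of a universe. A group on another type belongs to the class if it is isomorphic to a member.
\<close>

definition group_class :: "('u monoid \<Rightarrow> bool) \<Rightarrow> bool" where
  "group_class \<C> \<longleftrightarrow> (\<forall>G. \<C> G \<longrightarrow> group G) \<and> (\<forall>G G'. \<C> G \<and> group G' \<and> G \<cong> G' \<longrightarrow> \<C> G')"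

definition in_class :: "('a, 'm) monoid_scheme \<Rightarrow> ('u monoid \<Rightarrow> bool) \<Rightarrow> bool" where
  "in_class X \<C> \<longleftrightarrow> (\<exists>G. \<C> G \<and> G \<cong> X)"

definition subgroup_closed :: "('u monoid \<Rightarrow> bool) \<Rightarrow> bool" where
  "subgroup_closed \<C> \<longleftrightarrow> (\<forall>G S. \<C> G \<and> subgroup S G \<longrightarrow> \<C> (G\<lparr>carrier := S\<rparr>))"

definition quotient_closed :: "('u monoid \<Rightarrow> bool) \<Rightarrow> bool" where
  "quotient_closed \<C> \<longleftrightarrow> (\<forall>G N. \<C> G \<and> N \<lhd> G \<longrightarrow> in_class (G Mod N) \<C>)"

text \<open>
  Of the equivalent closure conditions for root classes, the one on subnormal series is used
  because it does not lead to groups of larger cardinality. For infinite \<open>'u\<close>, the predicates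
  satisfying \<open>root_class\<close> are exactly the restrictions to \<open>'u\<close> of root classes in the usual sense:
  given \<open>\<C>\<close>, the groups all of whose subgroups of cardinality at most \<open>|'u|\<close> belong to \<open>\<C>\<close> form
  a root class, and its members on \<open>'u\<close> are those of \<open>\<C>\<close>. On a finite universe the class of all
  groups would wrongly qualify; hence the sort constraint.
\<close>

definition root_class :: "('u::infinite monoid \<Rightarrow> bool) \<Rightarrow> bool" where
  "root_class \<C> \<longleftrightarrow>
    group_class \<C> \<and>
    (\<exists>G. \<C> G \<and> carrier G \<noteq> {\<one>\<^bsub>G\<^esub>}) \<and>
    subgroup_closed \<C> \<and>
    (\<forall>(X :: 'u monoid) Y Z. group X \<and> Y \<lhd> X \<and> Z \<lhd> X\<lparr>carrier := Y\<rparr> \<and>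
        in_class (X Mod Y) \<C> \<and> in_class (X\<lparr>carrier := Y\<rparr> Mod Z) \<C> \<longrightarrow>
      (\<exists>T. T \<lhd> X \<and> in_class (X Mod T) \<C> \<and> T \<subseteq> Z))"

definition residually :: "('u monoid \<Rightarrow> bool) \<Rightarrow> ('a, 'm) monoid_scheme \<Rightarrow> bool" where
  "residually \<C> X \<longleftrightarrow>
    (\<forall>x \<in> carrier X. x \<noteq> \<one>\<^bsub>X\<^esub> \<longrightarrow>
      (\<exists>G f. \<C> G \<and> f \<in> hom X G \<and> f ` carrier X = carrier G \<and> f x \<noteq> \<one>\<^bsub>G\<^esub>))"

end

theory Submission
  imports Defs "HOL-Algebra.SndIsomorphismGrp"
begin

text \<open>
  Everything is phrased through homomorphisms from the HNN-extension \<open>E\<close> to groups \<open>G\<close>; such a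
  homomorphism is a pair \<open>(f, \<tau>)\<close> of a homomorphism \<open>f\<close> on the base and an element \<open>\<tau>\<close> with
  \<open>f h \<tau> = \<tau> f (\<phi> h)\<close>, called a representation below (\<open>hnn_rep\<close>).

  Necessity. If \<open>E\<close> is residually in the class, some homomorphism to a member \<open>G\<close> is injective on
  the finite group \<open>H\<close>. Conjugation by the images of \<open>B\<close>, of \<open>t B inv t\<close> and of \<open>t\<close> then induces the
  generators of \<open>\<UU>\<close> on the image of \<open>H\<close> and those of \<open>\<VV>\<close> on the image of \<open>L\<close>. So \<open>\<UU>\<close> and \<open>\<VV>\<close> are
  quotients of subgroups of \<open>G\<close> (\<open>generated_auts_normalizer\<close>). That \<open>B\<close> is residually in the class
  needs that \<open>B\<close> embeds in \<open>E\<close>; this is the embedding theorem below, applied to the class of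
  all groups on a large enough type (\<open>\<iota>_inj\<close>).

  Sufficiency. The engine is the root property in the following form (\<open>wreath_quotient\<close>): if \<open>G\<close> and
  \<open>A\<close> are in the class, then a homomorphism from \<open>E\<close> to the wreath product \<open>Map(G, A) \<rtimes> G\<close> can be
  replaced by a homomorphism to a member of the class whose values still determine the part in \<open>G\<close>
  and the coordinate at \<open>1\<close>. Up to conjugation, the lifts of a surjection \<open>E \<rightarrow> G\<close> to the wreath
  product correspond to the homomorphisms to \<open>A\<close> of its kernel, which is the fundamental group of a
  graph of groups with vertex set \<open>G/B\<close>. Such lifts are called coverings here, and are used in two
  ways.

  First, if the base lies in the class, it embeds in a member of the class by a representation. If
  \<open>H \<inter> K = 1\<close> (\<open>base_embedding_trivial_intersection\<close>), a non-trivial element \<open>g\<close> of a member \<open>G\<^sub>0\<close> is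
  used to let \<open>B\<close> act on two separate copies of \<open>H\<close>, by conjugation and by conjugation on \<open>K\<close>
  carried over by \<open>\<phi>\<close>, while \<open>t\<close> shifts by \<open>g\<close>. Together with \<open>B \<rightarrow> B/HK\<close> this leaves a kernel inside
  \<open>HK = H \<times> K\<close>, centralising \<open>H\<close> and \<open>K\<close>; a covering (\<open>cover_in_class\<close>) maps it to the two copies of \<open>H\<close>
  by projection. In general (\<open>base_embedding\<close>), the case of \<open>B/L\<close>, whose \<open>\<UU>\<close> is a quotient of that
  of \<open>B\<close>, and the action of \<open>E\<close> on \<open>L\<close> leave a kernel that meets \<open>B\<close> in the centre of \<open>L\<close>; a further
  covering maps this centre to \<open>L\<close> itself.

  Second, a reduced word containing a stable letter is kept away from the base by induction on
  its length (\<open>reduced_word_separated\<close>): once all shorter reduced words on the same syllables are kept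
  away, the word describes a path in the graph \<open>G/B\<close> that crosses its first edge exactly once, and
  labelling that edge by a non-trivial element gives the word a non-trivial label.

  For a residually \<open>\<C>\<close> base, a non-trivial element of \<open>E\<close> is written as a reduced word times an
  element of \<open>B\<close>. A quotient of \<open>B\<close> in the class that is injective on the finitely many elements of
  \<open>H\<close>, \<open>K\<close> and of the word keeps it reduced and non-trivial and does not change \<open>\<UU>\<close> and \<open>\<VV>\<close> up to
  isomorphism.
\<close>

section \<open>Root classes closed under quotients\<close>

lemma (in group) inv_mult_cancel:
  assumes "x \<in> carrier G" "y \<in> carrier G"
  shows "inv x \<otimes> (x \<otimes> y) = y" "x \<otimes> (inv x \<otimes> y) = y"
  using assms by (simp_all add: m_assoc[symmetric])

lemma inj_on_infinite_pair: "\<exists>p :: 'u::infinite \<times> 'u \<Rightarrow> 'u. inj p"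
proof -
  have "(card_of ((UNIV :: 'u set) \<times> (UNIV :: 'u set)), card_of (UNIV :: 'u set)) \<in> ordLeq"
    by (rule ordIso_imp_ordLeq[OF card_of_Times_same_infinite[OF infinite_UNIV]])
  then show ?thesis
    unfolding card_of_ordLeq[symmetric] by auto
qed

lemma isoI_inv_into:
  assumes "group X" "group Y" "h \<in> iso X Y"
  shows "inv_into (carrier X) h \<in> hom Y X"
    "\<And>y. y \<in> carrier Y \<Longrightarrow> h (inv_into (carrier X) h y) = y"
proof -
  have b: "bij_betw h (carrier X) (carrier Y)" using assms(3) by (simp add: iso_def)
  show "inv_into (carrier X) h \<in> hom Y X"
    using group.iso_set_sym[OF assms(1,3)] by (simp add: iso_def)
  show "\<And>y. y \<in> carrier Y \<Longrightarrow> h (inv_into (carrier X) h y) = y"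
    using b by (simp add: bij_betw_def f_inv_into_f)
qed

locale root_quotient_class =
  fixes \<C> :: "'u::infinite monoid \<Rightarrow> bool"
  assumes root: "root_class \<C>" and quot: "quotient_closed \<C>"
begin

lemma class_group: "\<C> G \<Longrightarrow> group G"
  using root unfolding root_class_def group_class_def by blast

lemma class_subgroup: "\<C> G \<Longrightarrow> subgroup S G \<Longrightarrow> \<C> (G\<lparr>carrier := S\<rparr>)"
  using root unfolding root_class_def subgroup_closed_def by blast

lemma class_nontrivial: obtains G g where "\<C> G" "g \<in> carrier G" "g \<noteq> \<one>\<^bsub>G\<^esub>"
proof -
  obtain G where G: "\<C> G" "carrier G \<noteq> {\<one>\<^bsub>G\<^esub>}" using root unfolding root_class_def by blast
  then show ?thesis using that group.is_monoid[OF class_group[OF G(1)]] monoid.one_closed by blast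
qed

lemma in_classI: "\<C> G \<Longrightarrow> in_class G \<C>"
  unfolding in_class_def using iso_refl by blast

lemma in_class_iso: "in_class X \<C> \<Longrightarrow> X \<cong> Y \<Longrightarrow> in_class Y \<C>"
  unfolding in_class_def using iso_trans by blast

lemma in_classE:
  assumes "in_class X \<C>" "group X"
  obtains G i where "\<C> G" "group G" "i \<in> hom X G" "inj_on i (carrier X)" "i ` carrier X = carrier G"
proof -
  obtain G h where G: "\<C> G" "h \<in> iso G X"
    using assms by (auto simp: in_class_def is_iso_def)
  have g: "group G" by (rule class_group[OF G(1)])
  have "inv_into (carrier G) h \<in> iso X G" by (rule group.iso_set_sym[OF g G(2)])
  then show ?thesis using that[OF G(1) g] by (auto simp: iso_def bij_betw_def)
qed

lemma in_class_hom_image: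
  assumes "\<C> G" "\<rho> \<in> hom G Y" "group Y"
  shows "in_class (Y\<lparr>carrier := \<rho> ` carrier G\<rparr>) \<C>"
proof -
  have g: "group G" by (rule class_group[OF assms(1)])
  interpret r: group_hom G Y \<rho> using g assms by (simp add: group_hom_def group_hom_axioms_def)
  let ?I = "Y\<lparr>carrier := \<rho> ` carrier G\<rparr>"
  have gI: "group ?I" by (rule subgroup.subgroup_is_group[OF r.img_is_subgroup assms(3)])
  have h: "\<rho> \<in> hom G ?I" using assms(2) by (auto simp: hom_def)
  interpret i: group_hom G ?I \<rho> using g gI h by (simp add: group_hom_def group_hom_axioms_def)
  have "(G Mod (kernel G ?I \<rho>)) \<cong> ?I" by (rule i.FactGroup_iso) simp
  moreover have "in_class (G Mod (kernel G ?I \<rho>)) \<C>"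
    using quot assms(1) i.normal_kernel unfolding quotient_closed_def by blast
  ultimately show ?thesis by (rule in_class_iso[rotated])
qed

lemma in_class_hom_onto:
  assumes "in_class X \<C>" "group X" "\<rho> \<in> hom X Y" "group Y" "\<rho> ` carrier X = carrier Y"
  shows "in_class Y \<C>"
proof -
  obtain G h where G: "\<C> G" "h \<in> iso G X"
    using assms by (auto simp: in_class_def is_iso_def)
  have "\<rho> \<circ> h \<in> hom G Y" using G(2) unfolding iso_def by (blast intro: hom_compose[OF _ assms(3)])
  from in_class_hom_image[OF G(1) this assms(4)]
  have "in_class (Y\<lparr>carrier := (\<rho> \<circ> h) ` carrier G\<rparr>) \<C>" .
  moreover have "(\<rho> \<circ> h) ` carrier G = carrier Y"
    using G(2) assms(5) unfolding iso_def bij_betw_def image_comp[symmetric] by simp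
  moreover have "Y\<lparr>carrier := carrier Y\<rparr> = Y" by simp
  ultimately show ?thesis by simp
qed

lemma in_class_embed:
  assumes "\<C> G" "group Y" "i \<in> hom Y G" "inj_on i (carrier Y)"
  shows "in_class Y \<C>"
proof -
  have g: "group G" by (rule class_group[OF assms(1)])
  interpret r: group_hom Y G i using g assms by (simp add: group_hom_def group_hom_axioms_def)
  have C: "\<C> (G\<lparr>carrier := i ` carrier Y\<rparr>)"
    by (rule class_subgroup[OF assms(1) r.img_is_subgroup])
  have "i \<in> iso Y (G\<lparr>carrier := i ` carrier Y\<rparr>)"
    using assms(3,4) by (auto simp: iso_def hom_def bij_betw_def)
  then have "inv_into (carrier Y) i \<in> iso (G\<lparr>carrier := i ` carrier Y\<rparr>) Y"
    by (rule group.iso_set_sym[OF assms(2)])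
  then show ?thesis using C unfolding in_class_def is_iso_def by blast
qed

lemma in_class_subgroup:
  assumes "in_class X \<C>" "group X" "subgroup S X"
  shows "in_class (X\<lparr>carrier := S\<rparr>) \<C>"
proof -
  obtain G i where G: "\<C> G" "group G" "i \<in> hom X G" "inj_on i (carrier X)"
    "i ` carrier X = carrier G"
    by (rule in_classE[OF assms(1,2)])
  have S: "S \<subseteq> carrier X" by (rule subgroup.subset[OF assms(3)])
  show ?thesis
  proof (rule in_class_embed[OF G(1)])
    show "group (X\<lparr>carrier := S\<rparr>)" by (rule subgroup.subgroup_is_group[OF assms(3,2)])
    show "i \<in> hom (X\<lparr>carrier := S\<rparr>) G" using G(3) S by (auto simp: hom_def)
    show "inj_on i (carrier (X\<lparr>carrier := S\<rparr>))" using G(4) S by (simp add: inj_on_subset)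
  qed
qed

text \<open>
  The root condition on the subnormal series formed by the kernels of \<open>\<psi>\<close> and \<open>\<nu>\<close>, whose factors
  embed in \<open>G\<close> and \<open>A\<close>.
\<close>

lemma root_quotient_on_universe:
  assumes X: "group (X :: 'u monoid)" and G: "\<C> G" and \<psi>: "\<psi> \<in> hom X G"
    and A: "\<C> A" and \<nu>: "\<nu> \<in> hom (X\<lparr>carrier := kernel X G \<psi>\<rparr>) A"
  obtains G' \<psi>' where "\<C> G'" "\<psi>' \<in> hom X G'"
    "\<And>x. x \<in> carrier X \<Longrightarrow> \<psi>' x = \<one>\<^bsub>G'\<^esub> \<Longrightarrow> \<psi> x = \<one>\<^bsub>G\<^esub> \<and> \<nu> x = \<one>\<^bsub>A\<^esub>"
proof -
  let ?Y = "kernel X G \<psi>"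
  let ?XY = "X\<lparr>carrier := ?Y\<rparr>"
  let ?Z = "kernel ?XY A \<nu>"
  interpret p: group_hom X G \<psi>
    using X \<psi> class_group[OF G] by (simp add: group_hom_def group_hom_axioms_def)
  have gY: "group ?XY" by (rule subgroup.subgroup_is_group[OF p.subgroup_kernel X])
  interpret l: group_hom ?XY A \<nu>
    using gY \<nu> class_group[OF A] by (simp add: group_hom_def group_hom_axioms_def)
  have emb: "in_class (X' Mod kernel X' G' h) \<C>"
    if X': "group X'" and G': "\<C> G'" and h: "h \<in> hom X' G'" for X' :: "'u monoid" and G' h
  proof -
    interpret h: group_hom X' G' h
      using X' class_group[OF G'] h by (simp add: group_hom_def group_hom_axioms_def)
    have "group (X' Mod kernel X' G' h)" by (rule normal.factorgroup_is_group[OF h.normal_kernel])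
    from in_class_embed[OF G' this h.FactGroup_hom h.FactGroup_inj_on] show ?thesis .
  qed
  have "\<exists>T. T \<lhd> X \<and> in_class (X Mod T) \<C> \<and> T \<subseteq> ?Z"
    using root X p.normal_kernel l.normal_kernel emb[OF X G \<psi>] emb[OF gY A \<nu>]
    unfolding root_class_def by blast
  then obtain T where T: "T \<lhd> X" "in_class (X Mod T) \<C>" "T \<subseteq> ?Z" by blast
  have gT: "group (X Mod T)" by (rule normal.factorgroup_is_group[OF T(1)])
  obtain G' i where G': "\<C> G'" "group G'" "i \<in> hom (X Mod T) G'" "inj_on i (carrier (X Mod T))"
    "i ` carrier (X Mod T) = carrier G'"
    by (rule in_classE[OF T(2) gT])
  have q: "(\<lambda>x. T #>\<^bsub>X\<^esub> x) \<in> hom X (X Mod T)" by (rule normal.r_coset_hom_Mod[OF T(1)])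
  show ?thesis
  proof (rule that[OF G'(1)])
    show "i \<circ> (\<lambda>x. T #>\<^bsub>X\<^esub> x) \<in> hom X G'" by (rule hom_compose[OF q G'(3)])
    fix x assume x: "x \<in> carrier X" "(i \<circ> (\<lambda>x. T #>\<^bsub>X\<^esub> x)) x = \<one>\<^bsub>G'\<^esub>"
    have "i \<one>\<^bsub>X Mod T\<^esub> = \<one>\<^bsub>G'\<^esub>" using hom_one[OF G'(3) gT G'(2)] .
    then have "T #>\<^bsub>X\<^esub> x = \<one>\<^bsub>X Mod T\<^esub>"
      using x inj_onD[OF G'(4), of "T #>\<^bsub>X\<^esub> x" "\<one>\<^bsub>X Mod T\<^esub>"] hom_in_carrier[OF q x(1)]
        monoid.one_closed[OF group.is_monoid[OF gT]] by (simp del: one_FactGroup)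
    then have "x \<in> T" using x(1) group.rcos_self[OF X x(1) normal_imp_subgroup[OF T(1)]]
      by (simp add: FactGroup_def)
    then have "x \<in> ?Z" using T(3) by blast
    then show "\<psi> x = \<one>\<^bsub>G\<^esub> \<and> \<nu> x = \<one>\<^bsub>A\<^esub>" by (auto simp: kernel_def)
  qed
qed

end

text \<open>
  Membership in a class is defined for groups on the type \<open>'u\<close>, while the groups of the proof live on
  other types. A group whose carrier embeds in \<open>'u\<close> is copied there.
\<close>

definition transported :: "('a \<Rightarrow> 'u) \<Rightarrow> ('a, 'm) monoid_scheme \<Rightarrow> 'u monoid" where
  "transported e X = \<lparr>carrier = e ` carrier X,
     monoid.mult = (\<lambda>a b. e (inv_into (carrier X) e a \<otimes>\<^bsub>X\<^esub> inv_into (carrier X) e b)),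
     one = e \<one>\<^bsub>X\<^esub>\<rparr>"

lemma transported_iso:
  assumes "group X" "inj_on e (carrier X)"
  shows "group (transported e X)" "e \<in> iso X (transported e X)"
proof -
  interpret group X by fact
  show i: "e \<in> iso X (transported e X)"
    using assms(2) by (auto simp: iso_def hom_def transported_def bij_betw_def)
  have "group ((transported e X)\<lparr>one := e \<one>\<^bsub>X\<^esub>\<rparr>)"
    by (rule iso_imp_img_group[OF i])
  then show "group (transported e X)" by (simp add: transported_def)
qed

context root_quotient_class
begin

text \<open>
  Moving \<open>X\<close> to the universe extends the root condition to all sufficiently small groups. The
  result is stated with homomorphisms to members, so that normal subgroups need not be named.
\<close>

lemma root_quotient:
  fixes X :: "('a, 'm) monoid_scheme" and e :: "'a \<Rightarrow> 'u"
  assumes X: "group X" and e: "inj_on e (carrier X)"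
    and G: "in_class G \<C>" "group G" and \<psi>: "\<psi> \<in> hom X G"
    and A: "in_class A \<C>" "group A" and \<nu>: "\<nu> \<in> hom (X\<lparr>carrier := kernel X G \<psi>\<rparr>) A"
  obtains G' \<psi>' where "\<C> G'" "\<psi>' \<in> hom X G'"
    "\<And>x. x \<in> carrier X \<Longrightarrow> \<psi>' x = \<one>\<^bsub>G'\<^esub> \<Longrightarrow> \<psi> x = \<one>\<^bsub>G\<^esub> \<and> \<nu> x = \<one>\<^bsub>A\<^esub>"
proof -
  let ?X = "transported e X" and ?d = "inv_into (carrier X) e"
  obtain G1 i where G1: "\<C> G1" "group G1" "i \<in> hom G G1" "inj_on i (carrier G)" "i ` carrier G = carrier G1"
    by (rule in_classE[OF G])
  obtain A1 j where A1: "\<C> A1" "group A1" "j \<in> hom A A1" "inj_on j (carrier A)" "j ` carrier A = carrier A1"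
    by (rule in_classE[OF A])
  have i1: "i g = \<one>\<^bsub>G1\<^esub> \<longleftrightarrow> g = \<one>\<^bsub>G\<^esub>" if "g \<in> carrier G" for g
    using inj_on_eq_iff[OF G1(4) that, of "\<one>\<^bsub>G\<^esub>"] hom_one[OF G1(3) G(2) G1(2)] G(2)
    by (simp add: group.is_monoid)
  have j1: "j g = \<one>\<^bsub>A1\<^esub> \<longleftrightarrow> g = \<one>\<^bsub>A\<^esub>" if "g \<in> carrier A" for g
    using inj_on_eq_iff[OF A1(4) that, of "\<one>\<^bsub>A\<^esub>"] hom_one[OF A1(3) A(2) A1(2)] A(2)
    by (simp add: group.is_monoid)
  note t = transported_iso[OF X e]
  note d = isoI_inv_into[OF X t(1) t(2)]
  have de: "?d (e x) = x" if "x \<in> carrier X" for x using e that by simp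
  have ec: "e x \<in> carrier ?X" if "x \<in> carrier X" for x using that by (simp add: transported_def)
  let ?p = "i \<circ> (\<psi> \<circ> ?d)" and ?l = "j \<circ> (\<nu> \<circ> ?d)"
  have p: "?p \<in> hom ?X G1" by (intro hom_compose[OF _ G1(3)] hom_compose[OF d(1) \<psi>])
  have dk: "?d x \<in> kernel X G \<psi>" if "x \<in> kernel ?X G1 ?p" for x
    using that hom_in_carrier[OF d(1), of x] i1[OF hom_in_carrier[OF \<psi>]] by (simp add: kernel_def)
  have "?d \<in> hom (?X\<lparr>carrier := kernel ?X G1 ?p\<rparr>) (X\<lparr>carrier := kernel X G \<psi>\<rparr>)"
    using d(1) dk by (auto simp: hom_def kernel_def)
  then have l: "?l \<in> hom (?X\<lparr>carrier := kernel ?X G1 ?p\<rparr>) A1"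
    by (intro hom_compose[OF _ A1(3)] hom_compose[OF _ \<nu>])
  obtain G' \<psi>' where r: "\<C> G'" "\<psi>' \<in> hom ?X G'"
    "\<And>x. x \<in> carrier ?X \<Longrightarrow> \<psi>' x = \<one>\<^bsub>G'\<^esub> \<Longrightarrow> ?p x = \<one>\<^bsub>G1\<^esub> \<and> ?l x = \<one>\<^bsub>A1\<^esub>"
    using root_quotient_on_universe[OF t(1) G1(1) p A1(1) l] by blast
  show ?thesis
  proof (rule that[OF r(1)])
    show "\<psi>' \<circ> e \<in> hom X G'" using hom_compose[OF _ r(2)] t(2) by (auto simp: iso_def)
    fix x assume x: "x \<in> carrier X" "(\<psi>' \<circ> e) x = \<one>\<^bsub>G'\<^esub>"
    then have k: "i (\<psi> x) = \<one>\<^bsub>G1\<^esub>" "j (\<nu> x) = \<one>\<^bsub>A1\<^esub>" using r(3)[of "e x"] ec de by simp_all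
    then have 1: "\<psi> x = \<one>\<^bsub>G\<^esub>" using i1[OF hom_in_carrier[OF \<psi> x(1)]] by simp
    then have "\<nu> x \<in> carrier A" using hom_in_carrier[OF \<nu>, of x] x(1) by (simp add: kernel_def)
    then show "\<psi> x = \<one>\<^bsub>G\<^esub> \<and> \<nu> x = \<one>\<^bsub>A\<^esub>" using 1 k(2) j1 by simp
  qed
qed

text \<open>Applied to the two projections, the root condition yields an injective homomorphism.\<close>

lemma in_class_DirProd:
  fixes G :: "('a, 'm) monoid_scheme" and A :: "('c, 'n) monoid_scheme"
  assumes G: "in_class G \<C>" "group G" and A: "in_class A \<C>" "group A"
  shows "in_class (G \<times>\<times> A) \<C>"
proof -
  have X: "group (G \<times>\<times> A)" by (rule DirProd_group[OF G(2) A(2)])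
  obtain e :: "'u \<times> 'u \<Rightarrow> 'u" where e: "inj e" using inj_on_infinite_pair by blast
  obtain G1 i where G1: "\<C> G1" "group G1" "i \<in> hom G G1" "inj_on i (carrier G)" "i ` carrier G = carrier G1"
    by (rule in_classE[OF G])
  obtain A1 j where A1: "\<C> A1" "group A1" "j \<in> hom A A1" "inj_on j (carrier A)" "j ` carrier A = carrier A1"
    by (rule in_classE[OF A])
  have ei: "inj_on (\<lambda>(x, y). e (i x, j y)) (carrier (G \<times>\<times> A))"
    by (auto intro!: inj_onI simp: inj_eq[OF e] inj_on_eq_iff[OF G1(4)] inj_on_eq_iff[OF A1(4)])
  have p: "fst \<in> hom (G \<times>\<times> A) G" by (auto simp: hom_def)
  have l: "snd \<in> hom ((G \<times>\<times> A)\<lparr>carrier := kernel (G \<times>\<times> A) G fst\<rparr>) A"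
    by (auto simp: hom_def kernel_def)
  obtain G' \<psi>' where r: "\<C> G'" "\<psi>' \<in> hom (G \<times>\<times> A) G'"
    "\<And>x. x \<in> carrier (G \<times>\<times> A) \<Longrightarrow> \<psi>' x = \<one>\<^bsub>G'\<^esub> \<Longrightarrow> fst x = \<one>\<^bsub>G\<^esub> \<and> snd x = \<one>\<^bsub>A\<^esub>"
    using root_quotient[OF X ei G p A l] by blast
  interpret group_hom "G \<times>\<times> A" G' \<psi>'
    using X class_group[OF r(1)] r(2) by (simp add: group_hom_def group_hom_axioms_def)
  have "inj_on \<psi>' (carrier (G \<times>\<times> A))"
    using r(3) by (subst inj_on_one_iff') (auto simp: prod_eq_iff)
  then show ?thesis by (rule in_class_embed[OF r(1) X r(2)])
qed

end

section \<open>Wreath products and coverings\<close>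

text \<open>
  The unrestricted wreath product: functions on \<open>G\<close> with values in \<open>A\<close>, on which \<open>G\<close> acts by right
  translation of the argument. Equivalently, \<open>(f, x)\<close> is the permutation of \<open>G \<times> A\<close> that maps
  \<open>(z, a)\<close> to \<open>(z x, a (f z))\<close>; a homomorphism to it lifts the right multiplication action on \<open>G\<close> to
  a covering with fibre \<open>A\<close>, and \<open>f z\<close> is the label of the edge that starts in \<open>z\<close>.
\<close>

definition wreath :: "('g, 'm) monoid_scheme \<Rightarrow> ('a, 'n) monoid_scheme \<Rightarrow> (('g \<Rightarrow> 'a) \<times> 'g) monoid" where
  "wreath G A = \<lparr>carrier = (carrier G \<rightarrow>\<^sub>E carrier A) \<times> carrier G,
     monoid.mult = (\<lambda>(f, x) (f', y). (\<lambda>z\<in>carrier G. f z \<otimes>\<^bsub>A\<^esub> f' (z \<otimes>\<^bsub>G\<^esub> x), x \<otimes>\<^bsub>G\<^esub> y)),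
     one = (\<lambda>z\<in>carrier G. \<one>\<^bsub>A\<^esub>, \<one>\<^bsub>G\<^esub>)\<rparr>"

lemma wreath_simps:
  "u \<in> carrier (wreath G A) \<longleftrightarrow> fst u \<in> carrier G \<rightarrow>\<^sub>E carrier A \<and> snd u \<in> carrier G"
  "fst (u \<otimes>\<^bsub>wreath G A\<^esub> v) = (\<lambda>z\<in>carrier G. fst u z \<otimes>\<^bsub>A\<^esub> fst v (z \<otimes>\<^bsub>G\<^esub> snd u))"
  "snd (u \<otimes>\<^bsub>wreath G A\<^esub> v) = snd u \<otimes>\<^bsub>G\<^esub> snd v"
  "fst \<one>\<^bsub>wreath G A\<^esub> = (\<lambda>z\<in>carrier G. \<one>\<^bsub>A\<^esub>)" "snd \<one>\<^bsub>wreath G A\<^esub> = \<one>\<^bsub>G\<^esub>"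
  by (auto simp: wreath_def split_beta mem_Times_iff)

lemma wreath_eqI:
  assumes "u \<in> carrier (wreath G A)" "v \<in> carrier (wreath G A)"
    "\<And>z. z \<in> carrier G \<Longrightarrow> fst u z = fst v z" "snd u = snd v"
  shows "u = v"
proof (rule prod_eqI)
  show "fst u = fst v"
    by (rule PiE_ext[of _ "carrier G" "\<lambda>_. carrier A"]) (use assms in \<open>auto simp: wreath_simps\<close>)
qed (rule assms(4))

lemma wreath_group:
  assumes "group G" "group A"
  shows "group (wreath G A)"
proof -
  interpret G: group G by fact
  interpret A: group A by fact
  have c: "u \<otimes>\<^bsub>wreath G A\<^esub> v \<in> carrier (wreath G A)"
    if "u \<in> carrier (wreath G A)" "v \<in> carrier (wreath G A)" for u v
    using that by (auto simp: wreath_simps)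
  have o: "\<one>\<^bsub>wreath G A\<^esub> \<in> carrier (wreath G A)" by (auto simp: wreath_simps)
  show ?thesis
  proof (rule groupI)
    fix u v w assume u: "u \<in> carrier (wreath G A)" and v: "v \<in> carrier (wreath G A)"
      and w: "w \<in> carrier (wreath G A)"
    show "u \<otimes>\<^bsub>wreath G A\<^esub> v \<otimes>\<^bsub>wreath G A\<^esub> w = u \<otimes>\<^bsub>wreath G A\<^esub> (v \<otimes>\<^bsub>wreath G A\<^esub> w)"
      by (rule wreath_eqI[OF c[OF c[OF u v] w] c[OF u c[OF v w]]])
        (use u v w in \<open>auto simp: wreath_simps PiE_def Pi_def A.m_assoc G.m_assoc\<close>)
  next
    fix u assume u: "u \<in> carrier (wreath G A)"
    show "\<one>\<^bsub>wreath G A\<^esub> \<otimes>\<^bsub>wreath G A\<^esub> u = u"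
      by (rule wreath_eqI[OF c[OF o u] u]) (use u in \<open>auto simp: wreath_simps PiE_def Pi_def\<close>)
    let ?v = "(\<lambda>z\<in>carrier G. inv\<^bsub>A\<^esub> (fst u (z \<otimes>\<^bsub>G\<^esub> inv\<^bsub>G\<^esub> (snd u))), inv\<^bsub>G\<^esub> (snd u))"
    have v: "?v \<in> carrier (wreath G A)" using u by (auto simp: wreath_simps PiE_def Pi_def)
    have "?v \<otimes>\<^bsub>wreath G A\<^esub> u = \<one>\<^bsub>wreath G A\<^esub>"
      by (rule wreath_eqI[OF c[OF v u] o]) (use u in \<open>auto simp: wreath_simps PiE_def Pi_def\<close>)
    then show "\<exists>v\<in>carrier (wreath G A). v \<otimes>\<^bsub>wreath G A\<^esub> u = \<one>\<^bsub>wreath G A\<^esub>" using v by blast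
  qed (use c o in auto)
qed

context root_quotient_class
begin

text \<open>
  The wreath product itself may be too large for the universe, but the coordinate at \<open>1\<close> is a
  homomorphism to \<open>A\<close> on the kernel of \<open>X \<rightarrow> G\<close>, and the root condition applies to it. The new
  homomorphism is made surjective so that \<open>G\<close> and the coordinate become functions of its values.
\<close>

lemma wreath_quotient:
  fixes X :: "('a, 'm) monoid_scheme" and e :: "'a \<Rightarrow> 'u"
  assumes X: "group X" and e: "inj_on e (carrier X)"
    and G: "in_class G \<C>" "group G" and A: "in_class A \<C>" "group A"
    and \<Phi>: "\<Phi> \<in> hom X (wreath G A)"
  obtains G' \<psi> where "\<C> G'" "group G'" "\<psi> \<in> hom X G'" "\<psi> ` carrier X = carrier G'"
    "\<And>u v. u \<in> carrier X \<Longrightarrow> v \<in> carrier X \<Longrightarrow> \<psi> u = \<psi> v \<Longrightarrow>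
      snd (\<Phi> u) = snd (\<Phi> v) \<and> fst (\<Phi> u) \<one>\<^bsub>G\<^esub> = fst (\<Phi> v) \<one>\<^bsub>G\<^esub>"
proof -
  interpret X: group X by fact
  interpret G: group G by fact
  interpret A: group A by fact
  have P: "\<Phi> x \<in> carrier (wreath G A)" if "x \<in> carrier X" for x
    using hom_in_carrier[OF \<Phi> that] .
  have Pm: "\<Phi> (x \<otimes>\<^bsub>X\<^esub> y) = \<Phi> x \<otimes>\<^bsub>wreath G A\<^esub> \<Phi> y" if "x \<in> carrier X" "y \<in> carrier X" for x y
    using hom_mult[OF \<Phi> that] .
  let ?p = "\<lambda>x. snd (\<Phi> x)" and ?l = "\<lambda>x. fst (\<Phi> x) \<one>\<^bsub>G\<^esub>"
  have p: "?p \<in> hom X G" by (rule homI) (use P in \<open>auto simp: Pm wreath_simps\<close>)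
  have l: "?l \<in> hom (X\<lparr>carrier := kernel X G ?p\<rparr>) A"
    by (rule homI) (use P in \<open>auto simp: Pm wreath_simps kernel_def PiE_def Pi_def\<close>)
  obtain G' \<psi> where r: "\<C> G'" "\<psi> \<in> hom X G'"
    "\<And>x. x \<in> carrier X \<Longrightarrow> \<psi> x = \<one>\<^bsub>G'\<^esub> \<Longrightarrow> ?p x = \<one>\<^bsub>G\<^esub> \<and> ?l x = \<one>\<^bsub>A\<^esub>"
    using root_quotient[OF X e G p A l] by blast
  interpret r: group_hom X G' \<psi>
    using X class_group[OF r(1)] r(2) by (simp add: group_hom_def group_hom_axioms_def)
  have C: "\<C> (G'\<lparr>carrier := \<psi> ` carrier X\<rparr>)" by (rule class_subgroup[OF r(1) r.img_is_subgroup])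
  show ?thesis
  proof (rule that[OF C class_group[OF C], of \<psi>])
    show "\<psi> \<in> hom X (G'\<lparr>carrier := \<psi> ` carrier X\<rparr>)" using r(2) by (auto simp: hom_def)
    fix u v assume u: "u \<in> carrier X" and v: "v \<in> carrier X" and eq: "\<psi> u = \<psi> v"
    let ?w = "u \<otimes>\<^bsub>X\<^esub> inv\<^bsub>X\<^esub> v"
    have w: "?w \<in> carrier X" "u = ?w \<otimes>\<^bsub>X\<^esub> v" using u v by (auto simp: X.m_assoc)
    have "\<psi> ?w = \<one>\<^bsub>G'\<^esub>" using u v eq by simp
    from r(3)[OF w(1) this] have k: "?p ?w = \<one>\<^bsub>G\<^esub>" "?l ?w = \<one>\<^bsub>A\<^esub>" by auto
    have "\<Phi> u = \<Phi> ?w \<otimes>\<^bsub>wreath G A\<^esub> \<Phi> v" using Pm[OF w(1) v] w(2) by simp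
    then show "?p u = ?p v \<and> ?l u = ?l v"
      using P[OF v] k by (auto simp: wreath_simps PiE_def Pi_def)
  qed auto
qed

end

text \<open>
  The images of the generators under a homomorphism from the HNN-extension to \<open>G\<close>.
\<close>

definition hnn_rep :: "('b, 'm) monoid_scheme \<Rightarrow> 'b set \<Rightarrow> ('b \<Rightarrow> 'b) \<Rightarrow> ('g, 'n) monoid_scheme \<Rightarrow> ('b \<Rightarrow> 'g) \<Rightarrow> 'g \<Rightarrow> bool" where
  "hnn_rep B H \<phi> G f \<tau> \<longleftrightarrow> group G \<and> f \<in> hom B G \<and> \<tau> \<in> carrier G \<and>
     (\<forall>h\<in>H. f h \<otimes>\<^bsub>G\<^esub> \<tau> = \<tau> \<otimes>\<^bsub>G\<^esub> f (\<phi> h))"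

lemma hnn_rep_prod:
  assumes "hnn_rep B H \<phi> G f \<tau>" "hnn_rep B H \<phi> G' f' \<tau>'"
  shows "hnn_rep B H \<phi> (G \<times>\<times> G') (\<lambda>b. (f b, f' b)) (\<tau>, \<tau>')"
  using assms DirProd_group[of G G'] by (auto simp: hnn_rep_def hom_def)

lemma (in group) wreath_inv:
  assumes "group A" "u \<in> carrier (wreath G A)"
  shows "snd (inv\<^bsub>wreath G A\<^esub> u) = inv (snd u)"
    "z \<in> carrier G \<Longrightarrow> fst (inv\<^bsub>wreath G A\<^esub> u) z = inv\<^bsub>A\<^esub> (fst u (z \<otimes> inv (snd u)))"
proof -
  interpret A: group A by fact
  interpret W: group "wreath G A" by (rule wreath_group[OF group_axioms assms(1)])
  let ?v = "(\<lambda>z\<in>carrier G. inv\<^bsub>A\<^esub> (fst u (z \<otimes> inv (snd u))), inv (snd u))"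
  have v: "?v \<in> carrier (wreath G A)" using assms(2) by (auto simp: wreath_simps PiE_def Pi_def)
  have "?v \<otimes>\<^bsub>wreath G A\<^esub> u = \<one>\<^bsub>wreath G A\<^esub>"
    by (rule wreath_eqI[OF W.m_closed[OF v assms(2)] W.one_closed])
      (use assms(2) in \<open>auto simp: wreath_simps PiE_def Pi_def\<close>)
  then have "inv\<^bsub>wreath G A\<^esub> u = ?v" using assms(2) v by (intro W.inv_equality)
  then show "snd (inv\<^bsub>wreath G A\<^esub> u) = inv (snd u)"
    "z \<in> carrier G \<Longrightarrow> fst (inv\<^bsub>wreath G A\<^esub> u) z = inv\<^bsub>A\<^esub> (fst u (z \<otimes> inv (snd u)))" by simp_all
qed

lemma hnn_rep_hom:
  assumes "hnn_rep B H \<phi> G f \<tau>" "\<psi> \<in> hom G G'" "group G'" "H \<subseteq> carrier B" "\<phi> ` H \<subseteq> carrier B"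
  shows "hnn_rep B H \<phi> G' (\<psi> \<circ> f) (\<psi> \<tau>)"
proof -
  have f: "f \<in> hom B G" "\<tau> \<in> carrier G" and r: "\<And>h. h \<in> H \<Longrightarrow> f h \<otimes>\<^bsub>G\<^esub> \<tau> = \<tau> \<otimes>\<^bsub>G\<^esub> f (\<phi> h)"
    using assms(1) by (auto simp: hnn_rep_def)
  have "\<psi> (f h) \<otimes>\<^bsub>G'\<^esub> \<psi> \<tau> = \<psi> \<tau> \<otimes>\<^bsub>G'\<^esub> \<psi> (f (\<phi> h))" if "h \<in> H" for h
  proof -
    have "f h \<in> carrier G" "f (\<phi> h) \<in> carrier G" using that assms(4,5) f(1) by (auto simp: hom_def)
    then show ?thesis using r[OF that] f(2) assms(2) by (metis hom_mult)
  qed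
  then show ?thesis using assms(2,3) f hom_compose[OF f(1) assms(2)] by (auto simp: hnn_rep_def hom_def)
qed

lemma coset_section:
  assumes "group B" "group G" "f \<in> hom B G"
  obtains r \<eta> where "\<And>x. x \<in> carrier G \<Longrightarrow> r x \<in> carrier G" "\<And>x. x \<in> carrier G \<Longrightarrow> \<eta> x \<in> carrier B"
    "\<And>x. x \<in> carrier G \<Longrightarrow> x = r x \<otimes>\<^bsub>G\<^esub> f (\<eta> x)"
    "\<And>x b. x \<in> carrier G \<Longrightarrow> b \<in> carrier B \<Longrightarrow> r (x \<otimes>\<^bsub>G\<^esub> f b) = r x"
proof -
  interpret group_hom B G f using assms by (simp add: group_hom_def group_hom_axioms_def)
  define R where "R x = (\<lambda>b. x \<otimes>\<^bsub>G\<^esub> f b) ` carrier B" for x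
  define r where "r x = (SOME y. y \<in> R x)" for x
  define \<eta> where "\<eta> x = (SOME b. b \<in> carrier B \<and> x = r x \<otimes>\<^bsub>G\<^esub> f b)" for x
  have Rb: "R (x \<otimes>\<^bsub>G\<^esub> f b) = R x" if x: "x \<in> carrier G" and b: "b \<in> carrier B" for x b
  proof -
    have 1: "x \<otimes>\<^bsub>G\<^esub> f b \<otimes>\<^bsub>G\<^esub> f c = x \<otimes>\<^bsub>G\<^esub> f (b \<otimes>\<^bsub>B\<^esub> c)" if "c \<in> carrier B" for c
      using that x b by (simp add: H.m_assoc)
    have 2: "x \<otimes>\<^bsub>G\<^esub> f c = x \<otimes>\<^bsub>G\<^esub> f b \<otimes>\<^bsub>G\<^esub> f (inv\<^bsub>B\<^esub> b \<otimes>\<^bsub>B\<^esub> c)" if "c \<in> carrier B" for c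
      using that x b by (simp add: H.m_assoc H.inv_mult_cancel)
    show ?thesis
    proof
      show "R (x \<otimes>\<^bsub>G\<^esub> f b) \<subseteq> R x" unfolding R_def using 1 b by blast
      show "R x \<subseteq> R (x \<otimes>\<^bsub>G\<^esub> f b)" unfolding R_def using 2 b by blast
    qed
  qed
  have ex: "\<exists>c\<in>carrier B. r x = x \<otimes>\<^bsub>G\<^esub> f c" for x
  proof -
    have "R x \<noteq> {}" unfolding R_def using G.one_closed by blast
    then have "r x \<in> R x" unfolding r_def by (meson ex_in_conv someI_ex)
    then show ?thesis unfolding R_def by blast
  qed
  have h: "\<eta> x \<in> carrier B \<and> x = r x \<otimes>\<^bsub>G\<^esub> f (\<eta> x)" if "x \<in> carrier G" for x
    unfolding \<eta>_def
  proof (rule someI_ex)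
    obtain c where c: "c \<in> carrier B" "r x = x \<otimes>\<^bsub>G\<^esub> f c" using ex by blast
    have "x = r x \<otimes>\<^bsub>G\<^esub> f (inv\<^bsub>B\<^esub> c)" using c that by (simp add: H.m_assoc)
    then show "\<exists>b. b \<in> carrier B \<and> x = r x \<otimes>\<^bsub>G\<^esub> f b" using c(1) by blast
  qed
  show ?thesis
  proof (rule that[of r \<eta>])
    show "r x \<in> carrier G" if "x \<in> carrier G" for x using ex[of x] that by auto
    show "r (x \<otimes>\<^bsub>G\<^esub> f b) = r x" if "x \<in> carrier G" "b \<in> carrier B" for x b
      using Rb[OF that] by (simp add: r_def)
  qed (use h in auto)
qed

text \<open>
  The functions from \<open>G\<close> to \<open>A\<close> are coinduced coefficients, so there is no obstruction to extending an
  equivariant family of homomorphisms \<open>\<Theta> x\<close> on the kernel to a crossed homomorphism on \<open>B\<close>.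
  Explicitly, coset representatives turn each \<open>b\<close> into an element of the kernel, namely the loop
  that leaves the representative, passes along \<open>b\<close> and returns.
\<close>

lemma cocycle_extension:
  assumes "group B" "group G" "f \<in> hom B G" "group A"
    and cl: "\<And>x d. x \<in> carrier G \<Longrightarrow> d \<in> kernel B G f \<Longrightarrow> \<Theta> x d \<in> carrier A"
    and hm: "\<And>x d d'. x \<in> carrier G \<Longrightarrow> d \<in> kernel B G f \<Longrightarrow> d' \<in> kernel B G f \<Longrightarrow>
      \<Theta> x (d \<otimes>\<^bsub>B\<^esub> d') = \<Theta> x d \<otimes>\<^bsub>A\<^esub> \<Theta> x d'"
    and eq: "\<And>x b d. x \<in> carrier G \<Longrightarrow> b \<in> carrier B \<Longrightarrow> d \<in> kernel B G f \<Longrightarrow>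
      \<Theta> (x \<otimes>\<^bsub>G\<^esub> f b) d = \<Theta> x (b \<otimes>\<^bsub>B\<^esub> d \<otimes>\<^bsub>B\<^esub> inv\<^bsub>B\<^esub> b)"
  obtains \<beta> where "\<And>b x. b \<in> carrier B \<Longrightarrow> x \<in> carrier G \<Longrightarrow> \<beta> b x \<in> carrier A"
    "\<And>b c x. b \<in> carrier B \<Longrightarrow> c \<in> carrier B \<Longrightarrow> x \<in> carrier G \<Longrightarrow>
      \<beta> (b \<otimes>\<^bsub>B\<^esub> c) x = \<beta> b x \<otimes>\<^bsub>A\<^esub> \<beta> c (x \<otimes>\<^bsub>G\<^esub> f b)"
    "\<And>d x. d \<in> kernel B G f \<Longrightarrow> x \<in> carrier G \<Longrightarrow> \<beta> d x = \<Theta> x d"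
proof -
  interpret group_hom B G f using assms by (simp add: group_hom_def group_hom_axioms_def)
  obtain r \<eta> where r: "\<And>x. x \<in> carrier G \<Longrightarrow> r x \<in> carrier G" "\<And>x. x \<in> carrier G \<Longrightarrow> \<eta> x \<in> carrier B"
    "\<And>x. x \<in> carrier G \<Longrightarrow> x = r x \<otimes>\<^bsub>G\<^esub> f (\<eta> x)"
    "\<And>x b. x \<in> carrier G \<Longrightarrow> b \<in> carrier B \<Longrightarrow> r (x \<otimes>\<^bsub>G\<^esub> f b) = r x"
    using coset_section[OF assms(1-3)] by blast
  define \<gamma> where "\<gamma> b x = \<eta> x \<otimes>\<^bsub>B\<^esub> b \<otimes>\<^bsub>B\<^esub> inv\<^bsub>B\<^esub> (\<eta> (x \<otimes>\<^bsub>G\<^esub> f b))" for b x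
  have g: "\<gamma> b x \<in> kernel B G f" if b: "b \<in> carrier B" and x: "x \<in> carrier G" for b x
  proof -
    have xb: "x \<otimes>\<^bsub>G\<^esub> f b \<in> carrier G" using b x by simp
    have "r x \<otimes>\<^bsub>G\<^esub> f (\<eta> x) \<otimes>\<^bsub>G\<^esub> f b = r x \<otimes>\<^bsub>G\<^esub> f (\<eta> (x \<otimes>\<^bsub>G\<^esub> f b))"
      using r(3)[OF x] r(3)[OF xb] r(4)[OF x b] by simp
    then have "f (\<eta> x) \<otimes>\<^bsub>G\<^esub> f b = f (\<eta> (x \<otimes>\<^bsub>G\<^esub> f b))"
      using r(1,2)[OF x] r(2)[OF xb] b by (simp add: H.m_assoc)
    then show ?thesis using r(2)[OF x] r(2)[OF xb] b by (simp add: \<gamma>_def kernel_def)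
  qed
  show ?thesis
  proof (rule that[of "\<lambda>b x. \<Theta> (r x) (\<gamma> b x)"])
    show "\<Theta> (r x) (\<gamma> b x) \<in> carrier A" if "b \<in> carrier B" "x \<in> carrier G" for b x
      using cl g r(1) that by blast
    show "\<Theta> (r x) (\<gamma> (b \<otimes>\<^bsub>B\<^esub> c) x) = \<Theta> (r x) (\<gamma> b x) \<otimes>\<^bsub>A\<^esub> \<Theta> (r (x \<otimes>\<^bsub>G\<^esub> f b)) (\<gamma> c (x \<otimes>\<^bsub>G\<^esub> f b))"
      if b: "b \<in> carrier B" and c: "c \<in> carrier B" and x: "x \<in> carrier G" for b c x
    proof -
      have xb: "x \<otimes>\<^bsub>G\<^esub> f b \<in> carrier G" "x \<otimes>\<^bsub>G\<^esub> f b \<otimes>\<^bsub>G\<^esub> f c \<in> carrier G" using b c x by auto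
      have "\<gamma> (b \<otimes>\<^bsub>B\<^esub> c) x = \<gamma> b x \<otimes>\<^bsub>B\<^esub> \<gamma> c (x \<otimes>\<^bsub>G\<^esub> f b)"
        using b c x r(2)[OF x] r(2)[OF xb(1)] r(2)[OF xb(2)]
        by (simp add: \<gamma>_def G.m_assoc H.m_assoc G.inv_mult_cancel)
      then show ?thesis using hm[OF r(1)[OF x] g[OF b x] g[OF c xb(1)]] r(4)[OF x b] by simp
    qed
    show "\<Theta> (r x) (\<gamma> d x) = \<Theta> x d" if d: "d \<in> kernel B G f" and x: "x \<in> carrier G" for d x
    proof -
      have "\<gamma> d x = \<eta> x \<otimes>\<^bsub>B\<^esub> d \<otimes>\<^bsub>B\<^esub> inv\<^bsub>B\<^esub> (\<eta> x)" using d x by (simp add: \<gamma>_def kernel_def)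
      then show ?thesis using eq[OF r(1)[OF x] r(2)[OF x] d] r(3)[OF x] by simp
    qed
  qed
qed

text \<open>
  The label \<open>\<rho>\<close> of the stable letter has to intertwine the crossed homomorphism \<open>\<beta>\<close> on \<open>H\<close> with the
  one that \<open>\<phi>\<close> pulls back from \<open>K\<close>. By assumption the two agree on the part of \<open>H\<close> that acts trivially, and
  \<open>H\<close> modulo that part acts freely on \<open>G\<close>. So \<open>\<rho>\<close> can be prescribed to be trivial at one point of each orbit
  and transported along the orbit.
\<close>

lemma stable_letter_cochain:
  assumes B: "group B" and rep: "hnn_rep B H \<phi> G f \<tau>" and A: "group A"
    and H: "subgroup H B" and \<phi>: "\<phi> \<in> hom (B\<lparr>carrier := H\<rparr>) B"
    and \<beta>: "\<And>b x. b \<in> carrier B \<Longrightarrow> x \<in> carrier G \<Longrightarrow> \<beta> b x \<in> carrier A"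
      "\<And>b c x. b \<in> carrier B \<Longrightarrow> c \<in> carrier B \<Longrightarrow> x \<in> carrier G \<Longrightarrow>
        \<beta> (b \<otimes>\<^bsub>B\<^esub> c) x = \<beta> b x \<otimes>\<^bsub>A\<^esub> \<beta> c (x \<otimes>\<^bsub>G\<^esub> f b)"
    and eq: "\<And>x h. x \<in> carrier G \<Longrightarrow> h \<in> H \<Longrightarrow> f h = \<one>\<^bsub>G\<^esub> \<Longrightarrow> \<beta> h x = \<beta> (\<phi> h) (x \<otimes>\<^bsub>G\<^esub> \<tau>)"
  obtains \<rho> where "\<And>x. x \<in> carrier G \<Longrightarrow> \<rho> x \<in> carrier A"
    "\<And>x h. x \<in> carrier G \<Longrightarrow> h \<in> H \<Longrightarrow>
      \<beta> h x \<otimes>\<^bsub>A\<^esub> \<rho> (x \<otimes>\<^bsub>G\<^esub> f h) = \<rho> x \<otimes>\<^bsub>A\<^esub> \<beta> (\<phi> h) (x \<otimes>\<^bsub>G\<^esub> \<tau>)"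
proof -
  have G: "group G" and f: "f \<in> hom B G" and t: "\<tau> \<in> carrier G"
    and ft: "\<And>h. h \<in> H \<Longrightarrow> f h \<otimes>\<^bsub>G\<^esub> \<tau> = \<tau> \<otimes>\<^bsub>G\<^esub> f (\<phi> h)"
    using rep by (auto simp: hnn_rep_def)
  interpret A: group A by fact
  interpret f: group_hom B G f using G B f by (simp add: group_hom_def group_hom_axioms_def)
  have HB: "\<And>h. h \<in> H \<Longrightarrow> h \<in> carrier B" using subgroup.subset[OF H] by blast
  have pB: "\<And>h. h \<in> H \<Longrightarrow> \<phi> h \<in> carrier B"
    and pm: "\<And>h k. h \<in> H \<Longrightarrow> k \<in> H \<Longrightarrow> \<phi> (h \<otimes>\<^bsub>B\<^esub> k) = \<phi> h \<otimes>\<^bsub>B\<^esub> \<phi> k" using \<phi> by (auto simp: hom_def)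
  have Hm: "\<And>h k. h \<in> H \<Longrightarrow> k \<in> H \<Longrightarrow> h \<otimes>\<^bsub>B\<^esub> k \<in> H" by (rule subgroup.m_closed[OF H])
  have fH: "f \<in> hom (B\<lparr>carrier := H\<rparr>) G" using f HB by (auto simp: hom_def)
  obtain r \<eta> where r: "\<And>x. x \<in> carrier G \<Longrightarrow> r x \<in> carrier G" "\<And>x. x \<in> carrier G \<Longrightarrow> \<eta> x \<in> H"
    "\<And>x. x \<in> carrier G \<Longrightarrow> x = r x \<otimes>\<^bsub>G\<^esub> f (\<eta> x)"
    "\<And>x b. x \<in> carrier G \<Longrightarrow> b \<in> H \<Longrightarrow> r (x \<otimes>\<^bsub>G\<^esub> f b) = r x"
    using coset_section[OF subgroup.subgroup_is_group[OF H B] G fH, simplified] by blast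
  \<comment> \<open>the label at \<open>y (f h)\<close> that is forced by a trivial label at \<open>y\<close>\<close>
  define D where "D y h = inv\<^bsub>A\<^esub> (\<beta> h y) \<otimes>\<^bsub>A\<^esub> \<beta> (\<phi> h) (y \<otimes>\<^bsub>G\<^esub> \<tau>)" for y h
  have Dc: "D y h \<in> carrier A" if "y \<in> carrier G" "h \<in> H" for y h
    using that t \<beta>(1) HB pB by (simp add: D_def)
  have D: "\<beta> k (y \<otimes>\<^bsub>G\<^esub> f h) \<otimes>\<^bsub>A\<^esub> D y (h \<otimes>\<^bsub>B\<^esub> k) = D y h \<otimes>\<^bsub>A\<^esub> \<beta> (\<phi> k) (y \<otimes>\<^bsub>G\<^esub> f h \<otimes>\<^bsub>G\<^esub> \<tau>)"
    if y: "y \<in> carrier G" and h: "h \<in> H" and k: "k \<in> H" for y h k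
  proof -
    have e: "y \<otimes>\<^bsub>G\<^esub> \<tau> \<otimes>\<^bsub>G\<^esub> f (\<phi> h) = y \<otimes>\<^bsub>G\<^esub> f h \<otimes>\<^bsub>G\<^esub> \<tau>"
      using y h t ft[OF h] HB pB by (simp add: f.H.m_assoc)
    have "D y (h \<otimes>\<^bsub>B\<^esub> k) = inv\<^bsub>A\<^esub> (\<beta> h y \<otimes>\<^bsub>A\<^esub> \<beta> k (y \<otimes>\<^bsub>G\<^esub> f h)) \<otimes>\<^bsub>A\<^esub>
        (\<beta> (\<phi> h) (y \<otimes>\<^bsub>G\<^esub> \<tau>) \<otimes>\<^bsub>A\<^esub> \<beta> (\<phi> k) (y \<otimes>\<^bsub>G\<^esub> f h \<otimes>\<^bsub>G\<^esub> \<tau>))"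
      using y h k t HB pB by (simp add: D_def pm \<beta>(2) e)
    then show ?thesis using y h k t HB pB
      by (simp add: D_def A.inv_mult_group A.m_assoc \<beta>(1) A.inv_mult_cancel)
  qed
  have Dk: "D y (d \<otimes>\<^bsub>B\<^esub> h) = D y h" if y: "y \<in> carrier G" and h: "h \<in> H" and d: "d \<in> H" "f d = \<one>\<^bsub>G\<^esub>" for y h d
  proof -
    have "\<tau> \<otimes>\<^bsub>G\<^esub> f (\<phi> d) = \<tau>" using ft[OF d(1)] d t by simp
    then have "D y d = \<one>\<^bsub>A\<^esub>" using eq[OF y d] y d t HB pB \<beta>(1) by (simp add: D_def)
    then have "\<beta> h y \<otimes>\<^bsub>A\<^esub> D y (d \<otimes>\<^bsub>B\<^esub> h) = \<beta> (\<phi> h) (y \<otimes>\<^bsub>G\<^esub> \<tau>)"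
      using D[OF y d(1) h] y h d t HB pB \<beta>(1) by simp
    then have "D y (d \<otimes>\<^bsub>B\<^esub> h) = inv\<^bsub>A\<^esub> (\<beta> h y) \<otimes>\<^bsub>A\<^esub> \<beta> (\<phi> h) (y \<otimes>\<^bsub>G\<^esub> \<tau>)"
      using y h d t HB pB \<beta>(1) Dc[OF y Hm[OF d(1) h]] by (simp add: A.inv_solve_left)
    then show ?thesis by (simp add: D_def)
  qed
  show ?thesis
  proof (rule that[of "\<lambda>x. D (r x) (\<eta> x)"])
    show "D (r x) (\<eta> x) \<in> carrier A" if "x \<in> carrier G" for x using that r Dc by blast
    show "\<beta> h x \<otimes>\<^bsub>A\<^esub> D (r (x \<otimes>\<^bsub>G\<^esub> f h)) (\<eta> (x \<otimes>\<^bsub>G\<^esub> f h)) = D (r x) (\<eta> x) \<otimes>\<^bsub>A\<^esub> \<beta> (\<phi> h) (x \<otimes>\<^bsub>G\<^esub> \<tau>)"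
      if x: "x \<in> carrier G" and h: "h \<in> H" for x h
    proof -
      let ?n = "\<eta> x" and ?m = "\<eta> (x \<otimes>\<^bsub>G\<^esub> f h)" and ?r = "r x"
      have xh: "x \<otimes>\<^bsub>G\<^esub> f h \<in> carrier G" using x h HB by simp
      have n: "?n \<in> H" "?m \<in> H" "?n \<in> carrier B" "?m \<in> carrier B" "h \<in> carrier B" "?r \<in> carrier G"
        using r(1,2) x xh h HB by auto
      have "?r \<otimes>\<^bsub>G\<^esub> f ?m = ?r \<otimes>\<^bsub>G\<^esub> f ?n \<otimes>\<^bsub>G\<^esub> f h"
        using r(3)[OF x] r(3)[OF xh] r(4)[OF x h] by simp
      then have fm: "f ?m = f (?n \<otimes>\<^bsub>B\<^esub> h)" using n by (simp add: f.H.m_assoc)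
      let ?d = "?m \<otimes>\<^bsub>B\<^esub> inv\<^bsub>B\<^esub> (?n \<otimes>\<^bsub>B\<^esub> h)"
      have nh: "?n \<otimes>\<^bsub>B\<^esub> h \<in> H" using n h Hm by blast
      have d: "?d \<in> H" using n nh Hm subgroup.m_inv_closed[OF H] by blast
      have "f ?d = \<one>\<^bsub>G\<^esub>" using n fm by (simp del: f.hom_mult add: f.hom_mult[of ?m])
      moreover have "?d \<otimes>\<^bsub>B\<^esub> (?n \<otimes>\<^bsub>B\<^esub> h) = ?m" using n by (simp add: f.G.m_assoc)
      ultimately have "D ?r ?m = D ?r (?n \<otimes>\<^bsub>B\<^esub> h)" using Dk[OF n(6) nh d] by simp
      then show ?thesis using D[OF n(6) n(1) h] r(3)[OF x] r(4)[OF x h] by simp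
    qed
  qed
qed

text \<open>
  A family of homomorphisms on the vertex groups \<open>ker f\<close> that is compatible with \<open>B\<close> and with the
  stable letter extends to a covering. The family depends on a point \<open>x\<close> of \<open>G\<close>, since the identification of
  the vertex group at \<open>x\<close> with \<open>ker f\<close> is conjugation by \<open>x\<close>.
\<close>

lemma cover_rep:
  assumes B: "group B" and rep: "hnn_rep B H \<phi> G f \<tau>" and A: "group A"
    and H: "subgroup H B" and \<phi>: "\<phi> \<in> hom (B\<lparr>carrier := H\<rparr>) B"
    and cl: "\<And>x d. x \<in> carrier G \<Longrightarrow> d \<in> kernel B G f \<Longrightarrow> \<Theta> x d \<in> carrier A"
    and hm: "\<And>x d d'. x \<in> carrier G \<Longrightarrow> d \<in> kernel B G f \<Longrightarrow> d' \<in> kernel B G f \<Longrightarrow>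
      \<Theta> x (d \<otimes>\<^bsub>B\<^esub> d') = \<Theta> x d \<otimes>\<^bsub>A\<^esub> \<Theta> x d'"
    and eq: "\<And>x b d. x \<in> carrier G \<Longrightarrow> b \<in> carrier B \<Longrightarrow> d \<in> kernel B G f \<Longrightarrow>
      \<Theta> (x \<otimes>\<^bsub>G\<^esub> f b) d = \<Theta> x (b \<otimes>\<^bsub>B\<^esub> d \<otimes>\<^bsub>B\<^esub> inv\<^bsub>B\<^esub> b)"
    and st: "\<And>x h. x \<in> carrier G \<Longrightarrow> h \<in> H \<Longrightarrow> h \<in> kernel B G f \<Longrightarrow> \<Theta> (x \<otimes>\<^bsub>G\<^esub> \<tau>) (\<phi> h) = \<Theta> x h"
  obtains f' \<tau>' where "hnn_rep B H \<phi> (wreath G A) f' \<tau>'"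
    "\<And>b. b \<in> carrier B \<Longrightarrow> snd (f' b) = f b" "snd \<tau>' = \<tau>"
    "\<And>d x. d \<in> kernel B G f \<Longrightarrow> x \<in> carrier G \<Longrightarrow> fst (f' d) x = \<Theta> x d"
proof -
  have G: "group G" and f: "f \<in> hom B G" and t: "\<tau> \<in> carrier G"
    and ft: "\<And>h. h \<in> H \<Longrightarrow> f h \<otimes>\<^bsub>G\<^esub> \<tau> = \<tau> \<otimes>\<^bsub>G\<^esub> f (\<phi> h)"
    using rep by (auto simp: hnn_rep_def)
  interpret f: group_hom B G f using G B f by (simp add: group_hom_def group_hom_axioms_def)
  have HB: "\<And>h. h \<in> H \<Longrightarrow> h \<in> carrier B" using subgroup.subset[OF H] by blast
  have pB: "\<And>h. h \<in> H \<Longrightarrow> \<phi> h \<in> carrier B" using \<phi> by (auto simp: hom_def)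
  obtain \<beta> where b: "\<And>b x. b \<in> carrier B \<Longrightarrow> x \<in> carrier G \<Longrightarrow> \<beta> b x \<in> carrier A"
    "\<And>b c x. b \<in> carrier B \<Longrightarrow> c \<in> carrier B \<Longrightarrow> x \<in> carrier G \<Longrightarrow>
      \<beta> (b \<otimes>\<^bsub>B\<^esub> c) x = \<beta> b x \<otimes>\<^bsub>A\<^esub> \<beta> c (x \<otimes>\<^bsub>G\<^esub> f b)"
    "\<And>d x. d \<in> kernel B G f \<Longrightarrow> x \<in> carrier G \<Longrightarrow> \<beta> d x = \<Theta> x d"
    using cocycle_extension[OF B G f A cl hm eq] by blast
  have "\<beta> h x = \<beta> (\<phi> h) (x \<otimes>\<^bsub>G\<^esub> \<tau>)" if x: "x \<in> carrier G" and h: "h \<in> H" "f h = \<one>\<^bsub>G\<^esub>" for x h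
  proof -
    have "\<tau> \<otimes>\<^bsub>G\<^esub> f (\<phi> h) = \<tau>" using ft[OF h(1)] h t by simp
    then have "f (\<phi> h) = \<one>\<^bsub>G\<^esub>" using t h(1) pB by simp
    then show ?thesis using h x t b(3) st HB pB by (simp add: kernel_def)
  qed
  then obtain \<rho> where r: "\<And>x. x \<in> carrier G \<Longrightarrow> \<rho> x \<in> carrier A"
    "\<And>x h. x \<in> carrier G \<Longrightarrow> h \<in> H \<Longrightarrow>
      \<beta> h x \<otimes>\<^bsub>A\<^esub> \<rho> (x \<otimes>\<^bsub>G\<^esub> f h) = \<rho> x \<otimes>\<^bsub>A\<^esub> \<beta> (\<phi> h) (x \<otimes>\<^bsub>G\<^esub> \<tau>)"
    using stable_letter_cochain[OF B rep A H \<phi> b(1,2)] by blast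
  let ?f = "\<lambda>b. (\<lambda>x\<in>carrier G. \<beta> b x, f b)" and ?t = "(\<lambda>x\<in>carrier G. \<rho> x, \<tau>)"
  have "hnn_rep B H \<phi> (wreath G A) ?f ?t"
    unfolding hnn_rep_def
  proof (intro conjI ballI)
    show "group (wreath G A)" by (rule wreath_group[OF G A])
    show "?f \<in> hom B (wreath G A)"
    proof (rule homI)
      fix x y assume "x \<in> carrier B" "y \<in> carrier B"
      then show "?f (x \<otimes>\<^bsub>B\<^esub> y) = ?f x \<otimes>\<^bsub>wreath G A\<^esub> ?f y"
        by (auto simp: wreath_simps prod_eq_iff b(2) intro!: restrict_ext)
    qed (auto simp: wreath_simps b(1))
    show "?t \<in> carrier (wreath G A)" using r(1) t by (auto simp: wreath_simps)
    show "?f h \<otimes>\<^bsub>wreath G A\<^esub> ?t = ?t \<otimes>\<^bsub>wreath G A\<^esub> ?f (\<phi> h)" if h: "h \<in> H" for h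
      using h HB t ft r(2) by (auto simp: wreath_simps prod_eq_iff intro!: restrict_ext)
  qed
  from that[OF this] show ?thesis using b(3) by auto
qed

section \<open>The HNN-extension as a group\<close>

text \<open>
  The value of \<open>b\<^sub>1 t\<^sub>1 b\<^sub>2 t\<^sub>2 \<dots>\<close>, where \<open>True\<close> stands for the stable letter and
  \<open>False\<close> for its inverse.
\<close>

primrec syllable_prod :: "('g, 'm) monoid_scheme \<Rightarrow> ('b \<Rightarrow> 'g) \<Rightarrow> 'g \<Rightarrow> ('b \<times> bool) list \<Rightarrow> 'g" where
  "syllable_prod G f \<tau> [] = \<one>\<^bsub>G\<^esub>"
| "syllable_prod G f \<tau> (p # w) =
    f (fst p) \<otimes>\<^bsub>G\<^esub> (if snd p then \<tau> else inv\<^bsub>G\<^esub> \<tau>) \<otimes>\<^bsub>G\<^esub> syllable_prod G f \<tau> w"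

lemma syllable_prod_closed:
  assumes "group G" "f \<in> hom B G" "\<tau> \<in> carrier G" "fst ` set w \<subseteq> carrier B"
  shows "syllable_prod G f \<tau> w \<in> carrier G"
proof -
  interpret group G by fact
  show ?thesis using assms(2-4) by (induction w) (auto simp: hom_def)
qed

lemma hom_syllable_prod:
  assumes "group G" "f \<in> hom B G" "\<tau> \<in> carrier G" "group G'" "\<psi> \<in> hom G G'" "fst ` set w \<subseteq> carrier B"
  shows "\<psi> (syllable_prod G f \<tau> w) = syllable_prod G' (\<psi> \<circ> f) (\<psi> \<tau>) w"
proof -
  interpret group_hom G G' \<psi> using assms by (simp add: group_hom_def group_hom_axioms_def)
  from assms(6) show ?thesis
  proof (induction w)
    case (Cons p w)
    have "syllable_prod G f \<tau> w \<in> carrier G"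
      by (rule syllable_prod_closed[OF assms(1-3)]) (use Cons.prems in auto)
    moreover have "f (fst p) \<in> carrier G" using Cons.prems assms(2) by (auto simp: hom_def)
    ultimately show ?case using Cons assms(3) by simp
  qed simp
qed

text \<open>
  Britton's condition: no factor \<open>t c (inv t)\<close> with \<open>c \<in> K\<close> and no factor \<open>(inv t) c t\<close> with
  \<open>c \<in> H\<close>.
\<close>

fun hnn_reduced :: "'b set \<Rightarrow> 'b set \<Rightarrow> ('b \<times> bool) list \<Rightarrow> bool" where
  "hnn_reduced H K ((b, s) # (c, r) # w) \<longleftrightarrow>
    (s \<noteq> r \<longrightarrow> c \<notin> (if s then K else H)) \<and> hnn_reduced H K ((c, r) # w)"
| "hnn_reduced H K _ \<longleftrightarrow> True"

lemma hnn_reduced_Cons: "hnn_reduced H K (p # w) \<Longrightarrow> hnn_reduced H K w"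
  by (cases p; cases w) auto

lemma hnn_reduced_appendD: "hnn_reduced H K (u @ v) \<Longrightarrow> hnn_reduced H K u"
  by (induction H K u rule: hnn_reduced.induct) auto

lemma hnn_reduced_head: "hnn_reduced H K ((b, s) # w) \<Longrightarrow> hnn_reduced H K ((c, s) # w)"
  by (cases w) auto

locale hnn_base = B: group B for B :: "'b monoid" (structure) +
  fixes H K :: "'b set" and \<phi> :: "'b \<Rightarrow> 'b"
  assumes H_normal: "H \<lhd> B" and K_normal: "K \<lhd> B"
    and \<phi>_iso: "\<phi> \<in> iso (B\<lparr>carrier := H\<rparr>) (B\<lparr>carrier := K\<rparr>)"
begin

lemma H_subgroup: "subgroup H B" and K_subgroup: "subgroup K B"
  using H_normal K_normal by (simp_all add: normal_imp_subgroup)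

lemma H_sub: "h \<in> H \<Longrightarrow> h \<in> carrier B" and K_sub: "k \<in> K \<Longrightarrow> k \<in> carrier B"
  using subgroup.subset[OF H_subgroup] subgroup.subset[OF K_subgroup] by auto

lemma \<phi>_K: "h \<in> H \<Longrightarrow> \<phi> h \<in> K"
  and \<phi>_mult: "h \<in> H \<Longrightarrow> h' \<in> H \<Longrightarrow> \<phi> (h \<otimes> h') = \<phi> h \<otimes> \<phi> h'"
  and \<phi>_inj: "inj_on \<phi> H" and \<phi>_image: "\<phi> ` H = K"
  using \<phi>_iso by (auto simp: iso_def hom_def bij_betw_def)

lemma \<phi>_B: "h \<in> H \<Longrightarrow> \<phi> h \<in> carrier B"
  using \<phi>_K K_sub by blast

lemma \<phi>_hom: "\<phi> \<in> hom (B\<lparr>carrier := H\<rparr>) B"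
  using \<phi>_B \<phi>_mult by (auto simp: hom_def)

lemma \<phi>_one: "\<phi> \<one> = \<one>"
proof -
  have "\<phi> \<one> \<otimes> \<phi> \<one> = \<phi> \<one>" "\<phi> \<one> \<in> carrier B"
    using \<phi>_mult[of \<one> \<one>] \<phi>_B subgroup.one_closed[OF H_subgroup] by auto
  then show ?thesis using B.l_cancel_one by blast
qed

lemma \<phi>_inv:
  assumes "h \<in> H"
  shows "\<phi> (inv h) = inv (\<phi> h)"
proof -
  have i: "inv h \<in> H" using subgroup.m_inv_closed[OF H_subgroup assms] .
  have "\<phi> (inv h) \<otimes> \<phi> h = \<one>" using \<phi>_mult[OF i assms] H_sub[OF assms] \<phi>_one by simp
  then show ?thesis using \<phi>_B[OF assms] \<phi>_B[OF i] by (simp add: B.inv_equality)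
qed

lemma \<phi>_conj:
  assumes "h \<in> H" "x \<in> H"
  shows "\<phi> (h \<otimes> x \<otimes> inv h) = \<phi> h \<otimes> \<phi> x \<otimes> inv (\<phi> h)"
  using assms subgroup.m_closed[OF H_subgroup] subgroup.m_inv_closed[OF H_subgroup]
  by (simp add: \<phi>_mult \<phi>_inv)

abbreviation cong where "cong \<equiv> hnn_cong B H \<phi>"
abbreviation cls where "cls \<equiv> hnn_class B H \<phi>"
abbreviation words where "words \<equiv> hnn_words B"
abbreviation E where "E \<equiv> hnn_extension B H \<phi>"

definition \<iota> where "\<iota> b = cls [Base b]"
definition stable where "stable = cls [Stable]"

lemma words_simps [simp]:
  "[] \<in> words" "(l # w) \<in> words \<longleftrightarrow> (case l of Base b \<Rightarrow> b \<in> carrier B | _ \<Rightarrow> True) \<and> w \<in> words"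
  "u @ v \<in> words \<longleftrightarrow> u \<in> words \<and> v \<in> words"
  by (auto simp: hnn_words_def split: hnn_letter.splits)

lemma cong_words: "cong u v \<Longrightarrow> u \<in> words \<and> v \<in> words"
  by (induction rule: hnn_cong.induct) (auto simp: H_sub \<phi>_B)

lemma cls_eq: "u \<in> words \<Longrightarrow> cls u = cls v \<longleftrightarrow> cong u v"
proof
  assume "cls u = cls v"
  moreover assume "u \<in> words"
  then have "u \<in> cls u" by (simp add: hnn_class_def hnn_refl)
  ultimately show "cong u v" by (auto simp: hnn_class_def intro: hnn_sym)
next
  assume uv: "cong u v"
  have "cong u w \<longleftrightarrow> cong v w" for w
    using hnn_trans[OF uv] hnn_trans[OF hnn_sym[OF uv]] by blast
  then show "cls u = cls v" by (simp add: hnn_class_def)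
qed

lemma E_carrier: "carrier E = cls ` words"
  by (simp add: hnn_extension_def)

lemma E_one: "\<one>\<^bsub>E\<^esub> = cls []"
  by (simp add: hnn_extension_def)

lemma E_mult:
  assumes "u \<in> words" "v \<in> words"
  shows "cls u \<otimes>\<^bsub>E\<^esub> cls v = cls (u @ v)"
proof -
  have 1: "cls (u' @ v') = cls (u @ v)" if "u' \<in> cls u" "v' \<in> cls v" for u' v'
  proof -
    have "cong (u @ v) (u' @ v')" using that by (auto simp: hnn_class_def intro: hnn_append)
    then show ?thesis using assms by (metis cls_eq words_simps(3))
  qed
  have 2: "u \<in> cls u" "v \<in> cls v" using assms by (auto simp: hnn_class_def intro: hnn_refl)
  have "cls u \<otimes>\<^bsub>E\<^esub> cls v = (\<Union>u'\<in>cls u. \<Union>v'\<in>cls v. cls (u' @ v'))"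
    by (simp add: hnn_extension_def)
  also have "\<dots> = (\<Union>u'\<in>cls u. \<Union>v'\<in>cls v. cls (u @ v))"
    by (intro SUP_cong refl) (rule 1)
  also have "\<dots> = cls (u @ v)" using 2 by blast
  finally show ?thesis .
qed

lemma E_group: "group E"
proof (rule groupI)
  fix x assume "x \<in> carrier E"
  then obtain w where w: "w \<in> words" "x = cls w" by (auto simp: E_carrier)
  from w(1) have "\<exists>v\<in>words. cong (v @ w) []"
  proof (induction w)
    case (Cons l w)
    then obtain v where v: "v \<in> words" "cong (v @ w) []" by auto
    have "\<exists>l'. [l'] \<in> words \<and> cong [l', l] []"
    proof (cases l)
      case (Base b)
      then have b: "b \<in> carrier B" using Cons.prems by simp
      have "cong [Base (inv b), Base b] [Base (inv b \<otimes> b)]" using b by (intro hnn_base_mult) auto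
      also have "inv b \<otimes> b = \<one>" using b by simp
      finally have "cong [Base (inv b), Base b] []" using hnn_base_one hnn_trans by metis
      then show ?thesis using b Base by (intro exI[of _ "Base (inv b)"]) simp
    next
      case Stable
      then show ?thesis by (intro exI[of _ Stable_Inv]) (auto intro: hnn_stable_left_inv)
    next
      case Stable_Inv
      then show ?thesis by (intro exI[of _ Stable]) (auto intro: hnn_stable_right_inv)
    qed
    then obtain l' where l': "[l'] \<in> words" "cong [l', l] []" by blast
    have "cong (v @ [l', l] @ w) (v @ [] @ w)"
      using v Cons.prems l'(2) by (intro hnn_append hnn_refl) auto
    then have "cong ((v @ [l']) @ l # w) []" using v(2) hnn_trans by fastforce
    then show ?case using v l' by (intro bexI[of _ "v @ [l']"]) auto
  next
    case Nil
    have "cong ([] @ []) []" by (simp add: hnn_refl)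
    then show ?case by (rule bexI) simp
  qed
  then obtain v where v: "v \<in> words" "cong (v @ w) []" by blast
  then have "cls v \<otimes>\<^bsub>E\<^esub> x = \<one>\<^bsub>E\<^esub>" using w by (simp add: E_mult E_one cls_eq)
  then show "\<exists>y\<in>carrier E. y \<otimes>\<^bsub>E\<^esub> x = \<one>\<^bsub>E\<^esub>" using v(1) by (auto simp: E_carrier)
qed (auto simp: E_carrier E_mult E_one)

lemma E_rep: "hnn_rep B H \<phi> E \<iota> stable"
  unfolding hnn_rep_def
proof (intro conjI ballI)
  show "group E" by (rule E_group)
  show "\<iota> \<in> hom B E"
    by (rule homI) (auto simp: \<iota>_def E_carrier E_mult cls_eq intro: hnn_base_mult hnn_sym)
  show "stable \<in> carrier E" by (auto simp: stable_def E_carrier)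
  fix h assume h: "h \<in> H"
  have "cong ([Stable, Stable_Inv] @ [Base h, Stable]) ([] @ [Base h, Stable])"
    using h H_sub by (intro hnn_append hnn_refl hnn_stable_right_inv) auto
  moreover have "cong ([Stable] @ [Stable_Inv, Base h, Stable]) ([Stable] @ [Base (\<phi> h)])"
    using h by (intro hnn_append hnn_refl hnn_stable_conj) auto
  ultimately have "cong [Base h, Stable] [Stable, Base (\<phi> h)]" using hnn_sym hnn_trans by fastforce
  then show "\<iota> h \<otimes>\<^bsub>E\<^esub> stable = stable \<otimes>\<^bsub>E\<^esub> \<iota> (\<phi> h)"
    using h H_sub \<phi>_B by (simp add: \<iota>_def stable_def E_mult cls_eq)
qed

lemma \<iota>_hom: "\<iota> \<in> hom B E" and stable_E: "stable \<in> carrier E"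
  and \<iota>_stable: "h \<in> H \<Longrightarrow> \<iota> h \<otimes>\<^bsub>E\<^esub> stable = stable \<otimes>\<^bsub>E\<^esub> \<iota> (\<phi> h)"
  using E_rep by (auto simp: hnn_rep_def)

text \<open>
  Words are evaluated letter by letter, and the value is invariant under each generating relation of
  the congruence.
\<close>

lemma E_universal:
  assumes "hnn_rep B H \<phi> G f \<tau>"
  obtains F where "F \<in> hom E G" "\<And>b. b \<in> carrier B \<Longrightarrow> F (\<iota> b) = f b" "F stable = \<tau>"
proof -
  have G: "group G" and f: "f \<in> hom B G" and t: "\<tau> \<in> carrier G"
    and ft: "\<And>h. h \<in> H \<Longrightarrow> f h \<otimes>\<^bsub>G\<^esub> \<tau> = \<tau> \<otimes>\<^bsub>G\<^esub> f (\<phi> h)"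
    using assms by (auto simp: hnn_rep_def)
  interpret f: group_hom B G f
    using B.group_axioms G f by (simp add: group_hom_def group_hom_axioms_def)
  define lv where "lv l = (case l of Base b \<Rightarrow> f b | Stable \<Rightarrow> \<tau> | Stable_Inv \<Rightarrow> inv\<^bsub>G\<^esub> \<tau>)" for l
  define wv where "wv w = foldr (\<lambda>l g. lv l \<otimes>\<^bsub>G\<^esub> g) w \<one>\<^bsub>G\<^esub>" for w
  have wv_s: "wv [] = \<one>\<^bsub>G\<^esub>" "wv (l # w) = lv l \<otimes>\<^bsub>G\<^esub> wv w" for l w by (auto simp: wv_def)
  have wc: "wv w \<in> carrier G" if "w \<in> words" for w
    using that t by (induction w) (auto simp: wv_s lv_def split: hnn_letter.splits)
  have lc: "lv l \<in> carrier G" if "[l] \<in> words" for l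
    using that t by (auto simp: lv_def split: hnn_letter.splits)
  have wa: "wv (u @ v) = wv u \<otimes>\<^bsub>G\<^esub> wv v" if "u \<in> words" "v \<in> words" for u v
    using that
  proof (induction u)
    case (Cons l u)
    then show ?case using wc[of u] wc[of v] lc[of l] by (simp add: wv_s f.H.m_assoc)
  qed (simp add: wv_s wc)
  have eq: "wv u = wv v" if "cong u v" for u v
    using that
  proof (induction rule: hnn_cong.induct)
    case (hnn_append u u' v v')
    then show ?case using cong_words wa by metis
  next
    case (hnn_stable_conj h)
    then show ?case using ft[of h] t H_sub[of h] \<phi>_B[of h]
      by (simp add: wv_s lv_def f.H.inv_mult_cancel)
  qed (use t in \<open>auto simp: wv_s lv_def f.H.m_assoc\<close>)
  define F where "F P = wv (SOME w. w \<in> P)" for P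
  have F: "F (cls w) = wv w" if w: "w \<in> words" for w
  proof -
    have "w \<in> cls w" using w by (auto simp: hnn_class_def intro: hnn_refl)
    then have "(SOME w'. w' \<in> cls w) \<in> cls w" by (rule someI)
    then show ?thesis unfolding F_def using eq by (simp add: hnn_class_def)
  qed
  show ?thesis
  proof (rule that[of F])
    show "F \<in> hom E G"
      by (rule homI) (auto simp: E_carrier E_mult F wc wa)
  qed (use t in \<open>auto simp: \<iota>_def stable_def F wv_s lv_def\<close>)
qed

definition syllables where
  "syllables w b \<longleftrightarrow> hnn_reduced H K w \<and> fst ` set w \<subseteq> carrier B \<and> b \<in> carrier B"

definition nf where "nf w b = syllable_prod E \<iota> stable w \<otimes>\<^bsub>E\<^esub> \<iota> b"

lemma nf_base:
  assumes "syllables w b" "c \<in> carrier B"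
  shows "\<exists>w' b'. syllables w' b' \<and> \<iota> c \<otimes>\<^bsub>E\<^esub> nf w b = nf w' b'"
proof -
  interpret E: group E by (rule E_group)
  show ?thesis
  proof (cases w)
    case Nil
    then show ?thesis using assms \<iota>_hom
      by (intro exI[of _ "[]"] exI[of _ "c \<otimes> b"]) (auto simp: nf_def syllables_def hom_def Pi_def)
  next
    case (Cons p v)
    obtain d s where p: "p = (d, s)" by force
    have d: "d \<in> carrier B" "fst ` set v \<subseteq> carrier B" "b \<in> carrier B"
      using assms(1) by (auto simp: syllables_def Cons p)
    have e: "\<iota> c \<in> carrier E" "\<iota> d \<in> carrier E" "\<iota> b \<in> carrier E"
      "syllable_prod E \<iota> stable v \<in> carrier E"
      using assms(2) d \<iota>_hom stable_E syllable_prod_closed[OF E_group \<iota>_hom] by (auto simp: hom_def)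
    have m: "\<iota> (c \<otimes> d) = \<iota> c \<otimes>\<^bsub>E\<^esub> \<iota> d" using assms(2) d \<iota>_hom by (auto simp: hom_def)
    have "syllables ((c \<otimes> d, s) # v) b"
      using assms hnn_reduced_head[of H K d s v] by (auto simp: syllables_def Cons p)
    moreover have "\<iota> c \<otimes>\<^bsub>E\<^esub> nf w b = nf ((c \<otimes> d, s) # v) b"
      using e stable_E by (simp add: nf_def Cons p m E.m_assoc)
    ultimately show ?thesis by blast
  qed
qed

text \<open>
  A new stable letter either keeps the word reduced or meets its inverse across an element of \<open>K\<close>
  or \<open>H\<close>; then both cancel and leave an element of the base.
\<close>

lemma nf_stable:
  assumes "syllables w b"
  shows "\<exists>w' b'. syllables w' b' \<and> (if s then stable else inv\<^bsub>E\<^esub> stable) \<otimes>\<^bsub>E\<^esub> nf w b = nf w' b'"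
    (is "\<exists>w' b'. _ \<and> ?t s \<otimes>\<^bsub>E\<^esub> _ = _")
proof -
  interpret E: group E by (rule E_group)
  have tc: "?t r \<in> carrier E" for r using stable_E by simp
  have one: "\<iota> \<one> = \<one>\<^bsub>E\<^esub>" using hom_one[OF \<iota>_hom B.group_axioms E_group] .
  have wc: "syllable_prod E \<iota> stable v \<in> carrier E" if "fst ` set v \<subseteq> carrier B" for v
    by (rule syllable_prod_closed[OF E_group \<iota>_hom stable_E that])
  have ic: "\<iota> c \<in> carrier E" if "c \<in> carrier B" for c using that \<iota>_hom by (auto simp: hom_def)
  show ?thesis
  proof (cases "hnn_reduced H K ((\<one>, s) # w)")
    case True
    have "?t s \<otimes>\<^bsub>E\<^esub> nf w b = nf ((\<one>, s) # w) b"
      using assms tc[of s] wc[of w] ic by (simp add: nf_def one syllables_def E.m_assoc)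
    moreover have "syllables ((\<one>, s) # w) b" using True assms by (auto simp: syllables_def)
    ultimately show ?thesis by blast
  next
    case False
    then obtain d r v where w: "w = (d, r) # v" by (cases w) auto
    have r: "r = (\<not> s)" "d \<in> (if s then K else H)"
      using False assms by (auto simp: w syllables_def split: if_splits)
    have v: "syllables v b" "fst ` set v \<subseteq> carrier B" "b \<in> carrier B" "d \<in> carrier B"
      using assms by (auto simp: w syllables_def dest: hnn_reduced_Cons)
    have "\<exists>c\<in>carrier B. ?t s \<otimes>\<^bsub>E\<^esub> \<iota> d \<otimes>\<^bsub>E\<^esub> ?t r = \<iota> c"
    proof (cases s)
      case True
      then obtain h where h: "h \<in> H" "d = \<phi> h" using r \<phi>_image by auto
      have "stable \<otimes>\<^bsub>E\<^esub> \<iota> d \<otimes>\<^bsub>E\<^esub> inv\<^bsub>E\<^esub> stable = \<iota> h"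
        using h \<iota>_stable[OF h(1)] stable_E ic H_sub by (metis E.inv_solve_right E.m_closed v(4))
      then show ?thesis using True r h H_sub by auto
    next
      case False
      then have h: "d \<in> H" using r by auto
      have "inv\<^bsub>E\<^esub> stable \<otimes>\<^bsub>E\<^esub> \<iota> d \<otimes>\<^bsub>E\<^esub> stable = \<iota> (\<phi> d)"
        using h \<iota>_stable[OF h] stable_E ic v(4) \<phi>_B by (simp add: E.m_assoc E.inv_mult_cancel)
      then show ?thesis using False r h \<phi>_B by auto
    qed
    then obtain c where c: "c \<in> carrier B" "?t s \<otimes>\<^bsub>E\<^esub> \<iota> d \<otimes>\<^bsub>E\<^esub> ?t r = \<iota> c" by blast
    have "?t s \<otimes>\<^bsub>E\<^esub> nf w b = (?t s \<otimes>\<^bsub>E\<^esub> \<iota> d \<otimes>\<^bsub>E\<^esub> ?t r) \<otimes>\<^bsub>E\<^esub> nf v b"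
      unfolding nf_def w syllable_prod.simps fst_conv snd_conv
      by (simp only: E.m_assoc E.m_closed tc ic v wc)
    then show ?thesis using nf_base[OF v(1) c(1)] c(2) by simp
  qed
qed

lemma normal_form:
  assumes "x \<in> carrier E"
  obtains w b where "hnn_reduced H K w" "fst ` set w \<subseteq> carrier B" "b \<in> carrier B"
    "x = syllable_prod E \<iota> stable w \<otimes>\<^bsub>E\<^esub> \<iota> b"
proof -
  interpret E: group E by (rule E_group)
  obtain u where u: "u \<in> words" "x = cls u" using assms by (auto simp: E_carrier)
  from u(1) have "\<exists>w b. syllables w b \<and> cls u = nf w b"
  proof (induction u)
    case Nil
    have "syllables [] \<one>" by (simp add: syllables_def)
    moreover have "cls [] = nf [] \<one>"
      using hom_one[OF \<iota>_hom B.group_axioms E_group] by (simp add: nf_def E_one[symmetric])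
    ultimately show ?case by blast
  next
    case (Cons l u)
    then obtain w b where wb: "syllables w b" "cls u = nf w b" by auto
    have l: "[l] \<in> words" "u \<in> words" using Cons.prems by auto
    have m: "cls (l # u) = cls [l] \<otimes>\<^bsub>E\<^esub> nf w b" using E_mult[OF l] wb(2) by simp
    show ?case
    proof (cases l)
      case (Base c)
      then show ?thesis using nf_base[OF wb(1), of c] l m by (simp add: \<iota>_def)
    next
      case Stable
      then show ?thesis using nf_stable[OF wb(1), of True] m by (simp add: stable_def)
    next
      case Stable_Inv
      have "cls [Stable_Inv] \<otimes>\<^bsub>E\<^esub> stable = \<one>\<^bsub>E\<^esub>"
        by (simp add: stable_def E_mult E_one cls_eq hnn_stable_left_inv)
      then have "cls [Stable_Inv] = inv\<^bsub>E\<^esub> stable"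
        using stable_E by (intro E.inv_equality[symmetric]) (auto simp: E_carrier)
      then show ?thesis using nf_stable[OF wb(1), of False] m Stable_Inv by simp
    qed
  qed
  then show ?thesis using that u(2) by (auto simp: syllables_def nf_def)
qed

text \<open>An infinite type contains codes for all words over it, by iterated pairing.\<close>

lemma E_small:
  fixes e :: "'b \<Rightarrow> 'u::infinite"
  assumes "inj_on e (carrier B)"
  obtains e' :: "'b hnn_letter list set \<Rightarrow> 'u" where "inj_on e' (carrier E)"
proof -
  obtain p :: "'u \<times> 'u \<Rightarrow> 'u" where p: "inj p" using inj_on_infinite_pair by blast
  obtain k :: "nat \<Rightarrow> 'u" where k: "inj k" using infinite_UNIV infinite_countable_subset by blast
  define cl where "cl l = (case l of Base b \<Rightarrow> p (k 0, e b) | Stable \<Rightarrow> p (k 1, k 0) | Stable_Inv \<Rightarrow> p (k 2, k 0))" for l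
  define cw where "cw w = foldr (\<lambda>l x. p (k 1, p (cl l, x))) w (p (k 0, k 0))" for w
  have pe: "p x = p y \<longleftrightarrow> x = y" and ke: "k i = k j \<longleftrightarrow> i = j" for x y i j
    using p k by (auto simp: inj_eq)
  have cle: "l = l'" if "[l] \<in> words" "[l'] \<in> words" "cl l = cl l'" for l l'
    using that assms by (auto simp: cl_def pe ke inj_on_def split: hnn_letter.splits)
  have cwe: "w = w'" if "w \<in> words" "w' \<in> words" "cw w = cw w'" for w w'
    using that
  proof (induction w arbitrary: w')
    case Nil
    then show ?case by (cases w') (auto simp: cw_def pe ke)
  next
    case (Cons l w)
    from Cons.prems(3) obtain l' v where w': "w' = l' # v" by (cases w') (auto simp: cw_def pe ke)
    have "cl l = cl l'" "cw w = cw v" using Cons.prems(3) by (auto simp: w' cw_def pe)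
    moreover have "[l] \<in> words" "[l'] \<in> words" "w \<in> words" "v \<in> words"
      using Cons.prems(1,2) by (auto simp: w')
    ultimately show ?case using Cons.IH[of v] cle[of l l'] by (simp add: w')
  qed
  define rp where "rp P = (SOME w. w \<in> words \<and> P = cls w)" for P
  have rp: "rp P \<in> words \<and> P = cls (rp P)" if "P \<in> carrier E" for P
    unfolding rp_def by (rule someI_ex) (use that in \<open>auto simp: E_carrier\<close>)
  have "inj_on (cw \<circ> rp) (carrier E)"
    by (rule inj_onI) (metis comp_apply cwe rp)
  then show ?thesis using that by blast
qed

end

section \<open>Separating reduced words from the base\<close>

lemma syllable_prod_cong:
  assumes "\<And>b. b \<in> fst ` set w \<Longrightarrow> f b = f' b"
  shows "syllable_prod G f \<tau> w = syllable_prod G f' \<tau> w"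
  using assms by (induction w) auto

text \<open>
  In a covering given by edge labels only, the label of a word is the product of the labels of the edges that
  its path crosses. At the point \<open>y\<close>, a stable letter crosses the edge that starts in \<open>y\<close>, and the
  inverse of one crosses backwards the edge that ends in \<open>y\<close> and starts in \<open>y (inv \<tau>)\<close>.
\<close>

lemma wreath_label_trivial:
  assumes G: "group G" and A: "group A" and f: "f \<in> hom B G" and t: "\<tau> \<in> carrier G"
    and lab: "\<And>x. x \<in> carrier G \<Longrightarrow> lab x \<in> carrier A"
    and w: "fst ` set w \<subseteq> carrier B" and x: "x \<in> carrier G"
    and away: "\<And>u b s v. w = u @ (b, s) # v \<Longrightarrow>
      lab (x \<otimes>\<^bsub>G\<^esub> syllable_prod G f \<tau> u \<otimes>\<^bsub>G\<^esub> f b \<otimes>\<^bsub>G\<^esub> (if s then \<one>\<^bsub>G\<^esub> else inv\<^bsub>G\<^esub> \<tau>)) = \<one>\<^bsub>A\<^esub>"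
  shows "fst (syllable_prod (wreath G A) (\<lambda>b. (\<lambda>x\<in>carrier G. \<one>\<^bsub>A\<^esub>, f b)) (\<lambda>x\<in>carrier G. lab x, \<tau>) w) x = \<one>\<^bsub>A\<^esub>"
  using w x away
proof (induction w arbitrary: x)
  case Nil
  then show ?case by (simp add: wreath_simps)
next
  case (Cons p w)
  interpret G: group G by fact
  interpret A: group A by fact
  obtain b s where p: "p = (b, s)" by force
  let ?W = "wreath G A" and ?f = "\<lambda>b. (\<lambda>x\<in>carrier G. \<one>\<^bsub>A\<^esub>, f b)" and ?t = "(\<lambda>x\<in>carrier G. lab x, \<tau>)"
  have tW: "?t \<in> carrier ?W" using lab t by (auto simp: wreath_simps)
  have fb: "f b \<in> carrier G" using Cons.prems(1) f by (auto simp: p hom_def)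
  note x = Cons.prems(2)
  let ?y = "x \<otimes>\<^bsub>G\<^esub> f b \<otimes>\<^bsub>G\<^esub> (if s then \<tau> else inv\<^bsub>G\<^esub> \<tau>)"
  have y: "?y \<in> carrier G" using x fb t by simp
  have rest: "fst (syllable_prod ?W ?f ?t w) ?y = \<one>\<^bsub>A\<^esub>"
  proof (rule Cons.IH)
    show "fst ` set w \<subseteq> carrier B" using Cons.prems(1) by auto
    show "?y \<in> carrier G" by (rule y)
    fix u c r v assume w: "w = u @ (c, r) # v"
    have u: "syllable_prod G f \<tau> u \<in> carrier G"
      by (rule syllable_prod_closed[OF G f t]) (use Cons.prems(1) w in auto)
    have c: "f c \<in> carrier G" using Cons.prems(1) f w by (auto simp: hom_def)
    show "lab (?y \<otimes>\<^bsub>G\<^esub> syllable_prod G f \<tau> u \<otimes>\<^bsub>G\<^esub> f c \<otimes>\<^bsub>G\<^esub> (if r then \<one>\<^bsub>G\<^esub> else inv\<^bsub>G\<^esub> \<tau>)) = \<one>\<^bsub>A\<^esub>"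
      using Cons.prems(3)[of "p # u" c r v] w u c x fb t by (simp add: p G.m_assoc)
  qed
  have e: "lab (x \<otimes>\<^bsub>G\<^esub> f b \<otimes>\<^bsub>G\<^esub> (if s then \<one>\<^bsub>G\<^esub> else inv\<^bsub>G\<^esub> \<tau>)) = \<one>\<^bsub>A\<^esub>"
    using Cons.prems(3)[of "[]" b s w] x fb t by (simp add: p)
  define F T where "F = ?f" and "T = ?t"
  have T: "snd T = \<tau>" "\<And>z. z \<in> carrier G \<Longrightarrow> fst T z = lab z"
    and F: "snd (F b) = f b" "\<And>z. z \<in> carrier G \<Longrightarrow> fst (F b) z = \<one>\<^bsub>A\<^esub>" by (simp_all add: F_def T_def)
  have TW: "T \<in> carrier ?W" using tW by (simp add: T_def)
  have "fst (syllable_prod ?W F T (p # w)) x = \<one>\<^bsub>A\<^esub>"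
  proof (cases s)
    case True
    then show ?thesis using rest[folded F_def T_def] e x fb t
      by (simp add: p wreath_simps T F G.m_assoc)
  next
    case False
    then show ?thesis using rest[folded F_def T_def] e x fb t
      by (simp add: p wreath_simps T F G.m_assoc G.wreath_inv[OF A TW])
  qed
  then show ?case by (simp only: F_def T_def)
qed

locale hnn_in_class = hnn_base B H K \<phi> + root_quotient_class \<C>
  for B :: "'b monoid" (structure) and H K \<phi> and \<C> :: "'u::infinite monoid \<Rightarrow> bool" +
  assumes B_in_class: "in_class B \<C>"
begin

lemma E_embeds_in_universe:
  obtains e :: "'b hnn_letter list set \<Rightarrow> 'u" where "inj_on e (carrier E)"
proof -
  obtain G i where i: "\<C> G" "group G" "i \<in> hom B G" "inj_on i (carrier B)" "i ` carrier B = carrier G"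
    by (rule in_classE[OF B_in_class B.group_axioms])
  show ?thesis by (rule E_small[OF i(4)]) (rule that)
qed

text \<open>
  Since the base is in the class, \<open>E\<close> is small enough for the root condition. The homomorphism
  \<open>\<Phi>\<close> is kept next to \<open>\<psi>\<close>: later steps read \<open>G\<close> and the first coordinate off the values of \<open>\<psi>\<close>.
\<close>

lemma rep_into_wreath:
  assumes rep: "hnn_rep B H \<phi> (wreath G A) f \<tau>"
    and G: "in_class G \<C>" "group G" and A: "in_class A \<C>" "group A"
  obtains \<Phi> G' \<psi> where "\<C> G'" "group G'" "\<psi> \<in> hom E G'" "\<psi> ` carrier E = carrier G'"
    "hnn_rep B H \<phi> G' (\<psi> \<circ> \<iota>) (\<psi> stable)"
    "\<Phi> \<in> hom E (wreath G A)" "\<forall>b\<in>carrier B. \<Phi> (\<iota> b) = f b" "\<Phi> stable = \<tau>"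
    "\<forall>u\<in>carrier E. \<forall>v\<in>carrier E. \<psi> u = \<psi> v \<longrightarrow>
      snd (\<Phi> u) = snd (\<Phi> v) \<and> fst (\<Phi> u) \<one>\<^bsub>G\<^esub> = fst (\<Phi> v) \<one>\<^bsub>G\<^esub>"
proof -
  obtain e :: "'b hnn_letter list set \<Rightarrow> 'u" where e: "inj_on e (carrier E)"
    by (rule E_embeds_in_universe)
  obtain \<Phi> where P: "\<Phi> \<in> hom E (wreath G A)" "\<And>b. b \<in> carrier B \<Longrightarrow> \<Phi> (\<iota> b) = f b" "\<Phi> stable = \<tau>"
    using E_universal[OF rep] by blast
  obtain G' \<psi> where r: "\<C> G'" "group G'" "\<psi> \<in> hom E G'" "\<psi> ` carrier E = carrier G'"
    "\<And>u v. u \<in> carrier E \<Longrightarrow> v \<in> carrier E \<Longrightarrow> \<psi> u = \<psi> v \<Longrightarrow>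
      snd (\<Phi> u) = snd (\<Phi> v) \<and> fst (\<Phi> u) \<one>\<^bsub>G\<^esub> = fst (\<Phi> v) \<one>\<^bsub>G\<^esub>"
    using wreath_quotient[OF E_group e G A P(1)] by blast
  have "hnn_rep B H \<phi> G' (\<psi> \<circ> \<iota>) (\<psi> stable)"
    by (rule hnn_rep_hom[OF E_rep r(3,2)]) (auto simp: H_sub \<phi>_B)
  then show ?thesis using that[OF r(1-4) _ P(1) _ P(3)] P(2) r(5) by blast
qed

text \<open>
  The covering given by \<open>\<Theta>\<close>, pushed into the class. Of its coordinates only those at \<open>1\<close> and \<open>\<tau>\<close> are
  recorded; these suffice for the kernels that occur below.
\<close>

lemma cover_in_class:
  assumes rep: "hnn_rep B H \<phi> G f \<tau>"
    and G: "in_class G \<C>" "group G" and A: "in_class A \<C>" "group A"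
    and cl: "\<And>x d. x \<in> carrier G \<Longrightarrow> d \<in> kernel B G f \<Longrightarrow> \<Theta> x d \<in> carrier A"
    and hm: "\<And>x d d'. x \<in> carrier G \<Longrightarrow> d \<in> kernel B G f \<Longrightarrow> d' \<in> kernel B G f \<Longrightarrow>
      \<Theta> x (d \<otimes> d') = \<Theta> x d \<otimes>\<^bsub>A\<^esub> \<Theta> x d'"
    and eq: "\<And>x b d. x \<in> carrier G \<Longrightarrow> b \<in> carrier B \<Longrightarrow> d \<in> kernel B G f \<Longrightarrow>
      \<Theta> (x \<otimes>\<^bsub>G\<^esub> f b) d = \<Theta> x (b \<otimes> d \<otimes> inv b)"
    and st: "\<And>x h. x \<in> carrier G \<Longrightarrow> h \<in> H \<Longrightarrow> h \<in> kernel B G f \<Longrightarrow> \<Theta> (x \<otimes>\<^bsub>G\<^esub> \<tau>) (\<phi> h) = \<Theta> x h"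
  obtains G' f' \<tau>' where "\<C> G'" "hnn_rep B H \<phi> G' f' \<tau>'"
    "\<forall>d\<in>carrier B. f' d = \<one>\<^bsub>G'\<^esub> \<longrightarrow>
      d \<in> kernel B G f \<and> \<Theta> \<one>\<^bsub>G\<^esub> d = \<one>\<^bsub>A\<^esub> \<and> \<Theta> \<tau> d = \<one>\<^bsub>A\<^esub>"
proof -
  let ?W = "wreath G A"
  obtain k \<sigma> where cov: "hnn_rep B H \<phi> ?W k \<sigma>"
    "\<And>b. b \<in> carrier B \<Longrightarrow> snd (k b) = f b" "snd \<sigma> = \<tau>"
    "\<And>d x. d \<in> kernel B G f \<Longrightarrow> x \<in> carrier G \<Longrightarrow> fst (k d) x = \<Theta> x d"
    using cover_rep[OF B.group_axioms rep A(2) H_subgroup \<phi>_hom cl hm eq st] by blast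
  obtain \<Phi> G' \<psi> where r: "\<C> G'" "group G'" "\<psi> \<in> hom E G'" "\<psi> ` carrier E = carrier G'"
    "hnn_rep B H \<phi> G' (\<psi> \<circ> \<iota>) (\<psi> stable)"
    "\<Phi> \<in> hom E ?W" "\<forall>b\<in>carrier B. \<Phi> (\<iota> b) = k b" "\<Phi> stable = \<sigma>"
    "\<forall>u\<in>carrier E. \<forall>v\<in>carrier E. \<psi> u = \<psi> v \<longrightarrow>
      snd (\<Phi> u) = snd (\<Phi> v) \<and> fst (\<Phi> u) \<one>\<^bsub>G\<^esub> = fst (\<Phi> v) \<one>\<^bsub>G\<^esub>"
    by (rule rep_into_wreath[OF cov(1) G A])
  interpret E: group E by (rule E_group)
  interpret G: group G by (rule G(2))
  interpret A: group A by (rule A(2))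
  interpret G': group G' by (rule r(2))
  have gW: "group ?W" by (rule wreath_group[OF G(2) A(2)])
  have t: "\<tau> \<in> carrier G" using rep by (simp add: hnn_rep_def)
  have "d \<in> kernel B G f \<and> \<Theta> \<one>\<^bsub>G\<^esub> d = \<one>\<^bsub>A\<^esub> \<and> \<Theta> \<tau> d = \<one>\<^bsub>A\<^esub>"
    if d: "d \<in> carrier B" and k1: "(\<psi> \<circ> \<iota>) d = \<one>\<^bsub>G'\<^esub>" for d
  proof -
    have dE: "\<iota> d \<in> carrier E" by (rule hom_in_carrier[OF \<iota>_hom d])
    have \<Phi>d: "\<Phi> (\<iota> d) = k d" using r(7) d by blast
    have "\<psi> (\<iota> d) = \<psi> \<one>\<^bsub>E\<^esub>" using k1 hom_one[OF r(3) E_group r(2)] by simp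
    then have "snd (k d) = snd (\<Phi> \<one>\<^bsub>E\<^esub>) \<and> fst (k d) \<one>\<^bsub>G\<^esub> = fst (\<Phi> \<one>\<^bsub>E\<^esub>) \<one>\<^bsub>G\<^esub>"
      using r(9) dE E.one_closed \<Phi>d by metis
    then have e: "snd (k d) = \<one>\<^bsub>G\<^esub>" "fst (k d) \<one>\<^bsub>G\<^esub> = \<one>\<^bsub>A\<^esub>"
      using hom_one[OF r(6) E_group gW] by (simp_all add: wreath_simps)
    then have dk: "d \<in> kernel B G f" using cov(2)[OF d] d by (simp add: kernel_def)
    \<comment> \<open>comparing \<open>t d\<close> with \<open>t\<close> at the coordinate \<open>1\<close> reads \<open>d\<close> at the coordinate \<open>\<tau>\<close>\<close>
    have "\<psi> (stable \<otimes>\<^bsub>E\<^esub> \<iota> d) = \<psi> stable"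
      using hom_mult[OF r(3) stable_E dE] k1 hom_in_carrier[OF r(3) stable_E] by simp
    then have "fst (\<Phi> (stable \<otimes>\<^bsub>E\<^esub> \<iota> d)) \<one>\<^bsub>G\<^esub> = fst \<sigma> \<one>\<^bsub>G\<^esub>"
      using r(8,9) stable_E dE E.m_closed by metis
    then have "fst \<sigma> \<one>\<^bsub>G\<^esub> \<otimes>\<^bsub>A\<^esub> fst (k d) \<tau> = fst \<sigma> \<one>\<^bsub>G\<^esub>"
      using hom_mult[OF r(6) stable_E dE] \<Phi>d r(8) cov(3) t by (simp add: wreath_simps)
    moreover have "fst \<sigma> \<one>\<^bsub>G\<^esub> \<in> carrier A"
      using cov(1) G.one_closed by (auto simp: hnn_rep_def wreath_simps)
    moreover have "fst (k d) \<tau> = \<Theta> \<tau> d" by (rule cov(4)[OF dk t])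
    ultimately have "\<Theta> \<tau> d = \<one>\<^bsub>A\<^esub>"
      using A.l_cancel_one[of "fst \<sigma> \<one>\<^bsub>G\<^esub>" "\<Theta> \<tau> d"] cl[OF t dk] by simp
    then show ?thesis using dk e(2) cov(4)[OF dk G.one_closed] by simp
  qed
  then show ?thesis using that[OF r(1,5)] by blast
qed

lemma rep_injI:
  assumes "hnn_rep B H \<phi> G f \<tau>" "\<And>d. d \<in> carrier B \<Longrightarrow> f d = \<one>\<^bsub>G\<^esub> \<Longrightarrow> d = \<one>"
  shows "inj_on f (carrier B)"
  using assms B.group_axioms by (subst inj_on_one_iff'[of f B G]) (auto simp: hnn_rep_def)

lemma class_rep_product:
  fixes G G' :: "'u monoid"
  assumes G: "\<C> G" "hnn_rep B H \<phi> G f \<tau>" and G': "\<C> G'" "hnn_rep B H \<phi> G' f' \<tau>'"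
  obtains P :: "'u monoid" and p \<sigma> where "\<C> P" "hnn_rep B H \<phi> P p \<sigma>"
    "\<And>w b. fst ` set w \<subseteq> carrier B \<Longrightarrow> b \<in> carrier B \<Longrightarrow> syllable_prod P p \<sigma> w = p b \<Longrightarrow>
      syllable_prod G f \<tau> w = f b \<and> syllable_prod G' f' \<tau>' w = f' b"
proof -
  note g = class_group[OF G(1)] class_group[OF G'(1)]
  let ?D = "G \<times>\<times> G'" and ?f = "\<lambda>b. (f b, f' b)" and ?t = "(\<tau>, \<tau>')"
  have gD: "group ?D" by (rule DirProd_group[OF g])
  have rD: "hnn_rep B H \<phi> ?D ?f ?t" by (rule hnn_rep_prod[OF G(2) G'(2)])
  have hD: "?f \<in> hom B ?D" "?t \<in> carrier ?D" using rD by (auto simp: hnn_rep_def)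
  obtain P i where P: "\<C> P" "group P" "i \<in> hom ?D P" "inj_on i (carrier ?D)" "i ` carrier ?D = carrier P"
    by (rule in_classE[OF in_class_DirProd[OF in_classI[OF G(1)] g(1) in_classI[OF G'(1)] g(2)] gD])
  show ?thesis
  proof (rule that[OF P(1)])
    show "hnn_rep B H \<phi> P (i \<circ> ?f) (i ?t)"
      by (rule hnn_rep_hom[OF rD P(3,2)]) (auto simp: H_sub \<phi>_B)
    fix w b assume w: "fst ` set w \<subseteq> carrier B" and b: "b \<in> carrier B"
      and eq: "syllable_prod P (i \<circ> ?f) (i ?t) w = (i \<circ> ?f) b"
    have "i (syllable_prod ?D ?f ?t w) = i (?f b)"
      using eq hom_syllable_prod[OF gD hD P(2,3) w] by simp
    then have D: "syllable_prod ?D ?f ?t w = ?f b"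
      using inj_onD[OF P(4) _ syllable_prod_closed[OF gD hD w] hom_in_carrier[OF hD(1) b]] by simp
    have "fst \<in> hom ?D G" "snd \<in> hom ?D G'" by (auto simp: hom_def)
    then show "syllable_prod G f \<tau> w = f b \<and> syllable_prod G' f' \<tau>' w = f' b"
      using hom_syllable_prod[OF gD hD g(1) _ w, of fst] hom_syllable_prod[OF gD hD g(2) _ w, of snd] D
      by (simp add: comp_def)
  qed
qed

definition separates :: "'u monoid \<Rightarrow> ('b \<Rightarrow> 'u) \<Rightarrow> 'u \<Rightarrow> ('b \<times> bool) list \<Rightarrow> bool" where
  "separates G f \<tau> w \<longleftrightarrow> (\<forall>b\<in>carrier B. syllable_prod G f \<tau> w \<noteq> f b)"

lemma separates_finite:
  assumes "finite W" and "\<And>w. w \<in> W \<Longrightarrow> fst ` set w \<subseteq> carrier B"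
    and "\<And>w. w \<in> W \<Longrightarrow> \<exists>G f \<tau>. \<C> G \<and> hnn_rep B H \<phi> G f \<tau> \<and> separates G f \<tau> w"
    and "\<C> G0" "hnn_rep B H \<phi> G0 f0 \<tau>0" "inj_on f0 (carrier B)"
  shows "\<exists>G f \<tau>. \<C> G \<and> hnn_rep B H \<phi> G f \<tau> \<and> inj_on f (carrier B) \<and> (\<forall>w\<in>W. separates G f \<tau> w)"
  using assms(1-3)
proof (induction W)
  case empty
  then show ?case using assms(4-6) by blast
next
  case (insert w W)
  obtain G f \<tau> where G: "\<C> G" "hnn_rep B H \<phi> G f \<tau>" "inj_on f (carrier B)" "\<forall>w\<in>W. separates G f \<tau> w"
    using insert by (metis insert_iff)
  obtain G' f' \<tau>' where G': "\<C> G'" "hnn_rep B H \<phi> G' f' \<tau>'" "separates G' f' \<tau>' w"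
    using insert.prems(2)[of w] by blast
  obtain P p \<sigma> where P: "\<C> P" "hnn_rep B H \<phi> P p \<sigma>"
    "\<And>w b. fst ` set w \<subseteq> carrier B \<Longrightarrow> b \<in> carrier B \<Longrightarrow> syllable_prod P p \<sigma> w = p b \<Longrightarrow>
      syllable_prod G f \<tau> w = f b \<and> syllable_prod G' f' \<tau>' w = f' b"
    using class_rep_product[OF G(1,2) G'(1,2)] by blast
  interpret f: group_hom B G f
    using G B.group_axioms by (simp add: group_hom_def group_hom_axioms_def hnn_rep_def)
  have "inj_on p (carrier B)"
  proof (rule rep_injI[OF P(2)])
    fix b assume b: "b \<in> carrier B" "p b = \<one>\<^bsub>P\<^esub>"
    have "f b = \<one>\<^bsub>G\<^esub>" using P(3)[of "[]" b] b by simp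
    then show "b = \<one>" using inj_onD[OF G(3), of b \<one>] b by simp
  qed
  moreover have "separates P p \<sigma> v" if "v \<in> insert w W" for v
  proof -
    have "fst ` set v \<subseteq> carrier B" by (rule insert.prems(1)[OF that])
    from P(3)[OF this] show ?thesis using G(4) G'(3) that unfolding separates_def by blast
  qed
  ultimately show ?case using P(1,2) by blast
qed

text \<open>
  Consider a representation that is injective on \<open>B\<close> and separates all shorter reduced words with the same
  syllables. The word describes a path in the graph with vertices \<open>G/B\<close> and edges \<open>G/H\<close>.
  If the first edge were crossed again in the same direction, a proper initial segment of the word
  would return to its starting vertex; if in the opposite direction, the segment strictly between
  the two crossings would do so, or be empty, and then the word would backtrack and not be reduced. So
  the first edge is crossed only once. Labelling it by a non-trivial element \<open>a\<close> of
  a class member, and all other edges trivially, gives the word the label \<open>a\<close> or its inverse, whereas the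
  elements of the base have trivial labels.
\<close>

lemma reduced_word_separated:
  assumes G0: "\<C> G0" "hnn_rep B H \<phi> G0 f0 \<tau>0" "inj_on f0 (carrier B)"
    and "hnn_reduced H K w" "fst ` set w \<subseteq> carrier B" "w \<noteq> []"
  shows "\<exists>G f \<tau>. \<C> G \<and> hnn_rep B H \<phi> G f \<tau> \<and> separates G f \<tau> w"
  using assms(4-6)
proof (induction w rule: length_induct)
  case (1 w)
  obtain b1 s1 w' where w: "w = (b1, s1) # w'" using 1(4) by (metis list.exhaust surj_pair)
  have b1: "b1 \<in> carrier B" and w'B: "fst ` set w' \<subseteq> carrier B" using 1(3) by (auto simp: w)
  define W where "W = {u. u \<noteq> [] \<and> hnn_reduced H K u \<and> set u \<subseteq> set w \<and> length u < length w}"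
  have "finite {u. set u \<subseteq> set w \<and> length u \<le> length w}" by (rule finite_lists_length_le) simp
  then have "finite W" by (rule finite_subset[rotated]) (auto simp: W_def)
  then obtain G f \<tau> where G: "\<C> G" "hnn_rep B H \<phi> G f \<tau>" and inj: "inj_on f (carrier B)"
    and sep: "\<And>u. u \<in> W \<Longrightarrow> separates G f \<tau> u"
    using separates_finite[OF _ _ _ G0, of W] 1(1,3) unfolding W_def by blast
  have gG: "group G" and f: "f \<in> hom B G" and t: "\<tau> \<in> carrier G"
    and ft: "\<And>h. h \<in> H \<Longrightarrow> f h \<otimes>\<^bsub>G\<^esub> \<tau> = \<tau> \<otimes>\<^bsub>G\<^esub> f (\<phi> h)"
    using G(2) by (auto simp: hnn_rep_def)
  interpret f: group_hom B G f
    using gG f B.group_axioms by (simp add: group_hom_def group_hom_axioms_def)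
  interpret E: group E by (rule E_group)
  obtain A a where A: "\<C> A" "a \<in> carrier A" "a \<noteq> \<one>\<^bsub>A\<^esub>" by (rule class_nontrivial)
  have gA: "group A" by (rule class_group[OF A(1)])
  interpret A: group A by (rule gA)
  \<comment> \<open>the first edge, as a left coset of \<open>f ` H\<close> with representative \<open>e\<close>\<close>
  define e where "e = f b1 \<otimes>\<^bsub>G\<^esub> (if s1 then \<one>\<^bsub>G\<^esub> else inv\<^bsub>G\<^esub> \<tau>)"
  have e: "e \<in> carrier G" using b1 t by (simp add: e_def)
  define S where "S = (\<lambda>h. e \<otimes>\<^bsub>G\<^esub> f h) ` H"
  define lab where "lab x = (if x \<in> S then a else \<one>\<^bsub>A\<^esub>)" for x
  have lab: "lab x \<in> carrier A" for x using A(2) by (simp add: lab_def)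
  have SH: "x \<otimes>\<^bsub>G\<^esub> f h \<in> S \<longleftrightarrow> x \<in> S" if x: "x \<in> carrier G" and h: "h \<in> H" for x h
  proof
    assume "x \<in> S"
    then obtain k where "k \<in> H" "x = e \<otimes>\<^bsub>G\<^esub> f k" by (auto simp: S_def)
    moreover from this h have "k \<otimes> h \<in> H" using subgroup.m_closed[OF H_subgroup] by blast
    ultimately show "x \<otimes>\<^bsub>G\<^esub> f h \<in> S" unfolding S_def using h e H_sub
      by (intro image_eqI[of _ _ "k \<otimes> h"]) (auto simp: f.H.m_assoc)
  next
    assume "x \<otimes>\<^bsub>G\<^esub> f h \<in> S"
    then obtain k where k: "k \<in> H" "x \<otimes>\<^bsub>G\<^esub> f h = e \<otimes>\<^bsub>G\<^esub> f k" by (auto simp: S_def)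
    then have "k \<otimes> inv h \<in> H"
      using h subgroup.m_closed[OF H_subgroup] subgroup.m_inv_closed[OF H_subgroup] by blast
    moreover have "x = e \<otimes>\<^bsub>G\<^esub> f (k \<otimes> inv h)"
    proof -
      have "x = e \<otimes>\<^bsub>G\<^esub> f k \<otimes>\<^bsub>G\<^esub> inv\<^bsub>G\<^esub> (f h)"
        using k x h e H_sub by (intro f.H.inv_solve_right[THEN iffD2]) auto
      then show ?thesis using k h e H_sub by (simp add: f.H.m_assoc)
    qed
    ultimately show "x \<in> S" unfolding S_def by blast
  qed
  let ?f = "\<lambda>b. (\<lambda>x\<in>carrier G. \<one>\<^bsub>A\<^esub>, f b)" and ?t = "(\<lambda>x\<in>carrier G. lab x, \<tau>)"
  have tW: "?t \<in> carrier (wreath G A)" using lab t by (auto simp: wreath_simps)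
  have rep: "hnn_rep B H \<phi> (wreath G A) ?f ?t"
    unfolding hnn_rep_def
  proof (intro conjI ballI)
    show "group (wreath G A)" by (rule wreath_group[OF gG gA])
    show "?f \<in> hom B (wreath G A)"
      by (rule homI) (auto simp: wreath_simps prod_eq_iff intro!: restrict_ext)
    show "?t \<in> carrier (wreath G A)" by (rule tW)
    show "?f h \<otimes>\<^bsub>wreath G A\<^esub> ?t = ?t \<otimes>\<^bsub>wreath G A\<^esub> ?f (\<phi> h)" if h: "h \<in> H" for h
      using h H_sub t ft lab SH
      by (auto simp: wreath_simps prod_eq_iff lab_def intro!: restrict_ext)
  qed
  let ?x0 = "f b1 \<otimes>\<^bsub>G\<^esub> (if s1 then \<tau> else inv\<^bsub>G\<^esub> \<tau>)"
  have x0: "?x0 \<in> carrier G" using b1 t by simp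
  have off: "?x0 \<otimes>\<^bsub>G\<^esub> syllable_prod G f \<tau> u \<otimes>\<^bsub>G\<^esub> f b \<otimes>\<^bsub>G\<^esub> (if s then \<one>\<^bsub>G\<^esub> else inv\<^bsub>G\<^esub> \<tau>) \<notin> S"
    if w': "w' = u @ (b, s) # v" for u b s v
  proof
    let ?P = "syllable_prod G f \<tau> u"
    assume "?x0 \<otimes>\<^bsub>G\<^esub> ?P \<otimes>\<^bsub>G\<^esub> f b \<otimes>\<^bsub>G\<^esub> (if s then \<one>\<^bsub>G\<^esub> else inv\<^bsub>G\<^esub> \<tau>) \<in> S"
    then obtain h where h: "h \<in> H"
      "?x0 \<otimes>\<^bsub>G\<^esub> ?P \<otimes>\<^bsub>G\<^esub> f b \<otimes>\<^bsub>G\<^esub> (if s then \<one>\<^bsub>G\<^esub> else inv\<^bsub>G\<^esub> \<tau>) = e \<otimes>\<^bsub>G\<^esub> f h"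
      by (auto simp: S_def)
    have b: "b \<in> carrier B" and uB: "fst ` set u \<subseteq> carrier B" using w'B by (auto simp: w')
    have P: "?P \<in> carrier G" by (rule syllable_prod_closed[OF gG f t uB])
    have hB: "h \<in> carrier B" "\<phi> h \<in> carrier B" using h H_sub \<phi>_B by auto
    have red: "hnn_reduced H K ((b1, s1) # u)" "hnn_reduced H K u"
      using 1(2) hnn_reduced_appendD[of H K "(b1, s1) # u" "(b, s) # v"] hnn_reduced_Cons
      by (auto simp: w w')
    have "(b1, s1) # u \<in> W" using red by (auto simp: W_def w w')
    then have sep1: "syllable_prod G f \<tau> ((b1, s1) # u) \<noteq> f c" if "c \<in> carrier B" for c
      using sep that unfolding separates_def by blast
    have "u \<noteq> [] \<Longrightarrow> u \<in> W" using red by (auto simp: W_def w w')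
    then have sep2: "u = []" if "?P = f c" "c \<in> carrier B" for c
      using sep that unfolding separates_def by blast
    have tft: "inv\<^bsub>G\<^esub> \<tau> \<otimes>\<^bsub>G\<^esub> f h \<otimes>\<^bsub>G\<^esub> \<tau> = f (\<phi> h)"
      using ft[OF h(1)] t hB by (simp add: f.H.m_assoc f.H.inv_mult_cancel)
    have cancel: "Q = R \<otimes>\<^bsub>G\<^esub> inv\<^bsub>G\<^esub> (f b)" if "Q \<otimes>\<^bsub>G\<^esub> f b = R" "Q \<in> carrier G" "R \<in> carrier G" for Q R
      using that b by (intro f.H.inv_solve_right[THEN iffD2]) auto
    consider "s1" "s" | "\<not> s1" "\<not> s" | "s1" "\<not> s" | "\<not> s1" "s" by blast
    then show False
    proof cases
      case 1
      have "?x0 \<otimes>\<^bsub>G\<^esub> ?P \<otimes>\<^bsub>G\<^esub> f b = f b1 \<otimes>\<^bsub>G\<^esub> f h"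
        using h(2) 1 b1 hB P x0 b t by (simp add: e_def)
      then have "?x0 \<otimes>\<^bsub>G\<^esub> ?P = f b1 \<otimes>\<^bsub>G\<^esub> f h \<otimes>\<^bsub>G\<^esub> inv\<^bsub>G\<^esub> (f b)"
        by (rule cancel) (use P x0 b1 hB in auto)
      then show False using sep1[of "b1 \<otimes> h \<otimes> inv b"] b1 hB b by simp
    next
      case 2
      have "?x0 \<otimes>\<^bsub>G\<^esub> ?P \<otimes>\<^bsub>G\<^esub> f b \<otimes>\<^bsub>G\<^esub> inv\<^bsub>G\<^esub> \<tau> = f b1 \<otimes>\<^bsub>G\<^esub> inv\<^bsub>G\<^esub> \<tau> \<otimes>\<^bsub>G\<^esub> f h"
        using h(2) 2 by (simp add: e_def)
      then have "?x0 \<otimes>\<^bsub>G\<^esub> ?P \<otimes>\<^bsub>G\<^esub> f b = f b1 \<otimes>\<^bsub>G\<^esub> inv\<^bsub>G\<^esub> \<tau> \<otimes>\<^bsub>G\<^esub> f h \<otimes>\<^bsub>G\<^esub> \<tau>"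
        using P x0 b b1 hB t
        by (metis f.H.inv_closed f.H.inv_solve_right' f.H.m_closed f.hom_closed f.H.inv_inv)
      also have "\<dots> = f b1 \<otimes>\<^bsub>G\<^esub> f (\<phi> h)" using tft b1 hB t by (simp add: f.H.m_assoc)
      finally have "?x0 \<otimes>\<^bsub>G\<^esub> ?P = f b1 \<otimes>\<^bsub>G\<^esub> f (\<phi> h) \<otimes>\<^bsub>G\<^esub> inv\<^bsub>G\<^esub> (f b)"
        by (rule cancel) (use P x0 b1 hB in auto)
      then show False using sep1[of "b1 \<otimes> \<phi> h \<otimes> inv b"] b1 hB b by simp
    next
      case 3
      have "f b1 \<otimes>\<^bsub>G\<^esub> (\<tau> \<otimes>\<^bsub>G\<^esub> ?P \<otimes>\<^bsub>G\<^esub> f b \<otimes>\<^bsub>G\<^esub> inv\<^bsub>G\<^esub> \<tau>) = f b1 \<otimes>\<^bsub>G\<^esub> f h"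
        using h(2) 3 b1 hB P b t by (simp add: e_def f.H.m_assoc)
      then have "\<tau> \<otimes>\<^bsub>G\<^esub> ?P \<otimes>\<^bsub>G\<^esub> f b \<otimes>\<^bsub>G\<^esub> inv\<^bsub>G\<^esub> \<tau> = f h" using b1 hB P b t by simp
      then have "\<tau> \<otimes>\<^bsub>G\<^esub> ?P \<otimes>\<^bsub>G\<^esub> f b = f h \<otimes>\<^bsub>G\<^esub> \<tau>"
        using P b hB t
        by (metis f.H.inv_closed f.H.inv_solve_right' f.H.m_closed f.hom_closed f.H.inv_inv)
      then have "\<tau> \<otimes>\<^bsub>G\<^esub> (?P \<otimes>\<^bsub>G\<^esub> f b) = \<tau> \<otimes>\<^bsub>G\<^esub> f (\<phi> h)" using ft[OF h(1)] P b t by (simp add: f.H.m_assoc)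
      then have eq: "?P \<otimes>\<^bsub>G\<^esub> f b = f (\<phi> h)" using P b hB t by simp
      then have "?P = f (\<phi> h) \<otimes>\<^bsub>G\<^esub> inv\<^bsub>G\<^esub> (f b)" by (rule cancel) (use P hB in auto)
      then have u: "u = []" using sep2[of "\<phi> h \<otimes> inv b"] hB b by simp
      then have "f b = f (\<phi> h)" using eq b by simp
      then have "b = \<phi> h" using inj b hB by (simp add: inj_on_eq_iff)
      then show False using 1(2) 3 u \<phi>_K[OF h(1)] by (simp add: w w')
    next
      case 4
      have "f b1 \<otimes>\<^bsub>G\<^esub> (inv\<^bsub>G\<^esub> \<tau> \<otimes>\<^bsub>G\<^esub> (?P \<otimes>\<^bsub>G\<^esub> f b)) = f b1 \<otimes>\<^bsub>G\<^esub> (inv\<^bsub>G\<^esub> \<tau> \<otimes>\<^bsub>G\<^esub> f h)"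
        using h(2) 4 b1 hB P b t by (simp add: e_def f.H.m_assoc)
      then have eq: "?P \<otimes>\<^bsub>G\<^esub> f b = f h" using b1 hB P b t by simp
      then have "?P = f h \<otimes>\<^bsub>G\<^esub> inv\<^bsub>G\<^esub> (f b)" by (rule cancel) (use P hB in auto)
      then have u: "u = []" using sep2[of "h \<otimes> inv b"] hB b by simp
      then have "f b = f h" using eq b by simp
      then have "b = h" using inj b hB by (simp add: inj_on_eq_iff)
      then show False using 1(2) 4 u h(1) by (simp add: w w')
    qed
  qed
  have rest: "fst (syllable_prod (wreath G A) ?f ?t w') ?x0 = \<one>\<^bsub>A\<^esub>"
    by (rule wreath_label_trivial[OF gG gA f t lab w'B x0]) (use off in \<open>simp add: lab_def\<close>)
  have "e = e \<otimes>\<^bsub>G\<^esub> f \<one>" using e by simp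
  then have "e \<in> S" unfolding S_def using subgroup.one_closed[OF H_subgroup] by blast
  then have labe: "lab e = a" by (simp add: lab_def)
  have first: "fst (syllable_prod (wreath G A) ?f ?t w) \<one>\<^bsub>G\<^esub> \<noteq> \<one>\<^bsub>A\<^esub>"
  proof -
    define F T where "F = ?f" and "T = ?t"
    have T: "snd T = \<tau>" "\<And>z. z \<in> carrier G \<Longrightarrow> fst T z = lab z"
      and F: "snd (F b) = f b" "\<And>z. z \<in> carrier G \<Longrightarrow> fst (F b) z = \<one>\<^bsub>A\<^esub>" for b
      by (simp_all add: F_def T_def)
    have TW: "T \<in> carrier (wreath G A)" using tW by (simp add: T_def)
    have "fst (syllable_prod (wreath G A) F T w) \<one>\<^bsub>G\<^esub> = (if s1 then a else inv\<^bsub>A\<^esub> a)"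
    proof (cases s1)
      case True
      then show ?thesis using rest[folded F_def T_def] labe A(2) b1 t
        by (simp add: w wreath_simps T F e_def)
    next
      case False
      then show ?thesis using rest[folded F_def T_def] labe A(2) b1 t
        by (simp add: w wreath_simps T F e_def f.H.wreath_inv[OF gA TW])
    qed
    then show ?thesis using A(2,3) unfolding F_def T_def by (auto simp: A.inv_eq_1_iff)
  qed
  obtain \<Phi> G' \<psi> where r: "\<C> G'" "group G'" "\<psi> \<in> hom E G'" "\<psi> ` carrier E = carrier G'"
    "hnn_rep B H \<phi> G' (\<psi> \<circ> \<iota>) (\<psi> stable)"
    "\<Phi> \<in> hom E (wreath G A)" "\<forall>b\<in>carrier B. \<Phi> (\<iota> b) = ?f b" "\<Phi> stable = ?t"
    "\<forall>u\<in>carrier E. \<forall>v\<in>carrier E. \<psi> u = \<psi> v \<longrightarrow>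
      snd (\<Phi> u) = snd (\<Phi> v) \<and> fst (\<Phi> u) \<one>\<^bsub>G\<^esub> = fst (\<Phi> v) \<one>\<^bsub>G\<^esub>"
    by (rule rep_into_wreath[OF rep in_classI[OF G(1)] gG in_classI[OF A(1)] gA])
  have "separates G' (\<psi> \<circ> \<iota>) (\<psi> stable) w"
    unfolding separates_def
  proof (intro ballI notI)
    fix b assume b: "b \<in> carrier B" and eq: "syllable_prod G' (\<psi> \<circ> \<iota>) (\<psi> stable) w = (\<psi> \<circ> \<iota>) b"
    let ?s = "syllable_prod E \<iota> stable w"
    have s: "?s \<in> carrier E" by (rule syllable_prod_closed[OF E_group \<iota>_hom stable_E 1(3)])
    have "\<psi> ?s = \<psi> (\<iota> b)" using eq hom_syllable_prod[OF E_group \<iota>_hom stable_E r(2,3) 1(3)] by simp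
    then have "fst (\<Phi> ?s) \<one>\<^bsub>G\<^esub> = fst (\<Phi> (\<iota> b)) \<one>\<^bsub>G\<^esub>"
      using r(9) s hom_in_carrier[OF \<iota>_hom b] by blast
    moreover have "\<Phi> ?s = syllable_prod (wreath G A) ?f ?t w"
      using hom_syllable_prod[OF E_group \<iota>_hom stable_E wreath_group[OF gG gA] r(6) 1(3)]
        syllable_prod_cong[of w "\<Phi> \<circ> \<iota>" ?f "wreath G A" ?t] r(7,8) 1(3) by auto
    ultimately show False using first r(7) b by simp
  qed
  then show ?case using r(1,5) by blast
qed

end

section \<open>Groups of automorphisms in the class\<close>

definition aut_action :: "('q, 'n) monoid_scheme \<Rightarrow> ('a, 'm) monoid_scheme \<Rightarrow> ('q \<Rightarrow> 'a \<Rightarrow> 'a) \<Rightarrow> bool" where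
  "aut_action Q X \<alpha> \<longleftrightarrow>
    (\<forall>q\<in>carrier Q. \<forall>x\<in>carrier X. \<alpha> q x \<in> carrier X) \<and>
    (\<forall>q\<in>carrier Q. \<forall>x\<in>carrier X. \<forall>y\<in>carrier X. \<alpha> q (x \<otimes>\<^bsub>X\<^esub> y) = \<alpha> q x \<otimes>\<^bsub>X\<^esub> \<alpha> q y) \<and>
    (\<forall>p\<in>carrier Q. \<forall>q\<in>carrier Q. \<forall>x\<in>carrier X. \<alpha> (p \<otimes>\<^bsub>Q\<^esub> q) x = \<alpha> p (\<alpha> q x)) \<and>
    (\<forall>x\<in>carrier X. \<alpha> \<one>\<^bsub>Q\<^esub> x = x)"

lemma AutoGroup_mem: "\<sigma> \<in> carrier (AutoGroup X) \<longleftrightarrow>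
    \<sigma> \<in> extensional (carrier X) \<and> bij_betw \<sigma> (carrier X) (carrier X) \<and> \<sigma> \<in> hom X X"
  by (auto simp: AutoGroup_def auto_def Bij_def)

lemma AutoGroup_mult:
  assumes "\<sigma> \<in> carrier (AutoGroup X)" "\<sigma>' \<in> carrier (AutoGroup X)"
  shows "\<sigma> \<otimes>\<^bsub>AutoGroup X\<^esub> \<sigma>' = compose (carrier X) \<sigma> \<sigma>'"
  using assms by (auto simp: AutoGroup_mem) (auto simp: AutoGroup_def BijGroup_def Bij_def)

lemma AutoGroup_restrictI:
  assumes "\<And>x. x \<in> carrier X \<Longrightarrow> a x \<in> carrier X" "\<And>x. x \<in> carrier X \<Longrightarrow> a' x \<in> carrier X"
    "\<And>x. x \<in> carrier X \<Longrightarrow> a (a' x) = x" "\<And>x. x \<in> carrier X \<Longrightarrow> a' (a x) = x"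
    "\<And>x y. x \<in> carrier X \<Longrightarrow> y \<in> carrier X \<Longrightarrow> a (x \<otimes>\<^bsub>X\<^esub> y) = a x \<otimes>\<^bsub>X\<^esub> a y"
    "group X"
  shows "restrict a (carrier X) \<in> carrier (AutoGroup X)"
proof -
  interpret group X by fact
  have "bij_betw (restrict a (carrier X)) (carrier X) (carrier X)"
    by (rule bij_betwI[of _ _ _ a']) (use assms in auto)
  moreover have "restrict a (carrier X) \<in> hom X X" by (rule homI) (use assms in auto)
  ultimately show ?thesis by (simp add: AutoGroup_mem)
qed

lemma aut_action_hom:
  assumes "group Q" "group X" and a: "aut_action Q X \<alpha>"
  shows "(\<lambda>q. restrict (\<alpha> q) (carrier X)) \<in> hom Q (AutoGroup X)"
proof -
  interpret Q: group Q by fact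
  have c: "restrict (\<alpha> q) (carrier X) \<in> carrier (AutoGroup X)" if q: "q \<in> carrier Q" for q
  proof (rule AutoGroup_restrictI[where a' = "\<alpha> (inv\<^bsub>Q\<^esub> q)"])
    fix x assume x: "x \<in> carrier X"
    have "\<alpha> (q \<otimes>\<^bsub>Q\<^esub> inv\<^bsub>Q\<^esub> q) x = x" "\<alpha> (inv\<^bsub>Q\<^esub> q \<otimes>\<^bsub>Q\<^esub> q) x = x"
      using a q x by (simp_all add: aut_action_def)
    then show "\<alpha> q (\<alpha> (inv\<^bsub>Q\<^esub> q) x) = x" "\<alpha> (inv\<^bsub>Q\<^esub> q) (\<alpha> q x) = x"
      using a q x Q.inv_closed[OF q] unfolding aut_action_def by metis+
  qed (use a q assms(2) in \<open>auto simp: aut_action_def\<close>)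
  show ?thesis
  proof (rule homI[OF c])
    fix p q assume pq: "p \<in> carrier Q" "q \<in> carrier Q"
    show "restrict (\<alpha> (p \<otimes>\<^bsub>Q\<^esub> q)) (carrier X) =
        restrict (\<alpha> p) (carrier X) \<otimes>\<^bsub>AutoGroup X\<^esub> restrict (\<alpha> q) (carrier X)"
      unfolding AutoGroup_mult[OF c[OF pq(1)] c[OF pq(2)]]
      using a pq by (auto simp: aut_action_def compose_def intro!: restrict_ext)
  qed auto
qed

context root_quotient_class
begin

text \<open>
  The elements of \<open>Q\<close> whose action lies in the generated group form a subgroup, of which the generated
  group is a quotient.
\<close>

lemma generated_auts_in_class:
  assumes Q: "in_class Q \<C>" "group Q" and X: "group (B\<lparr>carrier := Y\<rparr>)"
    and a: "aut_action Q (B\<lparr>carrier := Y\<rparr>) \<alpha>"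
    and S: "\<And>\<sigma>. \<sigma> \<in> S \<Longrightarrow> \<exists>q\<in>carrier Q. \<sigma> = restrict (\<alpha> q) Y"
  shows "in_class (generated_auts B Y S) \<C>"
proof -
  let ?A = "AutoGroup (B\<lparr>carrier := Y\<rparr>)" and ?r = "\<lambda>q. restrict (\<alpha> q) Y"
  have gA: "group ?A" by (rule group.AutoGroup[OF X])
  have r: "?r \<in> hom Q ?A" using aut_action_hom[OF Q(2) X a] by simp
  interpret r: group_hom Q ?A ?r using gA Q(2) r by (simp add: group_hom_def group_hom_axioms_def)
  have Si: "S \<subseteq> ?r ` carrier Q" using S by blast
  then have SA: "S \<subseteq> carrier ?A" using r by (auto simp: hom_def)
  have g: "subgroup (generate ?A S) ?A" by (rule r.H.generate_is_subgroup[OF SA])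
  have gi: "generate ?A S \<subseteq> ?r ` carrier Q"
    by (rule r.H.generate_subgroup_incl[OF Si r.img_is_subgroup])
  define P where "P = {q \<in> carrier Q. ?r q \<in> generate ?A S}"
  have P: "subgroup P Q"
  proof (rule subgroup.intro)
    fix x y assume "x \<in> P" "y \<in> P"
    then show "x \<otimes>\<^bsub>Q\<^esub> y \<in> P" using subgroup.m_closed[OF g] by (auto simp: P_def r.hom_mult)
  next
    show "\<one>\<^bsub>Q\<^esub> \<in> P" using subgroup.one_closed[OF g] r.hom_one by (simp add: P_def)
    fix x assume "x \<in> P"
    then show "inv\<^bsub>Q\<^esub> x \<in> P" using subgroup.m_inv_closed[OF g] r.hom_inv by (auto simp: P_def)
  qed (auto simp: P_def)
  have "in_class (Q\<lparr>carrier := P\<rparr>) \<C>" by (rule in_class_subgroup[OF Q P])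
  then show ?thesis
  proof (rule in_class_hom_onto)
    show "group (Q\<lparr>carrier := P\<rparr>)" by (rule subgroup.subgroup_is_group[OF P Q(2)])
    show "group (generated_auts B Y S)"
      unfolding generated_auts_def by (rule subgroup.subgroup_is_group[OF g gA])
    show "?r \<in> hom (Q\<lparr>carrier := P\<rparr>) (generated_auts B Y S)"
      by (rule homI) (auto simp: P_def generated_auts_def r.hom_mult)
    show "?r ` carrier (Q\<lparr>carrier := P\<rparr>) = carrier (generated_auts B Y S)"
      using gi by (auto simp: P_def generated_auts_def)
  qed
qed

text \<open>Conversely, a member isomorphic to the generated group acts faithfully through the isomorphism.\<close>

lemma generated_auts_action:
  assumes c: "in_class (generated_auts B Y S) \<C>" and X: "group (B\<lparr>carrier := Y\<rparr>)"
    and S: "S \<subseteq> carrier (AutoGroup (B\<lparr>carrier := Y\<rparr>))"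
  obtains Q \<alpha> where "\<C> Q" "group Q" "aut_action Q (B\<lparr>carrier := Y\<rparr>) \<alpha>"
    "\<forall>p\<in>carrier Q. \<forall>q\<in>carrier Q. (\<forall>y\<in>Y. \<alpha> p y = \<alpha> q y) \<longrightarrow> p = q"
    "\<forall>\<sigma>\<in>S. \<exists>q\<in>carrier Q. \<forall>y\<in>Y. \<alpha> q y = \<sigma> y"
proof -
  let ?A = "AutoGroup (B\<lparr>carrier := Y\<rparr>)" and ?U = "generated_auts B Y S"
  interpret A: group ?A by (rule group.AutoGroup[OF X])
  have U: "subgroup (generate ?A S) ?A" by (rule A.generate_is_subgroup[OF S])
  have gU: "group ?U" unfolding generated_auts_def by (rule subgroup.subgroup_is_group[OF U A.group_axioms])
  have UA: "carrier ?U \<subseteq> carrier ?A" using subgroup.subset[OF U] by (simp add: generated_auts_def)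
  obtain Q \<alpha> where Q: "\<C> Q" and i: "\<alpha> \<in> iso Q ?U" using c by (auto simp: in_class_def is_iso_def)
  have gQ: "group Q" by (rule class_group[OF Q])
  interpret i: group_hom Q ?U \<alpha> using gQ gU i by (simp add: group_hom_def group_hom_axioms_def iso_def)
  have aA: "\<alpha> q \<in> carrier ?A" if "q \<in> carrier Q" for q using UA i.hom_closed[OF that] by blast
  have am: "\<alpha> (p \<otimes>\<^bsub>Q\<^esub> q) = compose Y (\<alpha> p) (\<alpha> q)" if "p \<in> carrier Q" "q \<in> carrier Q" for p q
    using AutoGroup_mult[OF aA[OF that(1)] aA[OF that(2)]] i.hom_mult[OF that]
    by (simp add: generated_auts_def)
  have ao: "\<alpha> \<one>\<^bsub>Q\<^esub> = (\<lambda>y\<in>Y. y)"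
    using i.hom_one by (simp add: generated_auts_def AutoGroup_def BijGroup_def)
  show ?thesis
  proof (rule that[OF Q gQ])
    show "aut_action Q (B\<lparr>carrier := Y\<rparr>) \<alpha>"
      unfolding aut_action_def
    proof (intro conjI ballI)
      fix q x y assume q: "q \<in> carrier Q" and x: "x \<in> carrier (B\<lparr>carrier := Y\<rparr>)"
        and y: "y \<in> carrier (B\<lparr>carrier := Y\<rparr>)"
      have h: "\<alpha> q \<in> hom (B\<lparr>carrier := Y\<rparr>) (B\<lparr>carrier := Y\<rparr>)" using aA[OF q] by (simp add: AutoGroup_mem)
      show "\<alpha> q (x \<otimes>\<^bsub>B\<lparr>carrier := Y\<rparr>\<^esub> y) = \<alpha> q x \<otimes>\<^bsub>B\<lparr>carrier := Y\<rparr>\<^esub> \<alpha> q y"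
        by (rule hom_mult[OF h x y])
    next
      fix q x assume q: "q \<in> carrier Q" and x: "x \<in> carrier (B\<lparr>carrier := Y\<rparr>)"
      have h: "\<alpha> q \<in> hom (B\<lparr>carrier := Y\<rparr>) (B\<lparr>carrier := Y\<rparr>)" using aA[OF q] by (simp add: AutoGroup_mem)
      show "\<alpha> q x \<in> carrier (B\<lparr>carrier := Y\<rparr>)" by (rule hom_in_carrier[OF h x])
    qed (auto simp: am ao compose_def simp del: i.hom_mult i.hom_one)
    show "\<forall>p\<in>carrier Q. \<forall>q\<in>carrier Q. (\<forall>y\<in>Y. \<alpha> p y = \<alpha> q y) \<longrightarrow> p = q"
    proof (intro ballI impI)
      fix p q assume pq: "p \<in> carrier Q" "q \<in> carrier Q" and eq: "\<forall>y\<in>Y. \<alpha> p y = \<alpha> q y"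
      have "\<alpha> p = \<alpha> q"
        by (rule extensionalityI[of _ Y]) (use aA pq eq in \<open>auto simp: AutoGroup_mem\<close>)
      then show "p = q" using i pq by (auto simp: iso_def bij_betw_def inj_on_def)
    qed
    show "\<forall>\<sigma>\<in>S. \<exists>q\<in>carrier Q. \<forall>y\<in>Y. \<alpha> q y = \<sigma> y"
    proof
      fix \<sigma> assume "\<sigma> \<in> S"
      then have "\<sigma> \<in> \<alpha> ` carrier Q"
        using i generate.incl[of \<sigma> S ?A] by (auto simp: iso_def bij_betw_def generated_auts_def)
      then show "\<exists>q\<in>carrier Q. \<forall>y\<in>Y. \<alpha> q y = \<sigma> y" by auto
    qed
  qed
qed

text \<open>Faithfulness makes the acting elements unique, hence their choice multiplicative.\<close>

lemma faithful_action_hom: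
  assumes Q: "group Q" and a: "aut_action Q (B\<lparr>carrier := Y\<rparr>) \<alpha>"
    and faithful: "\<forall>p\<in>carrier Q. \<forall>q\<in>carrier Q. (\<forall>y\<in>Y. \<alpha> p y = \<alpha> q y) \<longrightarrow> p = q"
    and ex: "\<And>b. b \<in> carrier B \<Longrightarrow> \<exists>q\<in>carrier Q. \<forall>y\<in>Y. \<alpha> q y = \<kappa> b y"
    and mult: "\<And>b c y. b \<in> carrier B \<Longrightarrow> c \<in> carrier B \<Longrightarrow> b \<otimes>\<^bsub>B\<^esub> c \<in> carrier B \<and>
      (y \<in> Y \<longrightarrow> \<kappa> (b \<otimes>\<^bsub>B\<^esub> c) y = \<kappa> b (\<kappa> c y))"
  obtains u where "u \<in> hom B Q" "\<forall>b\<in>carrier B. \<forall>y\<in>Y. \<alpha> (u b) y = \<kappa> b y"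
proof -
  have "\<forall>b\<in>carrier B. \<exists>q. q \<in> carrier Q \<and> (\<forall>y\<in>Y. \<alpha> q y = \<kappa> b y)" using ex by blast
  then obtain u where u: "\<forall>b\<in>carrier B. u b \<in> carrier Q \<and> (\<forall>y\<in>Y. \<alpha> (u b) y = \<kappa> b y)"
    by (rule bchoice[THEN exE])
  have "u \<in> hom B Q"
  proof (rule homI)
    fix b c assume bc: "b \<in> carrier B" "c \<in> carrier B"
    have q: "u b \<otimes>\<^bsub>Q\<^esub> u c \<in> carrier Q" "u (b \<otimes>\<^bsub>B\<^esub> c) \<in> carrier Q"
      using u bc mult[OF bc] Q by (auto simp: group.is_monoid monoid.m_closed)
    have "\<alpha> (u (b \<otimes>\<^bsub>B\<^esub> c)) y = \<alpha> (u b \<otimes>\<^bsub>Q\<^esub> u c) y" if y: "y \<in> Y" for y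
    proof -
      have "\<kappa> c y \<in> Y" using a u bc(2) y unfolding aut_action_def by force
      then show ?thesis using a u bc mult[OF bc] y by (simp add: aut_action_def)
    qed
    then show "u (b \<otimes>\<^bsub>B\<^esub> c) = u b \<otimes>\<^bsub>Q\<^esub> u c" using faithful q by blast
  qed (use u in auto)
  then show ?thesis using that u by blast
qed

text \<open>
  Automorphisms that preserve the kernel of \<open>f\<close> induce automorphisms of the image. A class member acting on \<open>Y\<close>
  is first restricted to the stabiliser of the kernel of \<open>f\<close>, which contains all lifts of \<open>S1\<close>.
\<close>

lemma generated_auts_quotient:
  assumes c: "in_class (generated_auts B Y S) \<C>" and X: "group (B\<lparr>carrier := Y\<rparr>)"
    and S: "S \<subseteq> carrier (AutoGroup (B\<lparr>carrier := Y\<rparr>))"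
    and X1: "group (B1\<lparr>carrier := Y1\<rparr>)" and S1: "S1 \<subseteq> carrier (AutoGroup (B1\<lparr>carrier := Y1\<rparr>))"
    and f: "f \<in> hom (B\<lparr>carrier := Y\<rparr>) (B1\<lparr>carrier := Y1\<rparr>)" "f ` Y = Y1"
    and S1S: "\<And>\<sigma>1. \<sigma>1 \<in> S1 \<Longrightarrow> \<exists>\<sigma>\<in>S. \<forall>y\<in>Y. \<sigma>1 (f y) = f (\<sigma> y)"
  shows "in_class (generated_auts B1 Y1 S1) \<C>"
proof -
  let ?X = "B\<lparr>carrier := Y\<rparr>" and ?X1 = "B1\<lparr>carrier := Y1\<rparr>"
  interpret f: group_hom ?X ?X1 f using X X1 f by (simp add: group_hom_def group_hom_axioms_def)
  obtain Q \<alpha> where Q: "\<C> Q" "group Q" and a: "aut_action Q ?X \<alpha>"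
    and "\<forall>p\<in>carrier Q. \<forall>q\<in>carrier Q. (\<forall>y\<in>Y. \<alpha> p y = \<alpha> q y) \<longrightarrow> p = q"
    and aS: "\<forall>\<sigma>\<in>S. \<exists>q\<in>carrier Q. \<forall>y\<in>Y. \<alpha> q y = \<sigma> y"
    by (rule generated_auts_action[OF c X S])
  interpret Q: group Q by (rule Q(2))
  have aY: "\<alpha> q y \<in> Y" if "q \<in> carrier Q" "y \<in> Y" for q y using a that by (simp add: aut_action_def)
  have a1: "\<alpha> \<one>\<^bsub>Q\<^esub> y = y" if "y \<in> Y" for y using a that by (simp add: aut_action_def)
  have aq: "\<alpha> (p \<otimes>\<^bsub>Q\<^esub> q) y = \<alpha> p (\<alpha> q y)" if "p \<in> carrier Q" "q \<in> carrier Q" "y \<in> Y" for p q y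
    using a that by (simp add: aut_action_def)
  have ah: "\<alpha> q (x \<otimes>\<^bsub>B\<^esub> y) = \<alpha> q x \<otimes>\<^bsub>B\<^esub> \<alpha> q y" if "q \<in> carrier Q" "x \<in> Y" "y \<in> Y" for q x y
    using a that by (simp add: aut_action_def)
  have fY: "f y \<in> Y1" if "y \<in> Y" for y using f(2) that by blast
  have fm: "f (x \<otimes>\<^bsub>B\<^esub> y) = f x \<otimes>\<^bsub>B1\<^esub> f y" if "x \<in> Y" "y \<in> Y" for x y
    using f.hom_mult[of x y] that by simp
  define P where "P = {q \<in> carrier Q. \<forall>y\<in>Y. f y = \<one>\<^bsub>B1\<^esub> \<longleftrightarrow> f (\<alpha> q y) = \<one>\<^bsub>B1\<^esub>}"
  have P: "subgroup P Q"
  proof (rule subgroup.intro)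
    show "P \<subseteq> carrier Q" by (auto simp: P_def)
    show "\<one>\<^bsub>Q\<^esub> \<in> P" using a1 by (auto simp: P_def)
    fix x assume x: "x \<in> P"
    then have xQ: "x \<in> carrier Q" by (simp add: P_def)
    show "inv\<^bsub>Q\<^esub> x \<in> P" unfolding P_def
    proof (intro CollectI conjI ballI)
      fix y assume y: "y \<in> Y"
      have z: "\<alpha> (inv\<^bsub>Q\<^esub> x) y \<in> Y" "\<alpha> x (\<alpha> (inv\<^bsub>Q\<^esub> x) y) = y"
        using aY[of "inv\<^bsub>Q\<^esub> x" y] aq[of x "inv\<^bsub>Q\<^esub> x" y] a1[OF y] xQ y by auto
      have "f (\<alpha> (inv\<^bsub>Q\<^esub> x) y) = \<one>\<^bsub>B1\<^esub> \<longleftrightarrow> f (\<alpha> x (\<alpha> (inv\<^bsub>Q\<^esub> x) y)) = \<one>\<^bsub>B1\<^esub>"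
        using x z(1) by (simp add: P_def)
      then show "f y = \<one>\<^bsub>B1\<^esub> \<longleftrightarrow> f (\<alpha> (inv\<^bsub>Q\<^esub> x) y) = \<one>\<^bsub>B1\<^esub>" using z(2) by simp
    qed (use xQ in auto)
    fix y assume "y \<in> P"
    with x show "x \<otimes>\<^bsub>Q\<^esub> y \<in> P" by (auto simp: P_def aq aY)
  qed
  define \<beta> where "\<beta> q z = f (\<alpha> q (inv_into Y f z))" for q z
  have b: "\<beta> q (f y) = f (\<alpha> q y)" if q: "q \<in> P" and y: "y \<in> Y" for q y
  proof -
    let ?y = "inv_into Y f (f y)"
    have y': "?y \<in> Y" "f ?y = f y" using y by (auto simp: inv_into_into f_inv_into_f)
    have qQ: "q \<in> carrier Q" using q by (simp add: P_def)
    let ?k = "?y \<otimes>\<^bsub>?X\<^esub> inv\<^bsub>?X\<^esub> y"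
    have iy: "inv\<^bsub>?X\<^esub> y \<in> Y" using f.G.inv_closed[of y] y by simp
    have k: "?k \<in> Y" using f.G.m_closed[of ?y "inv\<^bsub>?X\<^esub> y"] y' iy by simp
    have "f ?k = \<one>\<^bsub>?X1\<^esub>"
      using f.hom_mult[of ?y "inv\<^bsub>?X\<^esub> y"] f.hom_inv[of y] y y' iy f.H.r_inv[of "f y"] fY[OF y] by simp
    then have "f (\<alpha> q ?k) = \<one>\<^bsub>B1\<^esub>" using q k by (simp add: P_def)
    moreover have "?k \<otimes>\<^bsub>B\<^esub> y = ?y"
      using f.G.m_assoc[of ?y "inv\<^bsub>?X\<^esub> y" y] f.G.l_inv[of y] f.G.r_one[of ?y] y y' iy by simp
    then have "f (\<alpha> q ?y) = f (\<alpha> q ?k) \<otimes>\<^bsub>B1\<^esub> f (\<alpha> q y)"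
      using ah[OF qQ k y] fm[OF aY[OF qQ k] aY[OF qQ y]] by simp
    ultimately show ?thesis
      using f.H.l_one[of "f (\<alpha> q y)"] fY[OF aY[OF qQ y]] by (simp add: \<beta>_def)
  qed
  show ?thesis
  proof (rule generated_auts_in_class)
    show "in_class (Q\<lparr>carrier := P\<rparr>) \<C>" by (rule in_class_subgroup[OF in_classI[OF Q(1)] Q(2) P])
    show "group (Q\<lparr>carrier := P\<rparr>)" by (rule subgroup.subgroup_is_group[OF P Q(2)])
    show "group ?X1" by (rule X1)
    have PQ: "q \<in> carrier Q" if "q \<in> P" for q using that by (simp add: P_def)
    show "aut_action (Q\<lparr>carrier := P\<rparr>) ?X1 \<beta>"
      unfolding aut_action_def
    proof (intro conjI ballI)
      fix q z assume "q \<in> carrier (Q\<lparr>carrier := P\<rparr>)" "z \<in> carrier ?X1"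
      then show "\<beta> q z \<in> carrier ?X1" using f(2) b fY aY PQ by auto
    next
      fix q z z' assume q: "q \<in> carrier (Q\<lparr>carrier := P\<rparr>)" and "z \<in> carrier ?X1" "z' \<in> carrier ?X1"
      then obtain y y' where y: "y \<in> Y" "z = f y" "y' \<in> Y" "z' = f y'" using f(2) by auto
      have "y \<otimes>\<^bsub>B\<^esub> y' \<in> Y" using f.G.m_closed[of y y'] y by simp
      then show "\<beta> q (z \<otimes>\<^bsub>?X1\<^esub> z') = \<beta> q z \<otimes>\<^bsub>?X1\<^esub> \<beta> q z'"
        using b[of q "y \<otimes>\<^bsub>B\<^esub> y'"] b[of q y] b[of q y'] y q PQ
        by (simp add: fm[symmetric] ah[symmetric] aY)
    next
      fix p q z assume p: "p \<in> carrier (Q\<lparr>carrier := P\<rparr>)" and q: "q \<in> carrier (Q\<lparr>carrier := P\<rparr>)"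
        and "z \<in> carrier ?X1"
      then obtain y where y: "y \<in> Y" "z = f y" using f(2) by auto
      have "p \<otimes>\<^bsub>Q\<^esub> q \<in> P" using p q subgroup.m_closed[OF P] by simp
      then show "\<beta> (p \<otimes>\<^bsub>Q\<lparr>carrier := P\<rparr>\<^esub> q) z = \<beta> p (\<beta> q z)"
        using b[of "p \<otimes>\<^bsub>Q\<^esub> q" y] b[of q y] b[of p "\<alpha> q y"] y p q PQ aY[of q y] by (simp add: aq)
    next
      fix z assume "z \<in> carrier ?X1"
      then obtain y where y: "y \<in> Y" "z = f y" using f(2) by auto
      then show "\<beta> \<one>\<^bsub>Q\<lparr>carrier := P\<rparr>\<^esub> z = z"
        using b[of "\<one>\<^bsub>Q\<^esub>" y] subgroup.one_closed[OF P] a1 by simp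
    qed
    fix \<sigma>1 assume s1: "\<sigma>1 \<in> S1"
    obtain \<sigma> where s: "\<sigma> \<in> S" "\<forall>y\<in>Y. \<sigma>1 (f y) = f (\<sigma> y)" using S1S[OF s1] by blast
    obtain q where q: "q \<in> carrier Q" "\<forall>y\<in>Y. \<alpha> q y = \<sigma> y" using aS s(1) by blast
    have A1: "\<sigma>1 \<in> extensional Y1" "bij_betw \<sigma>1 Y1 Y1" "\<sigma>1 \<in> hom ?X1 ?X1"
      using S1 s1 by (auto simp: AutoGroup_mem)
    have o1: "\<sigma>1 \<one>\<^bsub>B1\<^esub> = \<one>\<^bsub>B1\<^esub>" using hom_one[OF A1(3) X1 X1] by simp
    have "\<one>\<^bsub>B1\<^esub> \<in> Y1" using f.H.one_closed by simp
    then have "\<sigma>1 z = \<one>\<^bsub>B1\<^esub> \<longleftrightarrow> z = \<one>\<^bsub>B1\<^esub>" if "z \<in> Y1" for z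
      using A1(2) o1 that unfolding bij_betw_def inj_on_def by metis
    then have "f y = \<one>\<^bsub>B1\<^esub> \<longleftrightarrow> f (\<alpha> q y) = \<one>\<^bsub>B1\<^esub>" if "y \<in> Y" for y
      using q(2) s(2) fY that by metis
    then have "q \<in> P" using q(1) by (simp add: P_def)
    moreover have "\<sigma>1 = restrict (\<beta> q) Y1"
    proof (rule extensionalityI[OF A1(1)])
      fix z assume "z \<in> Y1"
      then obtain y where "y \<in> Y" "z = f y" using f(2) by auto
      then show "\<sigma>1 z = restrict (\<beta> q) Y1 z" using b[OF \<open>q \<in> P\<close>] s(2) q(2) fY by simp
    qed auto
    ultimately show "\<exists>q\<in>carrier (Q\<lparr>carrier := P\<rparr>). \<sigma>1 = restrict (\<beta> q) Y1" by auto
  qed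
qed

end

lemma (in group) conj_auts_auto:
  assumes N: "N \<lhd> G"
  shows "conj_auts G N \<subseteq> carrier (AutoGroup (G\<lparr>carrier := N\<rparr>))"
proof
  fix \<sigma> assume "\<sigma> \<in> conj_auts G N"
  then obtain x where x: "x \<in> carrier G" "\<sigma> = (\<lambda>y\<in>N. inv x \<otimes> y \<otimes> x)" by (auto simp: conj_auts_def)
  have NG: "\<And>y. y \<in> N \<Longrightarrow> y \<in> carrier G" using normal_imp_subgroup[OF N] subgroup.subset by blast
  have "restrict (\<lambda>y. inv x \<otimes> y \<otimes> x) (carrier (G\<lparr>carrier := N\<rparr>)) \<in> carrier (AutoGroup (G\<lparr>carrier := N\<rparr>))"
  proof (rule AutoGroup_restrictI[where a' = "\<lambda>y. x \<otimes> y \<otimes> inv x"])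
    show "group (G\<lparr>carrier := N\<rparr>)"
      by (rule subgroup.subgroup_is_group[OF normal_imp_subgroup[OF N] group_axioms])
  qed (use x NG normal.inv_op_closed1[OF N] normal.inv_op_closed2[OF N] in
      \<open>auto simp: m_assoc inv_mult_cancel\<close>)
  then show "\<sigma> \<in> carrier (AutoGroup (G\<lparr>carrier := N\<rparr>))" using x by simp
qed

context hnn_base
begin

abbreviation "twisted_conj \<equiv> (\<lambda>\<alpha>. \<lambda>h\<in>H. inv_into H \<phi> (\<alpha> (\<phi> h)))"

lemma inv_\<phi>: "k \<in> K \<Longrightarrow> inv_into H \<phi> k \<in> H" "k \<in> K \<Longrightarrow> \<phi> (inv_into H \<phi> k) = k"
  "h \<in> H \<Longrightarrow> inv_into H \<phi> (\<phi> h) = h"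
  using \<phi>_image \<phi>_inj by (auto simp: inv_into_into f_inv_into_f)

lemma H_group: "group (B\<lparr>carrier := H\<rparr>)" and K_group: "group (B\<lparr>carrier := K\<rparr>)"
  using subgroup.subgroup_is_group[OF H_subgroup B.group_axioms]
    subgroup.subgroup_is_group[OF K_subgroup B.group_axioms] by auto

lemma U_generators_auto:
  "conj_auts B H \<union> twisted_conj ` conj_auts B K \<subseteq> carrier (AutoGroup (B\<lparr>carrier := H\<rparr>))"
proof
  fix \<sigma> assume "\<sigma> \<in> conj_auts B H \<union> twisted_conj ` conj_auts B K"
  then show "\<sigma> \<in> carrier (AutoGroup (B\<lparr>carrier := H\<rparr>))"
  proof
    assume "\<sigma> \<in> conj_auts B H"
    then show ?thesis using B.conj_auts_auto[OF H_normal] by blast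
  next
    assume "\<sigma> \<in> twisted_conj ` conj_auts B K"
    then obtain \<kappa> where k: "\<kappa> \<in> conj_auts B K" "\<sigma> = (\<lambda>h\<in>H. inv_into H \<phi> (\<kappa> (\<phi> h)))" by auto
    then have kA: "bij_betw \<kappa> K K" "\<kappa> \<in> hom (B\<lparr>carrier := K\<rparr>) (B\<lparr>carrier := K\<rparr>)"
      using B.conj_auts_auto[OF K_normal] by (auto simp: AutoGroup_mem)
    have kK: "\<kappa> y \<in> K" "inv_into K \<kappa> y \<in> K" "\<kappa> (inv_into K \<kappa> y) = y" "inv_into K \<kappa> (\<kappa> y) = y"
      if "y \<in> K" for y
      using kA(1) that by (auto simp: bij_betw_def f_inv_into_f inv_into_into)
    have km: "\<kappa> (x \<otimes> y) = \<kappa> x \<otimes> \<kappa> y" if "x \<in> K" "y \<in> K" for x y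
      using hom_mult[OF kA(2), of x y] that by simp
    have "restrict (\<lambda>h. inv_into H \<phi> (\<kappa> (\<phi> h))) (carrier (B\<lparr>carrier := H\<rparr>)) \<in> carrier (AutoGroup (B\<lparr>carrier := H\<rparr>))"
    proof (rule AutoGroup_restrictI[where a' = "\<lambda>h. inv_into H \<phi> (inv_into K \<kappa> (\<phi> h))"])
      fix x y assume "x \<in> carrier (B\<lparr>carrier := H\<rparr>)" "y \<in> carrier (B\<lparr>carrier := H\<rparr>)"
      then have xy: "x \<in> H" "y \<in> H" by auto
      let ?x = "inv_into H \<phi> (\<kappa> (\<phi> x))" and ?y = "inv_into H \<phi> (\<kappa> (\<phi> y))"
      have h: "?x \<in> H" "?y \<in> H" using inv_\<phi>(1) kK(1) \<phi>_K xy by auto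
      then have "?x \<otimes> ?y \<in> H" using subgroup.m_closed[OF H_subgroup] by blast
      moreover have "\<phi> (?x \<otimes> ?y) = \<kappa> (\<phi> (x \<otimes> y))"
        using h xy inv_\<phi>(2) kK(1) \<phi>_K by (simp add: \<phi>_mult km)
      ultimately have "inv_into H \<phi> (\<kappa> (\<phi> (x \<otimes> y))) = ?x \<otimes> ?y" using inv_\<phi>(3) by metis
      then show "inv_into H \<phi> (\<kappa> (\<phi> (x \<otimes>\<^bsub>B\<lparr>carrier := H\<rparr>\<^esub> y))) = ?x \<otimes>\<^bsub>B\<lparr>carrier := H\<rparr>\<^esub> ?y" by simp
    qed (use inv_\<phi> kK \<phi>_K H_group in auto)
    then show ?thesis using k by simp
  qed
qed

text \<open>
  Used for \<open>B/L\<close>, where the images of \<open>H\<close> and \<open>K\<close> meet trivially, and for quotients injective on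
  \<open>H\<close> and \<open>K\<close>.
\<close>

lemma quotient_data:
  assumes B1: "group B1" and f: "f \<in> hom B B1" "f ` carrier B = carrier B1"
    and ker: "\<And>h. h \<in> H \<Longrightarrow> f h = \<one>\<^bsub>B1\<^esub> \<longleftrightarrow> f (\<phi> h) = \<one>\<^bsub>B1\<^esub>"
  obtains \<phi>1 where "hnn_base B1 (f ` H) (f ` K) \<phi>1" "\<And>h. h \<in> H \<Longrightarrow> \<phi>1 (f h) = f (\<phi> h)"
proof -
  interpret f: group_hom B B1 f
    using B1 f B.group_axioms by (simp add: group_hom_def group_hom_axioms_def)
  have eq: "f h = f h' \<longleftrightarrow> f (\<phi> h) = f (\<phi> h')" if h: "h \<in> H" and h': "h' \<in> H" for h h'
  proof -
    have i: "inv h' \<in> H" "h \<otimes> inv h' \<in> H"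
      using h h' subgroup.m_inv_closed[OF H_subgroup] subgroup.m_closed[OF H_subgroup] by auto
    have c: "h \<in> carrier B" "h' \<in> carrier B" "\<phi> h \<in> carrier B" "\<phi> h' \<in> carrier B"
      using h h' H_sub \<phi>_B by auto
    have "\<phi> (h \<otimes> inv h') = \<phi> h \<otimes> inv (\<phi> h')" using \<phi>_mult[OF h i(1)] \<phi>_inv[OF h'] by simp
    then have "f (\<phi> h \<otimes> inv (\<phi> h')) = \<one>\<^bsub>B1\<^esub> \<longleftrightarrow> f (h \<otimes> inv h') = \<one>\<^bsub>B1\<^esub>"
      using ker[OF i(2)] by simp
    moreover have "f (x \<otimes> inv y) = \<one>\<^bsub>B1\<^esub> \<longleftrightarrow> f x = f y" if "x \<in> carrier B" "y \<in> carrier B" for x y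
      using that f.H.inv_solve_right[of "\<one>\<^bsub>B1\<^esub>" "f x" "f y"] by auto
    ultimately show ?thesis using c by blast
  qed
  define \<phi>1 where "\<phi>1 y = f (\<phi> (inv_into H f y))" for y
  have p: "\<phi>1 (f h) = f (\<phi> h)" if "h \<in> H" for h
    using eq[OF _ that, of "inv_into H f (f h)"] that unfolding \<phi>1_def
    by (simp add: inv_into_into f_inv_into_f)
  have nrm: "f ` N \<lhd> B1" if "N \<lhd> B" for N
    by (rule normal.surj_hom_normal_subgroup[OF that f.group_hom_axioms f(2)])
  have "hnn_base B1 (f ` H) (f ` K) \<phi>1"
  proof (intro hnn_base.intro hnn_base_axioms.intro B1 nrm H_normal K_normal)
    have "\<phi>1 \<in> hom (B1\<lparr>carrier := f ` H\<rparr>) (B1\<lparr>carrier := f ` K\<rparr>)"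
    proof (rule homI)
      fix x y assume "x \<in> carrier (B1\<lparr>carrier := f ` H\<rparr>)" "y \<in> carrier (B1\<lparr>carrier := f ` H\<rparr>)"
      then obtain h h' where h: "h \<in> H" "x = f h" "h' \<in> H" "y = f h'" by auto
      then have "h \<otimes> h' \<in> H" using subgroup.m_closed[OF H_subgroup] by blast
      then show "\<phi>1 (x \<otimes>\<^bsub>B1\<lparr>carrier := f ` H\<rparr>\<^esub> y) = \<phi>1 x \<otimes>\<^bsub>B1\<lparr>carrier := f ` K\<rparr>\<^esub> \<phi>1 y"
        using h p[of "h \<otimes> h'"] p[of h] p[of h'] H_sub \<phi>_B by (simp add: \<phi>_mult)
    qed (use p \<phi>_K in auto)
    moreover have "bij_betw \<phi>1 (f ` H) (f ` K)"
      unfolding bij_betw_def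
    proof
      show "inj_on \<phi>1 (f ` H)" by (rule inj_onI) (auto simp: p eq)
      show "\<phi>1 ` f ` H = f ` K" using p \<phi>_image by (auto simp: image_image intro!: image_eqI)
    qed
    ultimately show "\<phi>1 \<in> iso (B1\<lparr>carrier := f ` H\<rparr>) (B1\<lparr>carrier := f ` K\<rparr>)" by (simp add: iso_def)
  qed
  then show ?thesis using that p by blast
qed

end

lemma (in root_quotient_class) hnn_U_quotient:
  assumes b: "hnn_base B H K \<phi>" and b1: "hnn_base B1 (f ` H) (f ` K) \<phi>1"
    and f: "f \<in> hom B B1" "f ` carrier B = carrier B1"
    and p: "\<And>h. h \<in> H \<Longrightarrow> \<phi>1 (f h) = f (\<phi> h)"
    and U: "in_class (hnn_U B H K \<phi>) \<C>"
  shows "in_class (hnn_U B1 (f ` H) (f ` K) \<phi>1) \<C>"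
proof -
  interpret b: hnn_base B H K \<phi> by (rule b)
  interpret b1: hnn_base B1 "f ` H" "f ` K" \<phi>1 by (rule b1)
  interpret f: group_hom B B1 f
    using f(1) b.B.group_axioms b1.B.group_axioms by (simp add: group_hom_def group_hom_axioms_def)
  have fc: "f (inv\<^bsub>B\<^esub> x \<otimes>\<^bsub>B\<^esub> y \<otimes>\<^bsub>B\<^esub> x) = inv\<^bsub>B1\<^esub> (f x) \<otimes>\<^bsub>B1\<^esub> f y \<otimes>\<^bsub>B1\<^esub> f x"
    if "x \<in> carrier B" "y \<in> carrier B" for x y using that by simp
  have cj: "\<exists>x\<in>carrier B. \<sigma> = (\<lambda>y\<in>Y. inv\<^bsub>B1\<^esub> (f x) \<otimes>\<^bsub>B1\<^esub> y \<otimes>\<^bsub>B1\<^esub> f x)"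
    if "\<sigma> \<in> conj_auts B1 Y" for \<sigma> Y
    using that unfolding conj_auts_def f(2)[symmetric] by blast
  show ?thesis
    unfolding hnn_U_def
  proof (rule generated_auts_quotient[OF U[unfolded hnn_U_def] b.H_group b.U_generators_auto
        b1.H_group b1.U_generators_auto])
    show "f \<in> hom (B\<lparr>carrier := H\<rparr>) (B1\<lparr>carrier := f ` H\<rparr>)"
      by (rule homI) (auto simp: b.H_sub)
    fix \<sigma>1 assume "\<sigma>1 \<in> conj_auts B1 (f ` H) \<union> b1.twisted_conj ` conj_auts B1 (f ` K)"
    then show "\<exists>\<sigma>\<in>conj_auts B H \<union> b.twisted_conj ` conj_auts B K. \<forall>y\<in>H. \<sigma>1 (f y) = f (\<sigma> y)"
    proof
      assume "\<sigma>1 \<in> conj_auts B1 (f ` H)"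
      then obtain x where x: "x \<in> carrier B"
        "\<sigma>1 = (\<lambda>y\<in>f ` H. inv\<^bsub>B1\<^esub> (f x) \<otimes>\<^bsub>B1\<^esub> y \<otimes>\<^bsub>B1\<^esub> f x)"
        using cj by blast
      then have "\<forall>y\<in>H. \<sigma>1 (f y) = f ((\<lambda>y\<in>H. inv\<^bsub>B\<^esub> x \<otimes>\<^bsub>B\<^esub> y \<otimes>\<^bsub>B\<^esub> x) y)"
        using b.H_sub by simp
      moreover have "(\<lambda>y\<in>H. inv\<^bsub>B\<^esub> x \<otimes>\<^bsub>B\<^esub> y \<otimes>\<^bsub>B\<^esub> x) \<in> conj_auts B H"
        using x(1) by (auto simp: conj_auts_def)
      ultimately show ?thesis by blast
    next
      assume "\<sigma>1 \<in> b1.twisted_conj ` conj_auts B1 (f ` K)"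
      then obtain x where x: "x \<in> carrier B"
        "\<sigma>1 = b1.twisted_conj (\<lambda>y\<in>f ` K. inv\<^bsub>B1\<^esub> (f x) \<otimes>\<^bsub>B1\<^esub> y \<otimes>\<^bsub>B1\<^esub> f x)"
        using cj by blast
      let ?\<kappa> = "\<lambda>y\<in>K. inv\<^bsub>B\<^esub> x \<otimes>\<^bsub>B\<^esub> y \<otimes>\<^bsub>B\<^esub> x"
      have "\<sigma>1 (f y) = f (b.twisted_conj ?\<kappa> y)" if y: "y \<in> H" for y
      proof -
        have k: "inv\<^bsub>B\<^esub> x \<otimes>\<^bsub>B\<^esub> \<phi> y \<otimes>\<^bsub>B\<^esub> x \<in> K"
          using normal.inv_op_closed1[OF b.K_normal x(1) b.\<phi>_K[OF y]] .
        let ?h = "inv_into H \<phi> (inv\<^bsub>B\<^esub> x \<otimes>\<^bsub>B\<^esub> \<phi> y \<otimes>\<^bsub>B\<^esub> x)"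
        have "\<phi>1 (f ?h) = f (inv\<^bsub>B\<^esub> x \<otimes>\<^bsub>B\<^esub> \<phi> y \<otimes>\<^bsub>B\<^esub> x)"
          using p[OF b.inv_\<phi>(1)[OF k]] b.inv_\<phi>(2)[OF k] by simp
        also have "\<dots> = inv\<^bsub>B1\<^esub> (f x) \<otimes>\<^bsub>B1\<^esub> \<phi>1 (f y) \<otimes>\<^bsub>B1\<^esub> f x"
          using fc[OF x(1) b.\<phi>_B[OF y]] p[OF y] by simp
        finally have "inv_into (f ` H) \<phi>1 (inv\<^bsub>B1\<^esub> (f x) \<otimes>\<^bsub>B1\<^esub> \<phi>1 (f y) \<otimes>\<^bsub>B1\<^esub> f x) = f ?h"
          using b1.inv_\<phi>(3)[of "f ?h"] b.inv_\<phi>(1)[OF k] by auto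
        moreover have "\<phi>1 (f y) \<in> f ` K" using p[OF y] b.\<phi>_K[OF y] by simp
        ultimately show ?thesis using x(2) y b.\<phi>_K[OF y] by simp
      qed
      moreover have "?\<kappa> \<in> conj_auts B K" using x(1) by (auto simp: conj_auts_def)
      ultimately show ?thesis by blast
    qed
  qed simp
qed

context hnn_base
begin

lemma L_normal: "H \<inter> K \<lhd> B"
  by (rule B.normal_subgroup_intersect[OF H_normal K_normal])

lemma L_group: "group (B\<lparr>carrier := H \<inter> K\<rparr>)"
  by (rule subgroup.subgroup_is_group[OF normal_imp_subgroup[OF L_normal] B.group_axioms])

lemma \<phi>_L_auto:
  assumes "\<phi> ` (H \<inter> K) = H \<inter> K"
  shows "restrict \<phi> (H \<inter> K) \<in> carrier (AutoGroup (B\<lparr>carrier := H \<inter> K\<rparr>))"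
proof -
  have "restrict \<phi> (carrier (B\<lparr>carrier := H \<inter> K\<rparr>)) \<in> carrier (AutoGroup (B\<lparr>carrier := H \<inter> K\<rparr>))"
  proof (rule AutoGroup_restrictI[where a' = "inv_into H \<phi>"])
    fix x assume x: "x \<in> carrier (B\<lparr>carrier := H \<inter> K\<rparr>)"
    then show "\<phi> x \<in> carrier (B\<lparr>carrier := H \<inter> K\<rparr>)" using assms by auto
    obtain y where "y \<in> H \<inter> K" "x = \<phi> y" using x assms by auto
    then show "inv_into H \<phi> x \<in> carrier (B\<lparr>carrier := H \<inter> K\<rparr>)" using inv_\<phi>(3) by auto
  qed (use inv_\<phi> \<phi>_mult L_group in auto)
  then show ?thesis by simp
qed

lemma V_generators_auto:
  assumes "\<phi> ` (H \<inter> K) = H \<inter> K"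
  shows "conj_auts B (H \<inter> K) \<union> {restrict \<phi> (H \<inter> K)} \<subseteq> carrier (AutoGroup (B\<lparr>carrier := H \<inter> K\<rparr>))"
  using B.conj_auts_auto[OF L_normal] \<phi>_L_auto[OF assms] by blast

text \<open>Generators suffice in place of the cyclic group that \<open>\<phi>\<close> generates.\<close>

lemma hnn_V_alt:
  assumes "\<phi> ` (H \<inter> K) = H \<inter> K"
  shows "hnn_V B (H \<inter> K) \<phi> = generated_auts B (H \<inter> K) (conj_auts B (H \<inter> K) \<union> {restrict \<phi> (H \<inter> K)})"
proof -
  let ?A = "AutoGroup (B\<lparr>carrier := H \<inter> K\<rparr>)" and ?C = "conj_auts B (H \<inter> K)" and ?s = "restrict \<phi> (H \<inter> K)"
  interpret A: group ?A by (rule group.AutoGroup[OF L_group])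
  note V = V_generators_auto[OF assms]
  have s: "subgroup (generate ?A (?C \<union> {?s})) ?A" by (rule A.generate_is_subgroup[OF V])
  have "generate ?A {?s} \<subseteq> generate ?A (?C \<union> {?s})"
    by (rule A.generate_subgroup_incl[OF _ s]) (auto intro: generate.incl)
  then have "generate ?A (?C \<union> generate ?A {?s}) \<subseteq> generate ?A (?C \<union> {?s})"
    by (intro A.generate_subgroup_incl[OF _ s]) (auto intro: generate.incl)
  moreover have "generate ?A (?C \<union> {?s}) \<subseteq> generate ?A (?C \<union> generate ?A {?s})"
    by (rule A.mono_generate) (auto intro: generate.incl)
  ultimately show ?thesis unfolding hnn_V_def generated_auts_def by (metis subset_antisym)
qed

end

lemma (in root_quotient_class) hnn_V_quotient:
  assumes b: "hnn_base B H K \<phi>" and b1: "hnn_base B1 (f ` H) (f ` K) \<phi>1"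
    and f: "f \<in> hom B B1" "f ` carrier B = carrier B1" "f ` (H \<inter> K) = f ` H \<inter> f ` K"
    and p: "\<And>h. h \<in> H \<Longrightarrow> \<phi>1 (f h) = f (\<phi> h)"
    and L: "\<phi> ` (H \<inter> K) = H \<inter> K"
    and V: "in_class (hnn_V B (H \<inter> K) \<phi>) \<C>"
  shows "\<phi>1 ` (f ` H \<inter> f ` K) = f ` H \<inter> f ` K" "in_class (hnn_V B1 (f ` H \<inter> f ` K) \<phi>1) \<C>"
proof -
  interpret b: hnn_base B H K \<phi> by (rule b)
  interpret b1: hnn_base B1 "f ` H" "f ` K" \<phi>1 by (rule b1)
  interpret f: group_hom B B1 f
    using f(1) b.B.group_axioms b1.B.group_axioms by (simp add: group_hom_def group_hom_axioms_def)
  have cj: "\<exists>x\<in>carrier B. \<sigma> = (\<lambda>y\<in>Y. inv\<^bsub>B1\<^esub> (f x) \<otimes>\<^bsub>B1\<^esub> y \<otimes>\<^bsub>B1\<^esub> f x)"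
    if "\<sigma> \<in> conj_auts B1 Y" for \<sigma> Y
    using that unfolding conj_auts_def f(2)[symmetric] by blast
  have "\<phi>1 ` f ` (H \<inter> K) = f ` \<phi> ` (H \<inter> K)"
    unfolding image_image by (rule image_cong) (auto simp: p)
  then show L1: "\<phi>1 ` (f ` H \<inter> f ` K) = f ` H \<inter> f ` K" using L f(3) by simp
  show "in_class (hnn_V B1 (f ` H \<inter> f ` K) \<phi>1) \<C>"
    unfolding b1.hnn_V_alt[OF L1]
  proof (rule generated_auts_quotient[OF V[unfolded b.hnn_V_alt[OF L]] b.L_group b.V_generators_auto[OF L]
        b1.L_group b1.V_generators_auto[OF L1]])
    show "f \<in> hom (B\<lparr>carrier := H \<inter> K\<rparr>) (B1\<lparr>carrier := f ` H \<inter> f ` K\<rparr>)"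
      by (rule homI) (auto simp: b.H_sub)
    show "f ` (H \<inter> K) = f ` H \<inter> f ` K" by (rule f(3))
    fix \<sigma>1 assume "\<sigma>1 \<in> conj_auts B1 (f ` H \<inter> f ` K) \<union> {restrict \<phi>1 (f ` H \<inter> f ` K)}"
    then show "\<exists>\<sigma>\<in>conj_auts B (H \<inter> K) \<union> {restrict \<phi> (H \<inter> K)}. \<forall>y\<in>H \<inter> K. \<sigma>1 (f y) = f (\<sigma> y)"
    proof
      assume "\<sigma>1 \<in> conj_auts B1 (f ` H \<inter> f ` K)"
      then obtain x where x: "x \<in> carrier B"
        "\<sigma>1 = (\<lambda>y\<in>f ` H \<inter> f ` K. inv\<^bsub>B1\<^esub> (f x) \<otimes>\<^bsub>B1\<^esub> y \<otimes>\<^bsub>B1\<^esub> f x)"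
        using cj by blast
      then have "\<forall>y\<in>H \<inter> K. \<sigma>1 (f y) = f ((\<lambda>y\<in>H \<inter> K. inv\<^bsub>B\<^esub> x \<otimes>\<^bsub>B\<^esub> y \<otimes>\<^bsub>B\<^esub> x) y)"
        using b.H_sub by simp
      moreover have "(\<lambda>y\<in>H \<inter> K. inv\<^bsub>B\<^esub> x \<otimes>\<^bsub>B\<^esub> y \<otimes>\<^bsub>B\<^esub> x) \<in> conj_auts B (H \<inter> K)"
        using x(1) by (auto simp: conj_auts_def)
      ultimately show ?thesis by blast
    next
      assume "\<sigma>1 \<in> {restrict \<phi>1 (f ` H \<inter> f ` K)}"
      then have "\<forall>y\<in>H \<inter> K. \<sigma>1 (f y) = f (restrict \<phi> (H \<inter> K) y)" using p by auto
      then show ?thesis by blast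
    qed
  qed
qed

section \<open>Embedding the base in a member of the class\<close>

context hnn_in_class
begin

lemma subgroup_in_class: "subgroup S B \<Longrightarrow> in_class (B\<lparr>carrier := S\<rparr>) \<C>"
  by (rule in_class_subgroup[OF B_in_class B.group_axioms])

text \<open>
  Two coverings in succession. The first has base \<open>G\<^sub>0\<close>, with \<open>B\<close> acting trivially on it and the stable
  letter acting by \<open>g \<noteq> 1\<close>; its fibre \<open>Q \<cong> \<UU>\<close> records the conjugation action of \<open>B\<close> on \<open>H\<close> at the point \<open>1\<close>
  and that on \<open>K\<close>, carried to \<open>H\<close>, at the point \<open>g\<close>. This respects the relation
  because \<open>H\<close> and \<open>K\<close> centralise each other when \<open>H \<inter> K = 1\<close>, and therefore \<open>h\<close> acts only at \<open>1\<close>, and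
  \<open>\<phi> h\<close> only at \<open>g\<close> by the same automorphism. The purpose of this covering is an action of \<open>E\<close> on the
  functions from \<open>G\<^sub>0\<close> to \<open>H\<close> that factors through a member of the class. The second covering has fibre
  \<open>H\<close>. After adding the quotient \<open>B/HK\<close> to its base, the kernel on \<open>B\<close> lies in \<open>HK\<close>, and its elements \<open>h k\<close>
  are sent to the function with value \<open>h\<close> at \<open>1\<close> and \<open>inv \<phi> k\<close> at \<open>g\<close>; this is equivariant for the action.
\<close>

lemma base_embedding_trivial_intersection:
  assumes U: "in_class (hnn_U B H K \<phi>) \<C>" and triv: "H \<inter> K = {\<one>}"
  shows "\<exists>G f \<tau>. \<C> G \<and> hnn_rep B H \<phi> G f \<tau> \<and> inj_on f (carrier B)"
proof -
  interpret E: group E by (rule E_group)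
  obtain Q \<alpha> where Q: "\<C> Q" "group Q" and a: "aut_action Q (B\<lparr>carrier := H\<rparr>) \<alpha>"
    and faithful: "\<forall>p\<in>carrier Q. \<forall>q\<in>carrier Q. (\<forall>y\<in>H. \<alpha> p y = \<alpha> q y) \<longrightarrow> p = q"
    and gen: "\<forall>\<sigma>\<in>conj_auts B H \<union> twisted_conj ` conj_auts B K. \<exists>q\<in>carrier Q. \<forall>y\<in>H. \<alpha> q y = \<sigma> y"
    by (rule generated_auts_action[OF U[unfolded hnn_U_def] H_group U_generators_auto])
  interpret Q: group Q by (rule Q(2))
  have aH: "\<alpha> q y \<in> H" if "q \<in> carrier Q" "y \<in> H" for q y using a that by (simp add: aut_action_def)
  have a1: "\<alpha> \<one>\<^bsub>Q\<^esub> y = y" if "y \<in> H" for y using a that by (simp add: aut_action_def)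
  have aq: "\<alpha> (p \<otimes>\<^bsub>Q\<^esub> q) y = \<alpha> p (\<alpha> q y)" if "p \<in> carrier Q" "q \<in> carrier Q" "y \<in> H" for p q y
    using a that by (simp add: aut_action_def)
  have ah: "\<alpha> q (x \<otimes> y) = \<alpha> q x \<otimes> \<alpha> q y" if "q \<in> carrier Q" "x \<in> H" "y \<in> H" for q x y
    using a that by (simp add: aut_action_def)
  have Hm: "x \<otimes> y \<in> H" if "x \<in> H" "y \<in> H" for x y using subgroup.m_closed[OF H_subgroup that] .
  have Km: "x \<otimes> y \<in> K" if "x \<in> K" "y \<in> K" for x y using subgroup.m_closed[OF K_subgroup that] .
  have Hc: "b \<otimes> h \<otimes> inv b \<in> H" if "b \<in> carrier B" "h \<in> H" for b h
    using normal.inv_op_closed2[OF H_normal that] .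
  have Kc: "b \<otimes> k \<otimes> inv b \<in> K" if "b \<in> carrier B" "k \<in> K" for b k
    using normal.inv_op_closed2[OF K_normal that] .
  let ?tw = "\<lambda>b h. inv_into H \<phi> (b \<otimes> \<phi> h \<otimes> inv b)"
  have tH: "?tw b h \<in> H" if "b \<in> carrier B" "h \<in> H" for b h
    using inv_\<phi>(1) Kc \<phi>_K that by blast
  have \<phi>t: "\<phi> (?tw b h) = b \<otimes> \<phi> h \<otimes> inv b" if "b \<in> carrier B" "h \<in> H" for b h
    using inv_\<phi>(2) Kc \<phi>_K that by blast
  \<comment> \<open>the commutator lies in both normal subgroups\<close>
  have comm: "h \<otimes> k = k \<otimes> h" if h: "h \<in> H" and k: "k \<in> K" for h k
  proof -
    have c: "h \<in> carrier B" "k \<in> carrier B" using h k H_sub K_sub by auto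
    have "h \<otimes> (k \<otimes> inv h \<otimes> inv k) \<in> H"
      using Hm[OF h Hc[OF c(2) subgroup.m_inv_closed[OF H_subgroup h]]] .
    moreover have "(h \<otimes> k \<otimes> inv h) \<otimes> inv k \<in> K"
      using Km[OF Kc[OF c(1) k] subgroup.m_inv_closed[OF K_subgroup k]] .
    ultimately have "h \<otimes> k \<otimes> inv h \<otimes> inv k \<in> H \<inter> K" using c by (simp add: B.m_assoc)
    then have e: "h \<otimes> k \<otimes> inv h \<otimes> inv k = \<one>" using triv by blast
    have "h \<otimes> k = (h \<otimes> k \<otimes> inv h \<otimes> inv k) \<otimes> (k \<otimes> h)" using c by (simp add: B.m_assoc B.inv_mult_cancel)
    then show ?thesis using e c by simp
  qed
  have dec: "h = h' \<and> k = k'" if h: "h \<in> H" "h' \<in> H" and k: "k \<in> K" "k' \<in> K" and eq: "h \<otimes> k = h' \<otimes> k'" for h h' k k'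
  proof -
    have c: "h \<in> carrier B" "h' \<in> carrier B" "k \<in> carrier B" "k' \<in> carrier B" using h k H_sub K_sub by auto
    have "inv h' \<otimes> (h \<otimes> k) \<otimes> inv k = inv h' \<otimes> (h' \<otimes> k') \<otimes> inv k" using eq by simp
    then have "inv h' \<otimes> h = k' \<otimes> inv k" using c by (simp add: B.m_assoc B.inv_mult_cancel)
    moreover have "inv h' \<otimes> h \<in> H" using Hm subgroup.m_inv_closed[OF H_subgroup] h by blast
    moreover have "k' \<otimes> inv k \<in> K" using Km subgroup.m_inv_closed[OF K_subgroup] k by blast
    ultimately have "inv h' \<otimes> h = \<one>" using triv by force
    then have "h' = h" using c B.inv_mult_cancel(2)[of h' h] by simp
    then show ?thesis using eq c by simp
  qed
  obtain u1 where u1h: "u1 \<in> hom B Q" and u1: "\<forall>b\<in>carrier B. \<forall>h\<in>H. \<alpha> (u1 b) h = b \<otimes> h \<otimes> inv b"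
  proof (rule faithful_action_hom[OF Q(2) a faithful, where \<kappa> = "\<lambda>b h. b \<otimes> h \<otimes> inv b"])
    fix b assume b: "b \<in> carrier B"
    have "(\<lambda>y\<in>H. inv (inv b) \<otimes> y \<otimes> inv b) \<in> conj_auts B H"
      unfolding conj_auts_def by (rule imageI) (use b in simp)
    then obtain q where "q \<in> carrier Q" "\<forall>y\<in>H. \<alpha> q y = (\<lambda>y\<in>H. inv (inv b) \<otimes> y \<otimes> inv b) y"
      using gen by blast
    then show "\<exists>q\<in>carrier Q. \<forall>h\<in>H. \<alpha> q h = b \<otimes> h \<otimes> inv b" using b by auto
  qed (use H_sub in \<open>auto simp: B.m_assoc B.inv_mult_group\<close>)
  obtain u2 where u2h: "u2 \<in> hom B Q" and u2: "\<forall>b\<in>carrier B. \<forall>h\<in>H. \<alpha> (u2 b) h = ?tw b h"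
  proof (rule faithful_action_hom[OF Q(2) a faithful, where \<kappa> = ?tw])
    fix b assume b: "b \<in> carrier B"
    have "(\<lambda>y\<in>K. inv (inv b) \<otimes> y \<otimes> inv b) \<in> conj_auts B K"
      unfolding conj_auts_def by (rule imageI) (use b in simp)
    then obtain q where "q \<in> carrier Q"
      "\<forall>y\<in>H. \<alpha> q y = twisted_conj (\<lambda>y\<in>K. inv (inv b) \<otimes> y \<otimes> inv b) y"
      using gen by blast
    then show "\<exists>q\<in>carrier Q. \<forall>h\<in>H. \<alpha> q h = ?tw b h" using b \<phi>_K by auto
    fix c h assume c: "c \<in> carrier B"
    show "b \<otimes> c \<in> carrier B \<and> (h \<in> H \<longrightarrow> ?tw (b \<otimes> c) h = ?tw b (?tw c h))"
      using b c \<phi>_B[of h] \<phi>t[OF c, of h] by (simp add: B.m_assoc B.inv_mult_group)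
  qed
  have uQ: "u1 b \<in> carrier Q" "u2 b \<in> carrier Q" if "b \<in> carrier B" for b
    using hom_in_carrier[OF u1h that] hom_in_carrier[OF u2h that] .
  have eqQ: "p = q" if "p \<in> carrier Q" "q \<in> carrier Q" "\<And>h. h \<in> H \<Longrightarrow> \<alpha> p h = \<alpha> q h" for p q
    using faithful that by blast
  have u1K: "u1 k = \<one>\<^bsub>Q\<^esub>" if k: "k \<in> K" for k
  proof (rule eqQ)
    fix h assume h: "h \<in> H"
    have "k \<otimes> h \<otimes> inv k = h" using comm[OF h k, symmetric] H_sub[OF h] K_sub[OF k] by (simp add: B.m_assoc)
    then show "\<alpha> (u1 k) h = \<alpha> \<one>\<^bsub>Q\<^esub> h" using u1 K_sub[OF k] h a1 by simp
  qed (use uQ K_sub[OF k] in auto)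
  have u2H: "u2 h = \<one>\<^bsub>Q\<^esub>" if h: "h \<in> H" for h
  proof (rule eqQ)
    fix x assume x: "x \<in> H"
    have "h \<otimes> \<phi> x \<otimes> inv h = \<phi> x" using comm[OF h \<phi>_K[OF x]] H_sub[OF h] \<phi>_B[OF x] by (simp add: B.m_assoc)
    then show "\<alpha> (u2 h) x = \<alpha> \<one>\<^bsub>Q\<^esub> x" using u2 H_sub[OF h] x a1 inv_\<phi>(3) by simp
  qed (use uQ H_sub[OF h] in auto)
  have u12: "u2 (\<phi> h) = u1 h" if h: "h \<in> H" for h
  proof (rule eqQ)
    fix x assume x: "x \<in> H"
    show "\<alpha> (u2 (\<phi> h)) x = \<alpha> (u1 h) x"
      using \<phi>_conj[OF h x] u1 u2 \<phi>_B[OF h] H_sub[OF h] x inv_\<phi>(3)[OF Hc[OF H_sub[OF h] x]] by simp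
  qed (use uQ H_sub[OF h] \<phi>_B[OF h] in auto)
  \<comment> \<open>the first covering; \<open>g\<close> may have order two, so that shifting by it exchanges the two points\<close>
  obtain G0 g where G0: "\<C> G0" and g: "g \<in> carrier G0" "g \<noteq> \<one>\<^bsub>G0\<^esub>" by (rule class_nontrivial)
  have gG0: "group G0" by (rule class_group[OF G0])
  interpret G0: group G0 by (rule gG0)
  define U where "U b z = (if z = \<one>\<^bsub>G0\<^esub> then u1 b else if z = g then u2 b else \<one>\<^bsub>Q\<^esub>)" for b z
  have UQ: "U b z \<in> carrier Q" if "b \<in> carrier B" for b z using uQ that by (simp add: U_def)
  have Um: "U (b \<otimes> c) z = U b z \<otimes>\<^bsub>Q\<^esub> U c z" if "b \<in> carrier B" "c \<in> carrier B" for b c z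
    using hom_mult[OF u1h] hom_mult[OF u2h] that by (simp add: U_def)
  have zg: "z \<otimes>\<^bsub>G0\<^esub> g = g \<longleftrightarrow> z = \<one>\<^bsub>G0\<^esub>" "\<one>\<^bsub>G0\<^esub> \<otimes>\<^bsub>G0\<^esub> g = g" "z = g \<Longrightarrow> z \<otimes>\<^bsub>G0\<^esub> g \<noteq> g"
    if "z \<in> carrier G0" for z using that g by auto
  have Ut: "U h z = U (\<phi> h) (z \<otimes>\<^bsub>G0\<^esub> g)" if h: "h \<in> H" and z: "z \<in> carrier G0" for h z
    using u12[OF h] u2H[OF h] u1K[OF \<phi>_K[OF h]] zg[OF z] g by (auto simp: U_def)
  let ?W1 = "wreath G0 Q" and ?f1 = "\<lambda>b. (\<lambda>z\<in>carrier G0. U b z, \<one>\<^bsub>G0\<^esub>)" and ?t1 = "(\<lambda>z\<in>carrier G0. \<one>\<^bsub>Q\<^esub>, g)"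
  have rep1: "hnn_rep B H \<phi> ?W1 ?f1 ?t1"
    unfolding hnn_rep_def
  proof (intro conjI ballI)
    show "group ?W1" by (rule wreath_group[OF gG0 Q(2)])
    show "?f1 \<in> hom B ?W1"
      by (rule homI) (auto simp: wreath_simps prod_eq_iff UQ Um intro!: restrict_ext)
    show "?t1 \<in> carrier ?W1" using g by (auto simp: wreath_simps)
    show "?f1 h \<otimes>\<^bsub>?W1\<^esub> ?t1 = ?t1 \<otimes>\<^bsub>?W1\<^esub> ?f1 (\<phi> h)" if h: "h \<in> H" for h
      using h g UQ[OF H_sub[OF h]] UQ[OF \<phi>_B[OF h]] Ut[OF h]
      by (auto simp: wreath_simps prod_eq_iff intro!: restrict_ext)
  qed
  obtain \<Phi> G1 \<psi> where r1: "\<C> G1" "group G1" "\<psi> \<in> hom E G1" "\<psi> ` carrier E = carrier G1"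
    "hnn_rep B H \<phi> G1 (\<psi> \<circ> \<iota>) (\<psi> stable)"
    "\<Phi> \<in> hom E ?W1" "\<forall>b\<in>carrier B. \<Phi> (\<iota> b) = ?f1 b" "\<Phi> stable = ?t1"
    "\<forall>u\<in>carrier E. \<forall>v\<in>carrier E. \<psi> u = \<psi> v \<longrightarrow>
      snd (\<Phi> u) = snd (\<Phi> v) \<and> fst (\<Phi> u) \<one>\<^bsub>G0\<^esub> = fst (\<Phi> v) \<one>\<^bsub>G0\<^esub>"
    by (rule rep_into_wreath[OF rep1 in_classI[OF G0] gG0 in_classI[OF Q(1)] Q(2)])
  have \<iota>E: "\<iota> b \<in> carrier E" if "b \<in> carrier B" for b using hom_in_carrier[OF \<iota>_hom that] .
  have \<Phi>W: "snd (\<Phi> u) \<in> carrier G0" "z \<in> carrier G0 \<Longrightarrow> fst (\<Phi> u) z \<in> carrier Q" if "u \<in> carrier E" for u z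
    using hom_in_carrier[OF r1(6) that] by (auto simp: wreath_simps)
  \<comment> \<open>the two parts of the action on functions that survive in \<open>G1\<close>: the shift \<open>s\<close> and the
    automorphism \<open>q\<close> at the point \<open>1\<close>\<close>
  define s where "s x = snd (\<Phi> (inv_into (carrier E) \<psi> x))" for x
  define q where "q x = fst (\<Phi> (inv_into (carrier E) \<psi> x)) \<one>\<^bsub>G0\<^esub>" for x
  have sq: "s (\<psi> u) = snd (\<Phi> u)" "q (\<psi> u) = fst (\<Phi> u) \<one>\<^bsub>G0\<^esub>" if u: "u \<in> carrier E" for u
  proof -
    have "inv_into (carrier E) \<psi> (\<psi> u) \<in> carrier E" "\<psi> (inv_into (carrier E) \<psi> (\<psi> u)) = \<psi> u"
      using u by (auto simp: inv_into_into f_inv_into_f)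
    then show "s (\<psi> u) = snd (\<Phi> u)" "q (\<psi> u) = fst (\<Phi> u) \<one>\<^bsub>G0\<^esub>"
      using r1(9) u unfolding s_def q_def by blast+
  qed
  have pre: "\<exists>u\<in>carrier E. x = \<psi> u" if "x \<in> carrier G1" for x using r1(4) that by blast
  have sG: "s x \<in> carrier G0" and qQ: "q x \<in> carrier Q" if "x \<in> carrier G1" for x
    using pre[OF that] sq \<Phi>W by auto
  have s1: "s \<one>\<^bsub>G1\<^esub> = \<one>\<^bsub>G0\<^esub>" and q1: "q \<one>\<^bsub>G1\<^esub> = \<one>\<^bsub>Q\<^esub>"
    using sq[OF E.one_closed] hom_one[OF r1(3) E_group r1(2)]
      hom_one[OF r1(6) E_group wreath_group[OF gG0 Q(2)]] by (auto simp: wreath_simps)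
  have st: "s (\<psi> stable) = g" and qt: "q (\<psi> stable) = \<one>\<^bsub>Q\<^esub>"
    using sq[OF stable_E] r1(8) by auto
  have sb: "s (x \<otimes>\<^bsub>G1\<^esub> \<psi> (\<iota> b)) = s x" and qb: "q (x \<otimes>\<^bsub>G1\<^esub> \<psi> (\<iota> b)) = q x \<otimes>\<^bsub>Q\<^esub> U b (s x)"
    if x: "x \<in> carrier G1" and b: "b \<in> carrier B" for x b
  proof -
    obtain u where u: "u \<in> carrier E" "x = \<psi> u" using pre[OF x] by blast
    have m: "\<psi> (u \<otimes>\<^bsub>E\<^esub> \<iota> b) = x \<otimes>\<^bsub>G1\<^esub> \<psi> (\<iota> b)" "\<Phi> (u \<otimes>\<^bsub>E\<^esub> \<iota> b) = \<Phi> u \<otimes>\<^bsub>?W1\<^esub> ?f1 b"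
      using hom_mult[OF r1(3) u(1) \<iota>E[OF b]] hom_mult[OF r1(6) u(1) \<iota>E[OF b]] u(2) r1(7) b by auto
    have ub: "u \<otimes>\<^bsub>E\<^esub> \<iota> b \<in> carrier E" using u(1) \<iota>E[OF b] by simp
    show "s (x \<otimes>\<^bsub>G1\<^esub> \<psi> (\<iota> b)) = s x" "q (x \<otimes>\<^bsub>G1\<^esub> \<psi> (\<iota> b)) = q x \<otimes>\<^bsub>Q\<^esub> U b (s x)"
      using sq[OF ub] sq[OF u(1)] m u(2) \<Phi>W[OF u(1)] by (simp_all add: wreath_simps)
  qed
  have sx: "s (x \<otimes>\<^bsub>G1\<^esub> \<psi> stable) = s x \<otimes>\<^bsub>G0\<^esub> g" and qx: "q (x \<otimes>\<^bsub>G1\<^esub> \<psi> stable) = q x"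
    if x: "x \<in> carrier G1" for x
  proof -
    obtain u where u: "u \<in> carrier E" "x = \<psi> u" using pre[OF x] by blast
    have m: "\<psi> (u \<otimes>\<^bsub>E\<^esub> stable) = x \<otimes>\<^bsub>G1\<^esub> \<psi> stable" "\<Phi> (u \<otimes>\<^bsub>E\<^esub> stable) = \<Phi> u \<otimes>\<^bsub>?W1\<^esub> ?t1"
      using hom_mult[OF r1(3) u(1) stable_E] hom_mult[OF r1(6) u(1) stable_E] u(2) r1(8) by auto
    have ub: "u \<otimes>\<^bsub>E\<^esub> stable \<in> carrier E" using u(1) stable_E by simp
    show "s (x \<otimes>\<^bsub>G1\<^esub> \<psi> stable) = s x \<otimes>\<^bsub>G0\<^esub> g" "q (x \<otimes>\<^bsub>G1\<^esub> \<psi> stable) = q x"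
      using sq[OF ub] sq[OF u(1)] m u(2) \<Phi>W[OF u(1)] by (simp_all add: wreath_simps)
  qed
  \<comment> \<open>the quotient by \<open>HK\<close>, to which the stable letter contributes nothing\<close>
  define R where "R = H <#> K"
  have Rmem: "d \<in> R \<longleftrightarrow> (\<exists>h\<in>H. \<exists>k\<in>K. d = h \<otimes> k)" for d by (auto simp: R_def set_mult_def)
  have Rn: "R \<lhd> B" unfolding R_def by (rule B.normal_subgroup_set_mult_closed[OF H_normal K_normal])
  have Rsub: "subgroup R B" by (rule normal_imp_subgroup[OF Rn])
  have HR: "h \<in> R" if "h \<in> H" for h
    using that H_sub[OF that] subgroup.one_closed[OF K_subgroup] B.r_one by (metis Rmem)
  have KR: "k \<in> R" if "k \<in> K" for k
    using that K_sub[OF that] subgroup.one_closed[OF H_subgroup] B.l_one by (metis Rmem)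
  let ?G2 = "B Mod R" and ?f2 = "\<lambda>b. R #> b"
  have gG2: "group ?G2" by (rule normal.factorgroup_is_group[OF Rn])
  have h2: "?f2 \<in> hom B ?G2" by (rule normal.r_coset_hom_Mod[OF Rn])
  have c2: "in_class ?G2 \<C>"
    by (rule in_class_hom_onto[OF B_in_class B.group_axioms h2 gG2])
      (auto simp: FactGroup_def RCOSETS_def)
  have f2R: "?f2 d = \<one>\<^bsub>?G2\<^esub> \<longleftrightarrow> d \<in> R" if d: "d \<in> carrier B" for d
    using B.coset_join2[OF d Rsub] B.rcos_self[OF d Rsub] by auto
  have rep2: "hnn_rep B H \<phi> ?G2 ?f2 \<one>\<^bsub>?G2\<^esub>"
    unfolding hnn_rep_def
  proof (intro conjI ballI gG2 h2)
    show "\<one>\<^bsub>?G2\<^esub> \<in> carrier ?G2" by (rule monoid.one_closed[OF group.is_monoid[OF gG2]])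
    show "?f2 h \<otimes>\<^bsub>?G2\<^esub> \<one>\<^bsub>?G2\<^esub> = \<one>\<^bsub>?G2\<^esub> \<otimes>\<^bsub>?G2\<^esub> ?f2 (\<phi> h)" if h: "h \<in> H" for h
      using f2R[of h] f2R[of "\<phi> h"] H_sub[OF h] \<phi>_B[OF h] HR[OF h] KR[OF \<phi>_K[OF h]] by simp
  qed
  let ?G = "G1 \<times>\<times> ?G2" and ?f = "\<lambda>b. ((\<psi> \<circ> \<iota>) b, ?f2 b)" and ?t = "(\<psi> stable, \<one>\<^bsub>?G2\<^esub>)"
  have gG: "group ?G" by (rule DirProd_group[OF r1(2) gG2])
  have rep: "hnn_rep B H \<phi> ?G ?f ?t" by (rule hnn_rep_prod[OF r1(5) rep2])
  have cG: "in_class ?G \<C>" by (rule in_class_DirProd[OF in_classI[OF r1(1)] r1(2) c2 gG2])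
  have kerR: "d \<in> carrier B \<and> d \<in> R" if "d \<in> kernel B ?G ?f" for d
    using that f2R[of d] by (auto simp: kernel_def)
  \<comment> \<open>the components of \<open>HK = H \<times> K\<close>, the second one carried to \<open>H\<close>\<close>
  define p1 where "p1 d = (THE h. h \<in> H \<and> (\<exists>k\<in>K. d = h \<otimes> k))" for d
  define p2 where "p2 d = inv_into H \<phi> (inv (p1 d) \<otimes> d)" for d
  have p1: "p1 (h \<otimes> k) = h" if "h \<in> H" "k \<in> K" for h k
    unfolding p1_def by (rule the_equality) (use that dec in blast)+
  have p2: "p2 (h \<otimes> k) = inv_into H \<phi> k" if "h \<in> H" "k \<in> K" for h k
    using that p1[OF that] H_sub K_sub by (simp add: p2_def B.inv_mult_cancel)
  have p12: "p1 d \<in> H" "p2 d \<in> H" "d = p1 d \<otimes> \<phi> (p2 d)" if d: "d \<in> R" for d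
  proof -
    obtain h k where h: "h \<in> H" "k \<in> K" "d = h \<otimes> k" using d by (auto simp: Rmem)
    then show "p1 d \<in> H" "p2 d \<in> H" "d = p1 d \<otimes> \<phi> (p2 d)" using p1 p2 inv_\<phi> by auto
  qed
  have pm: "p1 (d \<otimes> d') = p1 d \<otimes> p1 d'" "p2 (d \<otimes> d') = p2 d \<otimes> p2 d'" if d: "d \<in> R" "d' \<in> R" for d d'
  proof -
    let ?k = "\<phi> (p2 d)" and ?k' = "\<phi> (p2 d')"
    have K: "?k \<in> K" "?k' \<in> K" using p12 d \<phi>_K by auto
    have c: "p1 d \<in> carrier B" "p1 d' \<in> carrier B" "?k \<in> carrier B" "?k' \<in> carrier B"
      using p12 d H_sub K K_sub by auto
    have "d \<otimes> d' = (p1 d \<otimes> ?k) \<otimes> (p1 d' \<otimes> ?k')" using p12(3) d by simp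
    also have "\<dots> = p1 d \<otimes> (?k \<otimes> p1 d') \<otimes> ?k'" using c by (simp add: B.m_assoc)
    also have "?k \<otimes> p1 d' = p1 d' \<otimes> ?k" using comm[OF p12(1)[OF d(2)] K(1)] by simp
    also have "p1 d \<otimes> (p1 d' \<otimes> ?k) \<otimes> ?k' = (p1 d \<otimes> p1 d') \<otimes> (?k \<otimes> ?k')" using c by (simp add: B.m_assoc)
    finally have e: "d \<otimes> d' = (p1 d \<otimes> p1 d') \<otimes> (?k \<otimes> ?k')" .
    have m: "p1 d \<otimes> p1 d' \<in> H" "?k \<otimes> ?k' \<in> K" "p2 d \<otimes> p2 d' \<in> H" using Hm Km K p12 d by auto
    show "p1 (d \<otimes> d') = p1 d \<otimes> p1 d'" using p1[OF m(1,2)] e by simp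
    have "?k \<otimes> ?k' = \<phi> (p2 d \<otimes> p2 d')" using \<phi>_mult p12 d by simp
    then show "p2 (d \<otimes> d') = p2 d \<otimes> p2 d'" using p2[OF m(1,2)] e inv_\<phi>(3)[OF m(3)] by simp
  qed
  have pc: "p1 (b \<otimes> d \<otimes> inv b) = b \<otimes> p1 d \<otimes> inv b" "p2 (b \<otimes> d \<otimes> inv b) = ?tw b (p2 d)"
    if d: "d \<in> R" and b: "b \<in> carrier B" for d b
  proof -
    let ?k = "\<phi> (p2 d)"
    have K: "?k \<in> K" using p12 d \<phi>_K by auto
    have c: "p1 d \<in> carrier B" "?k \<in> carrier B" using p12(1)[OF d] H_sub K K_sub by auto
    have "b \<otimes> d \<otimes> inv b = b \<otimes> (p1 d \<otimes> ?k) \<otimes> inv b" using p12(3)[OF d] by simp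
    also have "\<dots> = (b \<otimes> p1 d \<otimes> inv b) \<otimes> (b \<otimes> ?k \<otimes> inv b)"
      using b c by (simp add: B.m_assoc B.inv_mult_cancel)
    finally have e: "b \<otimes> d \<otimes> inv b = (b \<otimes> p1 d \<otimes> inv b) \<otimes> (b \<otimes> ?k \<otimes> inv b)" .
    show "p1 (b \<otimes> d \<otimes> inv b) = b \<otimes> p1 d \<otimes> inv b" "p2 (b \<otimes> d \<otimes> inv b) = ?tw b (p2 d)"
      using p1[OF Hc[OF b p12(1)[OF d]] Kc[OF b K]] p2[OF Hc[OF b p12(1)[OF d]] Kc[OF b K]] e by simp_all
  qed
  have pH: "p1 h = h" "p2 h = \<one>" and pK: "p1 (\<phi> h) = \<one>" "p2 (\<phi> h) = h" if h: "h \<in> H" for h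
  proof -
    have o: "\<one> \<in> H" "\<one> \<in> K" using subgroup.one_closed[OF H_subgroup] subgroup.one_closed[OF K_subgroup] by auto
    show "p1 h = h" "p2 h = \<one>" using p1[OF h o(2)] p2[OF h o(2)] H_sub[OF h] inv_\<phi>(3)[OF o(1)] \<phi>_one by auto
    show "p1 (\<phi> h) = \<one>" "p2 (\<phi> h) = h"
      using p1[OF o(1) \<phi>_K[OF h]] p2[OF o(1) \<phi>_K[OF h]] \<phi>_B[OF h] inv_\<phi>(3)[OF h] by auto
  qed
  define \<theta> where "\<theta> d z = (if z = \<one>\<^bsub>G0\<^esub> then p1 d else if z = g then p2 d else \<one>)" for d z
  have \<theta>H: "\<theta> d z \<in> H" if "d \<in> R" for d z
    using p12[OF that] subgroup.one_closed[OF H_subgroup] by (simp add: \<theta>_def)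
  have \<theta>m: "\<theta> (d \<otimes> d') z = \<theta> d z \<otimes> \<theta> d' z" if "d \<in> R" "d' \<in> R" for d d' z
    using pm[OF that] by (simp add: \<theta>_def)
  have \<theta>c: "\<theta> (b \<otimes> d \<otimes> inv b) z = \<alpha> (U b z) (\<theta> d z)" if "d \<in> R" "b \<in> carrier B" for b d z
    using pc[OF that] p12[OF that(1)] u1 u2 that(2) a1 subgroup.one_closed[OF H_subgroup]
    by (simp add: \<theta>_def U_def)
  have \<theta>t: "\<theta> (\<phi> h) (z \<otimes>\<^bsub>G0\<^esub> g) = \<theta> h z" if h: "h \<in> H" and z: "z \<in> carrier G0" for h z
    using pH[OF h] pK[OF h] zg[OF z] g by (auto simp: \<theta>_def)
  have fm: "fst (x \<otimes>\<^bsub>?G\<^esub> y) = fst x \<otimes>\<^bsub>G1\<^esub> fst y" for x y by (simp add: DirProd_def split_beta)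
  \<comment> \<open>the value at \<open>1\<close> of the translate of \<open>\<theta> d\<close> by \<open>x\<close>\<close>
  let ?\<Theta> = "\<lambda>x d. \<alpha> (q (fst x)) (\<theta> d (s (fst x)))"
  let ?A = "B\<lparr>carrier := H\<rparr>"
  obtain G' f' \<tau>' where cov: "\<C> G'" "hnn_rep B H \<phi> G' f' \<tau>'"
    "\<forall>d\<in>carrier B. f' d = \<one>\<^bsub>G'\<^esub> \<longrightarrow>
      d \<in> kernel B ?G ?f \<and> ?\<Theta> \<one>\<^bsub>?G\<^esub> d = \<one>\<^bsub>?A\<^esub> \<and> ?\<Theta> ?t d = \<one>\<^bsub>?A\<^esub>"
  proof (rule cover_in_class[OF rep cG gG subgroup_in_class[OF H_subgroup] H_group, where \<Theta> = ?\<Theta>])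
    fix x d assume x: "x \<in> carrier ?G" and d: "d \<in> kernel B ?G ?f"
    have x1: "fst x \<in> carrier G1" using x by auto
    note qx = qQ[OF x1] and dR = kerR[OF d]
    show "?\<Theta> x d \<in> carrier ?A" using aH[OF qx \<theta>H] dR by simp
    show "?\<Theta> x (d \<otimes> d') = ?\<Theta> x d \<otimes>\<^bsub>?A\<^esub> ?\<Theta> x d'" if d': "d' \<in> kernel B ?G ?f" for d'
      using ah[OF qx \<theta>H \<theta>H] \<theta>m dR kerR[OF d'] by simp
    show "?\<Theta> (x \<otimes>\<^bsub>?G\<^esub> ?f b) d = ?\<Theta> x (b \<otimes> d \<otimes> inv b)" if b: "b \<in> carrier B" for b
      using sb[OF x1 b] qb[OF x1 b] aq[OF qx UQ[OF b] \<theta>H] \<theta>c[OF _ b] dR by (simp add: fm)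
  next
    fix x h assume x: "x \<in> carrier ?G" and h: "h \<in> H"
    have x1: "fst x \<in> carrier G1" using x by auto
    show "?\<Theta> (x \<otimes>\<^bsub>?G\<^esub> ?t) (\<phi> h) = ?\<Theta> x h"
      using sx[OF x1] qx[OF x1] \<theta>t[OF h sG[OF x1]] by (simp add: fm)
  qed (rule that)
  have "inj_on f' (carrier B)"
  proof (rule rep_injI[OF cov(2)])
    fix d assume d: "d \<in> carrier B" "f' d = \<one>\<^bsub>G'\<^esub>"
    then have k: "d \<in> R" "?\<Theta> \<one>\<^bsub>?G\<^esub> d = \<one>" "?\<Theta> ?t d = \<one>" using cov(3) kerR by auto
    have "p1 d = \<one>" using k s1 q1 a1 p12(1) by (simp add: \<theta>_def)
    moreover have "p2 d = \<one>" using k(1,3) st qt a1 p12(2) g by (simp add: \<theta>_def)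
    ultimately show "d = \<one>" using p12(3)[OF k(1)] \<phi>_one by simp
  qed
  then show ?thesis using cov(1,2) by blast
qed

end

lemma hnn_rep_pullback:
  assumes "hnn_rep B1 (f ` H) \<phi>1 G g \<tau>" "f \<in> hom B B1" "\<And>h. h \<in> H \<Longrightarrow> \<phi>1 (f h) = f (\<phi> h)"
  shows "hnn_rep B H \<phi> G (g \<circ> f) \<tau>"
  using assms hom_compose[OF assms(2), of g G] by (auto simp: hnn_rep_def)

lemma hnn_reduced_map:
  assumes "hnn_reduced H K w"
    and "\<And>c s. c \<in> fst ` set w \<Longrightarrow> c \<notin> (if s then K else H) \<Longrightarrow> f c \<notin> f ` (if s then K else H)"
  shows "hnn_reduced (f ` H) (f ` K) (map (\<lambda>(c, s). (f c, s)) w)"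
  using assms
proof (induction w)
  case (Cons p w)
  note prems = Cons.prems
  have IH: "hnn_reduced (f ` H) (f ` K) (map (\<lambda>(c, s). (f c, s)) w)"
    using Cons.IH hnn_reduced_Cons[OF Cons.prems(1)] Cons.prems(2) by auto
  show ?case
  proof (cases w)
    case (Cons q v)
    obtain b s c r where pq: "p = (b, s)" "q = (c, r)" by (metis surj_pair)
    have "f c \<notin> f ` (if s then K else H)" if "s \<noteq> r"
      using prems(1) prems(2)[of c s] that by (simp add: pq Cons)
    then show ?thesis using IH by (cases s) (auto simp: pq Cons)
  qed (cases p, simp)
qed simp

context hnn_in_class
begin

text \<open>
  The preceding result for \<open>B/L\<close> gives a representation with kernel \<open>L\<close> on the base. Since \<open>L\<close> is invariant
  under \<open>B\<close> and \<open>\<phi>\<close>, it is normal in \<open>E\<close>, and conjugation on \<open>L\<close> is a second representation, with values in a group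
  isomorphic to \<open>\<VV>\<close>. The kernel of the pair on \<open>B\<close> lies in \<open>L\<close>. A covering with fibre \<open>L\<close> removes it: at
  \<open>x\<close> the kernel is identified with a subgroup of \<open>L\<close> by the action of \<open>x\<close>, and these identifications are
  consistent because elements that act trivially on \<open>G\<close> act trivially on \<open>L\<close>.
\<close>

lemma base_embedding:
  assumes U: "in_class (hnn_U B H K \<phi>) \<C>" and L: "\<phi> ` (H \<inter> K) = H \<inter> K"
    and V: "in_class (hnn_V B (H \<inter> K) \<phi>) \<C>"
  shows "\<exists>G f \<tau>. \<C> G \<and> hnn_rep B H \<phi> G f \<tau> \<and> inj_on f (carrier B)"
proof -
  let ?L = "H \<inter> K" and ?B = "B Mod (H \<inter> K)" and ?c = "\<lambda>b. (H \<inter> K) #> b"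
  note Ls = normal_imp_subgroup[OF L_normal]
  have gB: "group ?B" by (rule normal.factorgroup_is_group[OF L_normal])
  have hc: "?c \<in> hom B ?B" "?c ` carrier B = carrier ?B"
    using normal.r_coset_hom_Mod[OF L_normal] by (auto simp: FactGroup_def RCOSETS_def)
  interpret c: group_hom B ?B ?c using gB hc(1) B.group_axioms by (simp add: group_hom_def group_hom_axioms_def)
  have ck: "?c d = \<one>\<^bsub>?B\<^esub> \<longleftrightarrow> d \<in> ?L" if d: "d \<in> carrier B" for d
    using B.coset_join2[OF d Ls] B.rcos_self[OF d Ls] by auto
  have "h \<in> ?L \<longleftrightarrow> \<phi> h \<in> ?L" if h: "h \<in> H" for h
  proof
    assume "\<phi> h \<in> ?L"
    then obtain l where "l \<in> ?L" "\<phi> h = \<phi> l" using L by (metis imageE)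
    then show "h \<in> ?L" using h \<phi>_inj by (auto dest: inj_onD)
  qed (use L in blast)
  then have "?c h = \<one>\<^bsub>?B\<^esub> \<longleftrightarrow> ?c (\<phi> h) = \<one>\<^bsub>?B\<^esub>" if h: "h \<in> H" for h
    using ck[OF H_sub[OF h]] ck[OF \<phi>_B[OF h]] h by blast
  then obtain \<phi>1 where b1: "hnn_base ?B (?c ` H) (?c ` K) \<phi>1"
    and p1: "\<And>h. h \<in> H \<Longrightarrow> \<phi>1 (?c h) = ?c (\<phi> h)"
    using quotient_data[OF gB hc] by blast
  interpret q: hnn_in_class ?B "?c ` H" "?c ` K" \<phi>1 \<C>
  proof (intro hnn_in_class.intro hnn_in_class_axioms.intro b1 root_quotient_class_axioms)
    show "in_class ?B \<C>" by (rule in_class_hom_onto[OF B_in_class B.group_axioms hc(1) gB hc(2)])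
  qed
  have "?c ` H \<inter> ?c ` K = {\<one>\<^bsub>?B\<^esub>}"
  proof
    show "?c ` H \<inter> ?c ` K \<subseteq> {\<one>\<^bsub>?B\<^esub>}"
    proof
      fix y assume "y \<in> ?c ` H \<inter> ?c ` K"
      then obtain h k where hk: "h \<in> H" "y = ?c h" "k \<in> K" "y = ?c k" by blast
      have c: "h \<in> carrier B" "k \<in> carrier B" using hk H_sub K_sub by auto
      have "h \<in> ?c h" by (rule B.rcos_self[OF c(1) Ls])
      then have "h \<in> ?c k" using hk(2,4) by blast
      then obtain l where l: "l \<in> ?L" "h = l \<otimes> k" by (auto simp: r_coset_def)
      then have "h \<in> K" using subgroup.m_closed[OF K_subgroup] hk(3) by blast
      then have "?c h = \<one>\<^bsub>?B\<^esub>" using ck[OF c(1)] hk(1) by blast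
      then show "y \<in> {\<one>\<^bsub>?B\<^esub>}" using hk(2) by blast
    qed
    show "{\<one>\<^bsub>?B\<^esub>} \<subseteq> ?c ` H \<inter> ?c ` K"
      using subgroup.one_closed[OF q.H_subgroup] subgroup.one_closed[OF q.K_subgroup] by blast
  qed
  then obtain G0 f0 \<tau>0 where G0: "\<C> G0" "hnn_rep ?B (?c ` H) \<phi>1 G0 f0 \<tau>0" "inj_on f0 (carrier ?B)"
    using q.base_embedding_trivial_intersection[OF hnn_U_quotient[OF hnn_base_axioms b1 hc p1 U]] by blast
  have rep0: "hnn_rep B H \<phi> G0 (f0 \<circ> ?c) \<tau>0" by (rule hnn_rep_pullback[OF G0(2) hc(1) p1])
  have gG0: "group G0" by (rule class_group[OF G0(1)])
  have f0: "f0 \<in> hom ?B G0" using G0(2) by (simp add: hnn_rep_def)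
  have k0: "d \<in> ?L" if d: "d \<in> carrier B" "(f0 \<circ> ?c) d = \<one>\<^bsub>G0\<^esub>" for d
  proof -
    have "f0 (?c d) = f0 \<one>\<^bsub>?B\<^esub>" using d(2) hom_one[OF f0 gB gG0] by (simp del: one_FactGroup)
    then have "?c d = \<one>\<^bsub>?B\<^esub>" using inj_onD[OF G0(3)] c.hom_closed[OF d(1)] c.H.one_closed by blast
    then show ?thesis using ck[OF d(1)] by blast
  qed
  \<comment> \<open>conjugation on \<open>L\<close>; the stable letter acts by the inverse of \<open>\<phi>\<close>, as \<open>t (\<phi> l) (inv t) = l\<close>\<close>
  let ?A = "B\<lparr>carrier := H \<inter> K\<rparr>"
  obtain R \<alpha> where R: "\<C> R" "group R" and a: "aut_action R ?A \<alpha>"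
    and faithful: "\<forall>p\<in>carrier R. \<forall>q\<in>carrier R. (\<forall>y\<in>?L. \<alpha> p y = \<alpha> q y) \<longrightarrow> p = q"
    and gen: "\<forall>\<sigma>\<in>conj_auts B ?L \<union> {restrict \<phi> ?L}. \<exists>q\<in>carrier R. \<forall>y\<in>?L. \<alpha> q y = \<sigma> y"
    by (rule generated_auts_action[OF V[unfolded hnn_V_alt[OF L]] L_group V_generators_auto[OF L]])
  interpret R: group R by (rule R(2))
  have aL: "\<alpha> q y \<in> ?L" if "q \<in> carrier R" "y \<in> ?L" for q y using a that by (simp add: aut_action_def)
  have a1: "\<alpha> \<one>\<^bsub>R\<^esub> y = y" if "y \<in> ?L" for y using a that by (simp add: aut_action_def)
  have aq: "\<alpha> (p \<otimes>\<^bsub>R\<^esub> q) y = \<alpha> p (\<alpha> q y)" if "p \<in> carrier R" "q \<in> carrier R" "y \<in> ?L" for p q y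
    using a that by (simp add: aut_action_def)
  have ah: "\<alpha> q (x \<otimes> y) = \<alpha> q x \<otimes> \<alpha> q y" if "q \<in> carrier R" "x \<in> ?L" "y \<in> ?L" for q x y
    using a that by (simp add: aut_action_def)
  have eqR: "p = q" if "p \<in> carrier R" "q \<in> carrier R" "\<And>h. h \<in> ?L \<Longrightarrow> \<alpha> p h = \<alpha> q h" for p q
    using faithful that by blast
  have Lc: "b \<otimes> l \<otimes> inv b \<in> ?L" if "b \<in> carrier B" "l \<in> ?L" for b l
    using normal.inv_op_closed2[OF L_normal that] .
  obtain v where vhom: "v \<in> hom B R" and v: "\<forall>b\<in>carrier B. \<forall>l\<in>?L. \<alpha> (v b) l = b \<otimes> l \<otimes> inv b"
  proof (rule faithful_action_hom[OF R(2) a faithful, where \<kappa> = "\<lambda>b l. b \<otimes> l \<otimes> inv b"])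
    fix b assume b: "b \<in> carrier B"
    have "(\<lambda>y\<in>?L. inv (inv b) \<otimes> y \<otimes> inv b) \<in> conj_auts B ?L"
      unfolding conj_auts_def by (rule imageI) (use b in simp)
    then obtain q where "q \<in> carrier R" "\<forall>y\<in>?L. \<alpha> q y = (\<lambda>y\<in>?L. inv (inv b) \<otimes> y \<otimes> inv b) y"
      using gen by blast
    then show "\<exists>q\<in>carrier R. \<forall>l\<in>?L. \<alpha> q l = b \<otimes> l \<otimes> inv b" using b by auto
  qed (use H_sub in \<open>auto simp: B.m_assoc B.inv_mult_group\<close>)
  have vR: "v b \<in> carrier R" if "b \<in> carrier B" for b by (rule hom_in_carrier[OF vhom that])
  obtain r where r: "r \<in> carrier R" "\<forall>y\<in>?L. \<alpha> r y = restrict \<phi> ?L y" using gen by blast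
  define s where "s = inv\<^bsub>R\<^esub> r"
  have s: "s \<in> carrier R" using r by (simp add: s_def)
  have s\<phi>: "\<alpha> s (\<phi> l) = l" if l: "l \<in> ?L" for l
    using aq[OF s r(1) l] r l a1[OF l] by (simp add: s_def)
  have rep1: "hnn_rep B H \<phi> R v s"
    unfolding hnn_rep_def
  proof (intro conjI ballI R(2) vhom s)
    fix h assume h: "h \<in> H"
    show "v h \<otimes>\<^bsub>R\<^esub> s = s \<otimes>\<^bsub>R\<^esub> v (\<phi> h)"
    proof (rule eqR)
      fix l assume "l \<in> ?L"
      then obtain m where m: "m \<in> ?L" "l = \<phi> m" using L by blast
      have e: "\<phi> (h \<otimes> m \<otimes> inv h) = \<phi> h \<otimes> \<phi> m \<otimes> inv (\<phi> h)" using \<phi>_conj[OF h] m(1) by simp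
      have lL: "\<phi> m \<in> ?L" using m(1) L by blast
      have "\<alpha> (v h \<otimes>\<^bsub>R\<^esub> s) l = h \<otimes> m \<otimes> inv h"
        using aq[of "v h" s l] v vR H_sub[OF h] s s\<phi>[OF m(1)] m lL by simp
      moreover have "\<alpha> (s \<otimes>\<^bsub>R\<^esub> v (\<phi> h)) l = \<alpha> s (\<phi> (h \<otimes> m \<otimes> inv h))"
        using aq[of s "v (\<phi> h)" l] v vR \<phi>_B[OF h] s m lL e by simp
      ultimately show "\<alpha> (v h \<otimes>\<^bsub>R\<^esub> s) l = \<alpha> (s \<otimes>\<^bsub>R\<^esub> v (\<phi> h)) l"
        using s\<phi>[OF Lc[OF H_sub[OF h] m(1)]] by simp
    qed (use vR H_sub[OF h] \<phi>_B[OF h] s in auto)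
  qed
  let ?G = "G0 \<times>\<times> R" and ?f = "\<lambda>b. ((f0 \<circ> ?c) b, v b)" and ?t = "(\<tau>0, s)"
  have gG: "group ?G" by (rule DirProd_group[OF gG0 R(2)])
  have rep: "hnn_rep B H \<phi> ?G ?f ?t" by (rule hnn_rep_prod[OF rep0 rep1])
  have cG: "in_class ?G \<C>" by (rule in_class_DirProd[OF in_classI[OF G0(1)] gG0 in_classI[OF R(1)] R(2)])
  have kerL: "d \<in> ?L" if "d \<in> kernel B ?G ?f" for d using that k0[of d] by (auto simp: kernel_def)
  have sm: "snd (x \<otimes>\<^bsub>?G\<^esub> y) = snd x \<otimes>\<^bsub>R\<^esub> snd y" for x y by (simp add: DirProd_def split_beta)
  let ?\<Theta> = "\<lambda>x d. \<alpha> (snd x) d"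
  obtain G' f' \<tau>' where cov: "\<C> G'" "hnn_rep B H \<phi> G' f' \<tau>'"
    "\<forall>d\<in>carrier B. f' d = \<one>\<^bsub>G'\<^esub> \<longrightarrow>
      d \<in> kernel B ?G ?f \<and> ?\<Theta> \<one>\<^bsub>?G\<^esub> d = \<one>\<^bsub>?A\<^esub> \<and> ?\<Theta> ?t d = \<one>\<^bsub>?A\<^esub>"
  proof (rule cover_in_class[OF rep cG gG subgroup_in_class[OF Ls] L_group, where \<Theta> = ?\<Theta>])
    fix x d assume x: "x \<in> carrier ?G" and d: "d \<in> kernel B ?G ?f"
    have x2: "snd x \<in> carrier R" using x by auto
    note dL = kerL[OF d]
    show "?\<Theta> x d \<in> carrier ?A" using aL[OF x2 dL] by simp
    show "?\<Theta> x (d \<otimes> d') = ?\<Theta> x d \<otimes>\<^bsub>?A\<^esub> ?\<Theta> x d'" if d': "d' \<in> kernel B ?G ?f" for d'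
      using ah[OF x2 dL kerL[OF d']] by simp
    show "?\<Theta> (x \<otimes>\<^bsub>?G\<^esub> ?f b) d = ?\<Theta> x (b \<otimes> d \<otimes> inv b)" if b: "b \<in> carrier B" for b
      using aq[OF x2 vR[OF b] dL] v b dL by (simp add: sm)
  next
    fix x h assume x: "x \<in> carrier ?G" and h: "h \<in> H" and d: "h \<in> kernel B ?G ?f"
    have x2: "snd x \<in> carrier R" using x by auto
    have "\<phi> h \<in> ?L" using kerL[OF d] L by blast
    then show "?\<Theta> (x \<otimes>\<^bsub>?G\<^esub> ?t) (\<phi> h) = ?\<Theta> x h"
      using aq[OF x2 s, of "\<phi> h"] s\<phi>[OF kerL[OF d]] by (simp add: sm)
  qed (rule that)
  have "inj_on f' (carrier B)"
  proof (rule rep_injI[OF cov(2)])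
    fix d assume "d \<in> carrier B" "f' d = \<one>\<^bsub>G'\<^esub>"
    then have "d \<in> ?L" "?\<Theta> \<one>\<^bsub>?G\<^esub> d = \<one>" using cov(3) kerL by auto
    then show "d = \<one>" using a1 by simp
  qed
  then show ?thesis using cov(1,2) by blast
qed

end

section \<open>The base embeds in the HNN-extension\<close>

text \<open>
  All groups on an infinite type form a root class closed under quotients, for which the
  conditions on \<open>\<UU>\<close> and \<open>\<VV>\<close> are automatic. The embedding of the base in a member of this class
  factors through the HNN-extension.
\<close>

lemma in_class_all_groups:
  fixes e :: "'a \<Rightarrow> 'v"
  assumes "group X" "inj_on e (carrier X)"
  shows "in_class X (group :: 'v monoid \<Rightarrow> bool)"
proof -
  have "transported e X \<cong> X"
    using group.iso_sym[OF assms(1)] transported_iso[OF assms] unfolding is_iso_def by blast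
  then show ?thesis using transported_iso(1)[OF assms] unfolding in_class_def by blast
qed

lemma quotient_in_class_all_groups:
  assumes N: "N \<lhd> (G :: 'v monoid)"
  shows "in_class (G Mod N) (group :: 'v monoid \<Rightarrow> bool)"
proof (rule in_class_all_groups)
  interpret N: normal N G by (rule N)
  show "group (G Mod N)" by (rule N.factorgroup_is_group)
  have in_coset: "(SOME x. x \<in> c) \<in> c" if "c \<in> rcosets\<^bsub>G\<^esub> N" for c
    using N.rcosets_non_empty[OF that] by (simp add: some_in_eq)
  show "inj_on (\<lambda>c. SOME x. x \<in> c) (carrier (G Mod N))"
  proof (rule inj_onI)
    fix c d assume "c \<in> carrier (G Mod N)" "d \<in> carrier (G Mod N)" "(SOME x. x \<in> c) = (SOME x. x \<in> d)"
    then have cd: "c \<in> rcosets\<^bsub>G\<^esub> N" "d \<in> rcosets\<^bsub>G\<^esub> N" "(SOME x. x \<in> c) \<in> d"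
      using in_coset by (auto simp: FactGroup_def)
    then show "c = d"
      using N.rcos_disjoint[OF N.subgroup_axioms] in_coset[OF cd(1)]
      unfolding pairwise_def disjnt_iff by blast
  qed
qed

lemma root_quotient_class_all_groups: "root_quotient_class (group :: 'v::infinite monoid \<Rightarrow> bool)"
proof (rule root_quotient_class.intro)
  let ?g = "group :: 'v monoid \<Rightarrow> bool"
  show "quotient_closed ?g"
    unfolding quotient_closed_def using quotient_in_class_all_groups by blast
  obtain k :: "nat \<Rightarrow> 'v" where k: "inj k" using infinite_UNIV infinite_countable_subset by blast
  let ?Z = "\<lparr>carrier = UNIV, monoid.mult = (\<noteq>), one = False\<rparr> :: bool monoid"
  have Z: "group ?Z" by (rule groupI) auto
  have k01: "k 1 \<noteq> k 0" using inj_eq[OF k] by simp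
  let ?e = "\<lambda>b. if b then k 1 else k 0"
  have e: "inj_on ?e (carrier ?Z)" by (rule inj_onI) (use k01 in \<open>auto split: if_splits\<close>)
  have "group (transported ?e ?Z)" by (rule transported_iso[OF Z e])
  moreover have "carrier (transported ?e ?Z) \<noteq> {\<one>\<^bsub>transported ?e ?Z\<^esub>}"
    using k01 by (auto simp: transported_def)
  moreover have "\<exists>T. T \<lhd> X \<and> in_class (X Mod T) ?g \<and> T \<subseteq> Z"
    if X: "group X" "Y \<lhd> X" "Z \<lhd> X\<lparr>carrier := Y\<rparr>" for X :: "'v monoid" and Y Z
  proof (intro exI conjI)
    show "{\<one>\<^bsub>X\<^esub>} \<lhd> X" by (rule group.one_is_normal[OF X(1)])
    then show "in_class (X Mod {\<one>\<^bsub>X\<^esub>}) ?g" by (rule quotient_in_class_all_groups)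
    show "{\<one>\<^bsub>X\<^esub>} \<subseteq> Z" using subgroup.one_closed[OF normal_imp_subgroup[OF X(3)]] by simp
  qed
  ultimately show "root_class ?g"
    unfolding root_class_def group_class_def subgroup_closed_def
    using subgroup.subgroup_is_group by blast
qed

text \<open>
  The type of lists of functions is infinite and contains \<open>B\<close> as constant functions as well as all
  automorphisms of subgroups of \<open>B\<close>.
\<close>

lemma (in hnn_base) \<iota>_inj:
  assumes L: "\<phi> ` (H \<inter> K) = H \<inter> K"
  shows "inj_on \<iota> (carrier B)"
proof -
  interpret all: hnn_in_class B H K \<phi> "group :: ('b \<Rightarrow> 'b) list monoid \<Rightarrow> bool"
  proof (intro hnn_in_class.intro hnn_in_class_axioms.intro hnn_base_axioms root_quotient_class_all_groups)
    show "in_class B (group :: ('b \<Rightarrow> 'b) list monoid \<Rightarrow> bool)"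
      by (rule in_class_all_groups[OF B.group_axioms, of "\<lambda>b. [\<lambda>_. b]"]) (auto simp: inj_on_def fun_eq_iff)
  qed
  have g: "in_class (generated_auts B Y S) (group :: ('b \<Rightarrow> 'b) list monoid \<Rightarrow> bool)"
    if "group (B\<lparr>carrier := Y\<rparr>)" "S \<subseteq> carrier (AutoGroup (B\<lparr>carrier := Y\<rparr>))" for Y S
  proof (rule in_class_all_groups)
    interpret A: group "AutoGroup (B\<lparr>carrier := Y\<rparr>)" by (rule group.AutoGroup[OF that(1)])
    show "group (generated_auts B Y S)"
      unfolding generated_auts_def
      by (rule subgroup.subgroup_is_group[OF A.generate_is_subgroup[OF that(2)] A.group_axioms])
    show "inj_on (\<lambda>\<sigma>. [\<sigma>]) (carrier (generated_auts B Y S))" by (simp add: inj_on_def)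
  qed
  obtain G :: "('b \<Rightarrow> 'b) list monoid" and f \<tau> where G: "hnn_rep B H \<phi> G f \<tau>" "inj_on f (carrier B)"
    using all.base_embedding[OF g[OF H_group U_generators_auto, folded hnn_U_def] L
        g[OF L_group V_generators_auto[OF L], folded hnn_V_alt[OF L]]] by blast
  obtain F where "F \<in> hom E G" "\<And>b. b \<in> carrier B \<Longrightarrow> F (\<iota> b) = f b" using E_universal[OF G(1)] by blast
  then show ?thesis using G(2) unfolding inj_on_def by metis
qed

section \<open>The two implications\<close>

context root_quotient_class
begin

lemma residually_separates_finite:
  assumes X: "group X" and res: "residually \<C> X" and F: "finite F" "F \<subseteq> carrier X"
  obtains G f where "\<C> G" "f \<in> hom X G" "f ` carrier X = carrier G" "inj_on f F"
proof -
  interpret X: group X by (rule X)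
  have fin: "\<exists>G f. \<C> G \<and> f \<in> hom X G \<and> (\<forall>d\<in>D. f d \<noteq> \<one>\<^bsub>G\<^esub>)"
    if "finite D" "D \<subseteq> carrier X - {\<one>\<^bsub>X\<^esub>}" for D
    using that
  proof (induction D)
    case empty
    obtain G g where G: "\<C> G" "g \<in> carrier G" "g \<noteq> \<one>\<^bsub>G\<^esub>" by (rule class_nontrivial)
    interpret G: group G by (rule class_group[OF G(1)])
    have "(\<lambda>_. \<one>\<^bsub>G\<^esub>) \<in> hom X G" by (rule homI) auto
    then show ?case using G(1) by blast
  next
    case (insert d D)
    obtain G f where G: "\<C> G" "f \<in> hom X G" "\<forall>d\<in>D. f d \<noteq> \<one>\<^bsub>G\<^esub>" using insert by blast
    obtain A k where A: "\<C> A" "k \<in> hom X A" "k d \<noteq> \<one>\<^bsub>A\<^esub>"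
      using res insert.prems unfolding residually_def by blast
    note g = class_group[OF G(1)] class_group[OF A(1)]
    have gD: "group (G \<times>\<times> A)" by (rule DirProd_group[OF g])
    have p: "(\<lambda>x. (f x, k x)) \<in> hom X (G \<times>\<times> A)" using G(2) A(2) by (auto simp: hom_def)
    obtain P i where P: "\<C> P" "group P" "i \<in> hom (G \<times>\<times> A) P" "inj_on i (carrier (G \<times>\<times> A))"
      "i ` carrier (G \<times>\<times> A) = carrier P"
      by (rule in_classE[OF in_class_DirProd[OF in_classI[OF G(1)] g(1) in_classI[OF A(1)] g(2)] gD])
    have "i (f x, k x) \<noteq> \<one>\<^bsub>P\<^esub>" if x: "x \<in> insert d D" for x
    proof
      assume "i (f x, k x) = \<one>\<^bsub>P\<^esub>"
      then have "i (f x, k x) = i \<one>\<^bsub>G \<times>\<times> A\<^esub>" using hom_one[OF P(3) gD P(2)] by simp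
      moreover have "(f x, k x) \<in> carrier (G \<times>\<times> A)" using hom_in_carrier[OF p] x insert.prems by blast
      ultimately have "(f x, k x) = \<one>\<^bsub>G \<times>\<times> A\<^esub>"
        using inj_onD[OF P(4)] monoid.one_closed[OF group.is_monoid[OF gD]] by blast
      then show False using x G(3) A(3) by auto
    qed
    then show ?case using P(1) hom_compose[OF p P(3)] by (auto simp: comp_def)
  qed
  define D where "D = (\<lambda>(x, y). x \<otimes>\<^bsub>X\<^esub> inv\<^bsub>X\<^esub> y) ` {(x, y) \<in> F \<times> F. x \<noteq> y}"
  have "finite D" unfolding D_def using F(1) by (auto intro: finite_subset[of _ "F \<times> F"])
  moreover have "x \<otimes>\<^bsub>X\<^esub> inv\<^bsub>X\<^esub> y \<noteq> \<one>\<^bsub>X\<^esub>" if "x \<in> F" "y \<in> F" "x \<noteq> y" for x y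
  proof
    assume "x \<otimes>\<^bsub>X\<^esub> inv\<^bsub>X\<^esub> y = \<one>\<^bsub>X\<^esub>"
    then have "\<one>\<^bsub>X\<^esub> \<otimes>\<^bsub>X\<^esub> y = x" using X.inv_solve_right[of "\<one>\<^bsub>X\<^esub>" x y] that F(2) by auto
    then show False using that F(2) by auto
  qed
  then have "D \<subseteq> carrier X - {\<one>\<^bsub>X\<^esub>}" unfolding D_def using F(2) subsetD[OF F(2)] by auto
  ultimately obtain G f where G: "\<C> G" "f \<in> hom X G" "\<forall>d\<in>D. f d \<noteq> \<one>\<^bsub>G\<^esub>" using fin by blast
  interpret f: group_hom X G f using X G(2) class_group[OF G(1)] by (simp add: group_hom_def group_hom_axioms_def)
  have "inj_on f F"
  proof (rule inj_onI, rule ccontr)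
    fix x y assume xy: "x \<in> F" "y \<in> F" "f x = f y" "x \<noteq> y"
    then have "x \<otimes>\<^bsub>X\<^esub> inv\<^bsub>X\<^esub> y \<in> D" by (force simp: D_def)
    moreover have "f (x \<otimes>\<^bsub>X\<^esub> inv\<^bsub>X\<^esub> y) = \<one>\<^bsub>G\<^esub>"
      using xy(3) subsetD[OF F(2) xy(1)] subsetD[OF F(2) xy(2)] by simp
    ultimately show False using G(3) by blast
  qed
  moreover have "f \<in> hom X (G\<lparr>carrier := f ` carrier X\<rparr>)" using G(2) by (auto simp: hom_def)
  ultimately show ?thesis using that[OF class_subgroup[OF G(1) f.img_is_subgroup]] by simp
qed

lemma residuallyI:
  assumes "group X" "\<And>x. x \<in> carrier X \<Longrightarrow> x \<noteq> \<one>\<^bsub>X\<^esub> \<Longrightarrow> \<exists>G f. \<C> G \<and> f \<in> hom X G \<and> f x \<noteq> \<one>\<^bsub>G\<^esub>"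
  shows "residually \<C> X"
  unfolding residually_def
proof (intro ballI impI)
  fix x assume "x \<in> carrier X" "x \<noteq> \<one>\<^bsub>X\<^esub>"
  then obtain G f where G: "\<C> G" "f \<in> hom X G" "f x \<noteq> \<one>\<^bsub>G\<^esub>" using assms(2) by blast
  interpret f: group_hom X G f
    using assms(1) G(2) class_group[OF G(1)] by (simp add: group_hom_def group_hom_axioms_def)
  have "f \<in> hom X (G\<lparr>carrier := f ` carrier X\<rparr>)" using G(2) by (auto simp: hom_def)
  then show "\<exists>G f. \<C> G \<and> f \<in> hom X G \<and> f ` carrier X = carrier G \<and> f x \<noteq> \<one>\<^bsub>G\<^esub>"
    using class_subgroup[OF G(1) f.img_is_subgroup] G(3)
    by (intro exI[of _ "G\<lparr>carrier := f ` carrier X\<rparr>"] exI[of _ f]) simp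
qed

text \<open>
  Automorphisms of \<open>Y\<close> that become inner in \<open>G\<close> are induced by the normaliser of the image of \<open>Y\<close>.
\<close>

lemma generated_auts_normalizer:
  assumes G: "\<C> G" and X: "group (B\<lparr>carrier := Y\<rparr>)" and f: "f \<in> hom (B\<lparr>carrier := Y\<rparr>) G" "inj_on f Y"
    and S: "S \<subseteq> carrier (AutoGroup (B\<lparr>carrier := Y\<rparr>))"
    and conj: "\<And>\<sigma>. \<sigma> \<in> S \<Longrightarrow> \<exists>g\<in>carrier G. \<forall>y\<in>Y. f (\<sigma> y) = g \<otimes>\<^bsub>G\<^esub> f y \<otimes>\<^bsub>G\<^esub> inv\<^bsub>G\<^esub> g"
  shows "in_class (generated_auts B Y S) \<C>"
proof -
  interpret G: group G by (rule class_group[OF G])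
  interpret f: group_hom "B\<lparr>carrier := Y\<rparr>" G f
    using X f(1) G.group_axioms by (simp add: group_hom_def group_hom_axioms_def)
  have fG: "f y \<in> carrier G" if "y \<in> Y" for y using f.hom_closed[of y] that by simp
  define P where "P = {g \<in> carrier G. \<forall>y\<in>Y. g \<otimes>\<^bsub>G\<^esub> f y \<otimes>\<^bsub>G\<^esub> inv\<^bsub>G\<^esub> g \<in> f ` Y \<and> inv\<^bsub>G\<^esub> g \<otimes>\<^bsub>G\<^esub> f y \<otimes>\<^bsub>G\<^esub> g \<in> f ` Y}"
  have P: "subgroup P G"
  proof (rule subgroup.intro)
    show "P \<subseteq> carrier G" by (auto simp: P_def)
    show "\<one>\<^bsub>G\<^esub> \<in> P" using fG by (auto simp: P_def)
    fix x assume x: "x \<in> P"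
    then show "inv\<^bsub>G\<^esub> x \<in> P" by (auto simp: P_def)
    fix y assume y: "y \<in> P"
    have c: "x \<in> carrier G" "y \<in> carrier G" using x y by (auto simp: P_def)
    show "x \<otimes>\<^bsub>G\<^esub> y \<in> P"
      unfolding P_def
    proof (intro CollectI conjI ballI)
      fix z assume z: "z \<in> Y"
      obtain z1 where z1: "z1 \<in> Y" "y \<otimes>\<^bsub>G\<^esub> f z \<otimes>\<^bsub>G\<^esub> inv\<^bsub>G\<^esub> y = f z1" using y z by (auto simp: P_def)
      have "x \<otimes>\<^bsub>G\<^esub> y \<otimes>\<^bsub>G\<^esub> f z \<otimes>\<^bsub>G\<^esub> inv\<^bsub>G\<^esub> (x \<otimes>\<^bsub>G\<^esub> y) = x \<otimes>\<^bsub>G\<^esub> f z1 \<otimes>\<^bsub>G\<^esub> inv\<^bsub>G\<^esub> x"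
        using c fG[OF z] by (simp add: z1(2)[symmetric] G.m_assoc G.inv_mult_group)
      then show "x \<otimes>\<^bsub>G\<^esub> y \<otimes>\<^bsub>G\<^esub> f z \<otimes>\<^bsub>G\<^esub> inv\<^bsub>G\<^esub> (x \<otimes>\<^bsub>G\<^esub> y) \<in> f ` Y" using x z1(1) by (simp add: P_def)
      obtain z2 where z2: "z2 \<in> Y" "inv\<^bsub>G\<^esub> x \<otimes>\<^bsub>G\<^esub> f z \<otimes>\<^bsub>G\<^esub> x = f z2" using x z by (auto simp: P_def)
      have "inv\<^bsub>G\<^esub> (x \<otimes>\<^bsub>G\<^esub> y) \<otimes>\<^bsub>G\<^esub> f z \<otimes>\<^bsub>G\<^esub> (x \<otimes>\<^bsub>G\<^esub> y) = inv\<^bsub>G\<^esub> y \<otimes>\<^bsub>G\<^esub> f z2 \<otimes>\<^bsub>G\<^esub> y"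
        using c fG[OF z] by (simp add: z2(2)[symmetric] G.m_assoc G.inv_mult_group)
      then show "inv\<^bsub>G\<^esub> (x \<otimes>\<^bsub>G\<^esub> y) \<otimes>\<^bsub>G\<^esub> f z \<otimes>\<^bsub>G\<^esub> (x \<otimes>\<^bsub>G\<^esub> y) \<in> f ` Y" using y z2(1) by (simp add: P_def)
    qed (use c in auto)
  qed
  define \<alpha> where "\<alpha> g y = inv_into Y f (g \<otimes>\<^bsub>G\<^esub> f y \<otimes>\<^bsub>G\<^esub> inv\<^bsub>G\<^esub> g)" for g y
  have a: "\<alpha> g y \<in> Y" "f (\<alpha> g y) = g \<otimes>\<^bsub>G\<^esub> f y \<otimes>\<^bsub>G\<^esub> inv\<^bsub>G\<^esub> g" if "g \<in> P" "y \<in> Y" for g y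
    using that by (auto simp: \<alpha>_def P_def inv_into_into f_inv_into_f)
  have inj: "x = y" if "f x = f y" "x \<in> Y" "y \<in> Y" for x y using inj_onD[OF f(2) that] .
  have PG: "g \<in> carrier G" if "g \<in> P" for g using that by (simp add: P_def)
  have Ym: "x \<otimes>\<^bsub>B\<^esub> y \<in> Y" if "x \<in> Y" "y \<in> Y" for x y using f.G.m_closed[of x y] that by simp
  have fm: "f (x \<otimes>\<^bsub>B\<^esub> y) = f x \<otimes>\<^bsub>G\<^esub> f y" if "x \<in> Y" "y \<in> Y" for x y using f.hom_mult[of x y] that by simp
  show ?thesis
  proof (rule generated_auts_in_class[of "G\<lparr>carrier := P\<rparr>"])
    show "in_class (G\<lparr>carrier := P\<rparr>) \<C>" by (rule in_classI[OF class_subgroup[OF G P]])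
    show "group (G\<lparr>carrier := P\<rparr>)" by (rule subgroup.subgroup_is_group[OF P G.group_axioms])
    show "group (B\<lparr>carrier := Y\<rparr>)" by (rule X)
    show "aut_action (G\<lparr>carrier := P\<rparr>) (B\<lparr>carrier := Y\<rparr>) \<alpha>"
      unfolding aut_action_def
    proof (intro conjI ballI)
      fix g x y assume "g \<in> carrier (G\<lparr>carrier := P\<rparr>)" "x \<in> carrier (B\<lparr>carrier := Y\<rparr>)" "y \<in> carrier (B\<lparr>carrier := Y\<rparr>)"
      then have c: "g \<in> P" "x \<in> Y" "y \<in> Y" by auto
      have "\<alpha> g (x \<otimes>\<^bsub>B\<^esub> y) = \<alpha> g x \<otimes>\<^bsub>B\<^esub> \<alpha> g y"
        by (rule inj) (use c PG[OF c(1)] fG in \<open>simp_all add: a Ym fm G.m_assoc G.inv_mult_cancel\<close>)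
      then show "\<alpha> g (x \<otimes>\<^bsub>B\<lparr>carrier := Y\<rparr>\<^esub> y) = \<alpha> g x \<otimes>\<^bsub>B\<lparr>carrier := Y\<rparr>\<^esub> \<alpha> g y" by simp
    next
      fix p g y assume "p \<in> carrier (G\<lparr>carrier := P\<rparr>)" "g \<in> carrier (G\<lparr>carrier := P\<rparr>)" "y \<in> carrier (B\<lparr>carrier := Y\<rparr>)"
      then have c: "p \<in> P" "g \<in> P" "y \<in> Y" by auto
      have pg: "p \<otimes>\<^bsub>G\<^esub> g \<in> P" by (rule subgroup.m_closed[OF P c(1,2)])
      have "\<alpha> (p \<otimes>\<^bsub>G\<^esub> g) y = \<alpha> p (\<alpha> g y)"
        by (rule inj) (use c pg PG[OF c(1)] PG[OF c(2)] fG in \<open>simp_all add: a G.m_assoc G.inv_mult_group\<close>)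
      then show "\<alpha> (p \<otimes>\<^bsub>G\<lparr>carrier := P\<rparr>\<^esub> g) y = \<alpha> p (\<alpha> g y)" by simp
    next
      fix y assume "y \<in> carrier (B\<lparr>carrier := Y\<rparr>)"
      then have y: "y \<in> Y" by simp
      have "\<alpha> \<one>\<^bsub>G\<^esub> y = y"
        by (rule inj) (use y fG a[OF subgroup.one_closed[OF P] y] in simp_all)
      then show "\<alpha> \<one>\<^bsub>G\<lparr>carrier := P\<rparr>\<^esub> y = y" by simp
    qed (use a in auto)
    fix \<sigma> assume s: "\<sigma> \<in> S"
    obtain g where g: "g \<in> carrier G" "\<forall>y\<in>Y. f (\<sigma> y) = g \<otimes>\<^bsub>G\<^esub> f y \<otimes>\<^bsub>G\<^esub> inv\<^bsub>G\<^esub> g" using conj[OF s] by blast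
    have A: "\<sigma> \<in> extensional Y" "bij_betw \<sigma> Y Y" using S s by (auto simp: AutoGroup_mem)
    have "g \<in> P"
      unfolding P_def
    proof (intro CollectI conjI ballI g(1))
      fix y assume y: "y \<in> Y"
      then show "g \<otimes>\<^bsub>G\<^esub> f y \<otimes>\<^bsub>G\<^esub> inv\<^bsub>G\<^esub> g \<in> f ` Y" using g(2) A(2) by (metis bij_betwE imageI)
      obtain z where z: "z \<in> Y" "y = \<sigma> z" using A(2) y by (auto simp: bij_betw_def)
      then have "inv\<^bsub>G\<^esub> g \<otimes>\<^bsub>G\<^esub> f y \<otimes>\<^bsub>G\<^esub> g = f z"
        using g fG[OF z(1)] by (simp add: G.m_assoc G.inv_mult_cancel)
      then show "inv\<^bsub>G\<^esub> g \<otimes>\<^bsub>G\<^esub> f y \<otimes>\<^bsub>G\<^esub> g \<in> f ` Y" using z(1) by simp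
    qed
    moreover have "\<sigma> = restrict (\<alpha> g) Y"
    proof (rule extensionalityI[OF A(1)])
      fix y assume y: "y \<in> Y"
      then have "\<sigma> y \<in> Y" using A(2) by (auto simp: bij_betw_def)
      then show "\<sigma> y = restrict (\<alpha> g) Y y"
        using y g(2) a[OF \<open>g \<in> P\<close> y] by (simp add: inj)
    qed auto
    ultimately show "\<exists>q\<in>carrier (G\<lparr>carrier := P\<rparr>). \<sigma> = restrict (\<alpha> q) Y" by auto
  qed
qed

end

locale hnn_root_class = hnn_base B H K \<phi> + root_quotient_class \<C>
  for B :: "'b monoid" (structure) and H K \<phi> and \<C> :: "'u::infinite monoid \<Rightarrow> bool" +
  assumes \<phi>_L: "\<phi> ` (H \<inter> K) = H \<inter> K" and finite_H: "finite H" and finite_K: "finite K"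
begin

lemma necessity:
  assumes res: "residually \<C> E"
  shows "residually \<C> B" "in_class (hnn_U B H K \<phi>) \<C>" "in_class (hnn_V B (H \<inter> K) \<phi>) \<C>"
proof -
  note inj = \<iota>_inj[OF \<phi>_L]
  have i1: "\<iota> b \<noteq> \<one>\<^bsub>E\<^esub>" if "b \<in> carrier B" "b \<noteq> \<one>" for b
    using inj_onD[OF inj, of b \<one>] that hom_one[OF \<iota>_hom B.group_axioms E_group] by auto
  show "residually \<C> B"
  proof (rule residuallyI[OF B.group_axioms])
    fix b assume b: "b \<in> carrier B" "b \<noteq> \<one>"
    then obtain G f where G: "\<C> G" "f \<in> hom E G" "f (\<iota> b) \<noteq> \<one>\<^bsub>G\<^esub>"
      using res i1[OF b] hom_in_carrier[OF \<iota>_hom b(1)] unfolding residually_def by blast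
    then show "\<exists>G f. \<C> G \<and> f \<in> hom B G \<and> f b \<noteq> \<one>\<^bsub>G\<^esub>"
      using hom_compose[OF \<iota>_hom G(2)] by (intro exI[of _ G] exI[of _ "f \<circ> \<iota>"]) simp
  qed
  have "\<iota> ` H \<subseteq> carrier E" using hom_in_carrier[OF \<iota>_hom] H_sub by blast
  then obtain G \<psi> where G: "\<C> G" "\<psi> \<in> hom E G" "\<psi> ` carrier E = carrier G" "inj_on \<psi> (\<iota> ` H)"
    using residually_separates_finite[OF E_group res finite_imageI[OF finite_H]] by blast
  have gG: "group G" by (rule class_group[OF G(1)])
  define f \<tau> where "f = \<psi> \<circ> \<iota>" and "\<tau> = \<psi> stable"
  have rep: "hnn_rep B H \<phi> G f \<tau>"
    unfolding f_def \<tau>_def by (rule hnn_rep_hom[OF E_rep G(2) gG]) (auto simp: H_sub \<phi>_B)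
  then have f: "f \<in> hom B G" and t: "\<tau> \<in> carrier G"
    and ft: "\<And>h. h \<in> H \<Longrightarrow> f h \<otimes>\<^bsub>G\<^esub> \<tau> = \<tau> \<otimes>\<^bsub>G\<^esub> f (\<phi> h)" by (auto simp: hnn_rep_def)
  interpret f: group_hom B G f using B.group_axioms gG f by (simp add: group_hom_def group_hom_axioms_def)
  have fH: "inj_on f H"
    unfolding f_def by (rule comp_inj_on[OF inj_on_subset[OF inj] G(4)]) (use H_sub in blast)
  have fo: "f h = \<tau> \<otimes>\<^bsub>G\<^esub> f (\<phi> h) \<otimes>\<^bsub>G\<^esub> inv\<^bsub>G\<^esub> \<tau>" if h: "h \<in> H" for h
    using ft[OF h] t H_sub[OF h] \<phi>_B[OF h] by (simp add: f.H.inv_solve_right)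
  have cj: "\<exists>g\<in>carrier G. \<forall>y\<in>Y. f (\<sigma> y) = g \<otimes>\<^bsub>G\<^esub> f y \<otimes>\<^bsub>G\<^esub> inv\<^bsub>G\<^esub> g"
    if s: "\<sigma> \<in> conj_auts B Y" and Y: "Y \<subseteq> carrier B" for \<sigma> Y
  proof -
    obtain x where x: "x \<in> carrier B" "\<sigma> = (\<lambda>y\<in>Y. inv x \<otimes> y \<otimes> x)" using s by (auto simp: conj_auts_def)
    have "f (\<sigma> y) = f (inv x) \<otimes>\<^bsub>G\<^esub> f y \<otimes>\<^bsub>G\<^esub> inv\<^bsub>G\<^esub> f (inv x)" if "y \<in> Y" for y
      using x that Y by auto
    then show ?thesis using f.hom_closed[OF B.inv_closed[OF x(1)]] by blast
  qed
  show "in_class (hnn_U B H K \<phi>) \<C>"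
    unfolding hnn_U_def
  proof (rule generated_auts_normalizer[OF G(1) H_group _ fH U_generators_auto])
    show "f \<in> hom (B\<lparr>carrier := H\<rparr>) G" using H_sub by (intro homI) auto
    fix \<sigma> assume "\<sigma> \<in> conj_auts B H \<union> twisted_conj ` conj_auts B K"
    then show "\<exists>g\<in>carrier G. \<forall>y\<in>H. f (\<sigma> y) = g \<otimes>\<^bsub>G\<^esub> f y \<otimes>\<^bsub>G\<^esub> inv\<^bsub>G\<^esub> g"
    proof
      assume "\<sigma> \<in> conj_auts B H"
      then show ?thesis by (rule cj) (use H_sub in blast)
    next
      assume "\<sigma> \<in> twisted_conj ` conj_auts B K"
      then obtain \<kappa> where k: "\<kappa> \<in> conj_auts B K" "\<sigma> = (\<lambda>h\<in>H. inv_into H \<phi> (\<kappa> (\<phi> h)))" by auto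
      obtain g where g: "g \<in> carrier G" "\<forall>y\<in>K. f (\<kappa> y) = g \<otimes>\<^bsub>G\<^esub> f y \<otimes>\<^bsub>G\<^esub> inv\<^bsub>G\<^esub> g"
        using cj[OF k(1)] K_sub by blast
      have kK: "\<kappa> y \<in> K" if "y \<in> K" for y
        using k(1) that normal.inv_op_closed1[OF K_normal] by (auto simp: conj_auts_def)
      \<comment> \<open>conjugation on \<open>K\<close> by an element of \<open>B\<close> becomes conjugation on \<open>H\<close> by its \<open>\<tau>\<close>-conjugate\<close>
      let ?g = "\<tau> \<otimes>\<^bsub>G\<^esub> g \<otimes>\<^bsub>G\<^esub> inv\<^bsub>G\<^esub> \<tau>"
      have "f (\<sigma> h) = ?g \<otimes>\<^bsub>G\<^esub> f h \<otimes>\<^bsub>G\<^esub> inv\<^bsub>G\<^esub> ?g" if h: "h \<in> H" for h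
      proof -
        have "\<kappa> (\<phi> h) \<in> K" using kK \<phi>_K h by blast
        then have i: "\<sigma> h \<in> H" "\<phi> (\<sigma> h) = \<kappa> (\<phi> h)" using inv_\<phi> k(2) h by auto
        have "f (\<sigma> h) = \<tau> \<otimes>\<^bsub>G\<^esub> (g \<otimes>\<^bsub>G\<^esub> f (\<phi> h) \<otimes>\<^bsub>G\<^esub> inv\<^bsub>G\<^esub> g) \<otimes>\<^bsub>G\<^esub> inv\<^bsub>G\<^esub> \<tau>"
          using fo[OF i(1)] i(2) g(2) \<phi>_K[OF h] by simp
        also have "\<dots> = ?g \<otimes>\<^bsub>G\<^esub> (\<tau> \<otimes>\<^bsub>G\<^esub> f (\<phi> h) \<otimes>\<^bsub>G\<^esub> inv\<^bsub>G\<^esub> \<tau>) \<otimes>\<^bsub>G\<^esub> inv\<^bsub>G\<^esub> ?g"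
          using t g(1) \<phi>_B[OF h] by (simp add: f.H.m_assoc f.H.inv_mult_group f.H.inv_mult_cancel)
        finally show ?thesis using fo[OF h] by simp
      qed
      then show ?thesis using t g(1) by blast
    qed
  qed
  show "in_class (hnn_V B (H \<inter> K) \<phi>) \<C>"
    unfolding hnn_V_alt[OF \<phi>_L]
  proof (rule generated_auts_normalizer[OF G(1) L_group _ inj_on_subset[OF fH] V_generators_auto[OF \<phi>_L]])
    show "f \<in> hom (B\<lparr>carrier := H \<inter> K\<rparr>) G" using H_sub by (intro homI) auto
    fix \<sigma> assume "\<sigma> \<in> conj_auts B (H \<inter> K) \<union> {restrict \<phi> (H \<inter> K)}"
    then show "\<exists>g\<in>carrier G. \<forall>y\<in>H \<inter> K. f (\<sigma> y) = g \<otimes>\<^bsub>G\<^esub> f y \<otimes>\<^bsub>G\<^esub> inv\<^bsub>G\<^esub> g"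
    proof
      assume "\<sigma> \<in> conj_auts B (H \<inter> K)"
      then show ?thesis by (rule cj) (use H_sub in blast)
    next
      assume "\<sigma> \<in> {restrict \<phi> (H \<inter> K)}"
      then have "f (\<sigma> l) = inv\<^bsub>G\<^esub> \<tau> \<otimes>\<^bsub>G\<^esub> f l \<otimes>\<^bsub>G\<^esub> inv\<^bsub>G\<^esub> (inv\<^bsub>G\<^esub> \<tau>)" if l: "l \<in> H \<inter> K" for l
        using fo[of l] l t \<phi>_B[of l] by (simp add: f.H.m_assoc f.H.inv_mult_cancel)
      then show ?thesis using f.H.inv_closed[OF t] by blast
    qed
  qed auto
qed

text \<open>
  The finite set \<open>?F\<close> controls all that has to survive in the quotient \<open>B1\<close> of the base: \<open>H\<close>, \<open>K\<close> and their
  intersection, the condition for the word to be reduced, and the non-triviality of \<open>b\<close>.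
\<close>

lemma sufficiency:
  assumes res: "residually \<C> B"
    and U: "in_class (hnn_U B H K \<phi>) \<C>" and V: "in_class (hnn_V B (H \<inter> K) \<phi>) \<C>"
  shows "residually \<C> E"
proof (rule residuallyI[OF E_group])
  interpret E: group E by (rule E_group)
  fix x assume x: "x \<in> carrier E" "x \<noteq> \<one>\<^bsub>E\<^esub>"
  obtain w b where w: "hnn_reduced H K w" "fst ` set w \<subseteq> carrier B" "b \<in> carrier B"
    and xw: "x = syllable_prod E \<iota> stable w \<otimes>\<^bsub>E\<^esub> \<iota> b"
    by (rule normal_form[OF x(1)])
  let ?F = "{\<one>, b} \<union> fst ` set w \<union> H \<union> K"
  have F: "finite ?F" "?F \<subseteq> carrier B" using finite_H finite_K w(2,3) H_sub K_sub by auto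
  obtain B1 f where B1: "\<C> B1" "f \<in> hom B B1" "f ` carrier B = carrier B1" and inj: "inj_on f ?F"
    using residually_separates_finite[OF B.group_axioms res F] by blast
  have gB1: "group B1" by (rule class_group[OF B1(1)])
  interpret f: group_hom B B1 f using B.group_axioms gB1 B1(2) by (simp add: group_hom_def group_hom_axioms_def)
  have fe: "f y = f z \<longleftrightarrow> y = z" if "y \<in> ?F" "z \<in> ?F" for y z using inj_on_eq_iff[OF inj that] .
  have f1: "f y = \<one>\<^bsub>B1\<^esub> \<longleftrightarrow> y = \<one>" if "y \<in> ?F" for y using fe[OF that, of \<one>] by simp
  have "f h = \<one>\<^bsub>B1\<^esub> \<longleftrightarrow> f (\<phi> h) = \<one>\<^bsub>B1\<^esub>" if h: "h \<in> H" for h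
  proof -
    have "\<phi> h = \<one> \<longleftrightarrow> h = \<one>"
      using \<phi>_one inj_on_eq_iff[OF \<phi>_inj h subgroup.one_closed[OF H_subgroup]] by simp
    then show ?thesis using f1[of h] f1[of "\<phi> h"] h \<phi>_K[OF h] by simp
  qed
  then obtain \<phi>1 where b1: "hnn_base B1 (f ` H) (f ` K) \<phi>1"
    and p1: "\<And>h. h \<in> H \<Longrightarrow> \<phi>1 (f h) = f (\<phi> h)"
    using quotient_data[OF gB1 B1(2,3)] by blast
  interpret q: hnn_in_class B1 "f ` H" "f ` K" \<phi>1 \<C>
    by (intro hnn_in_class.intro hnn_in_class_axioms.intro b1 root_quotient_class_axioms in_classI[OF B1(1)])
  have fL: "f ` (H \<inter> K) = f ` H \<inter> f ` K"
    by (rule inj_on_image_Int[OF inj]) auto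
  note V1 = hnn_V_quotient[OF hnn_base_axioms b1 B1(2,3) fL p1 \<phi>_L V]
  obtain G0 f0 \<tau>0 where G0: "\<C> G0" "hnn_rep B1 (f ` H) \<phi>1 G0 f0 \<tau>0" "inj_on f0 (carrier B1)"
    using q.base_embedding[OF hnn_U_quotient[OF hnn_base_axioms b1 B1(2,3) p1 U] V1] by blast
  have goal: "\<exists>G F. \<C> G \<and> F \<in> hom E G \<and> F x \<noteq> \<one>\<^bsub>G\<^esub>"
    if G: "\<C> G" "hnn_rep B1 (f ` H) \<phi>1 G g \<tau>"
      and ne: "syllable_prod G (g \<circ> f) \<tau> w \<otimes>\<^bsub>G\<^esub> g (f b) \<noteq> \<one>\<^bsub>G\<^esub>" for G g \<tau>
  proof -
    have gG: "group G" by (rule class_group[OF G(1)])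
    obtain \<Psi> where P: "\<Psi> \<in> hom E G" "\<And>b. b \<in> carrier B \<Longrightarrow> \<Psi> (\<iota> b) = (g \<circ> f) b" "\<Psi> stable = \<tau>"
      using E_universal[OF hnn_rep_pullback[OF G(2) B1(2) p1]] by blast
    have s: "syllable_prod E \<iota> stable w \<in> carrier E" by (rule syllable_prod_closed[OF E_group \<iota>_hom stable_E w(2)])
    have "\<Psi> (syllable_prod E \<iota> stable w) = syllable_prod G (g \<circ> f) \<tau> w"
      using hom_syllable_prod[OF E_group \<iota>_hom stable_E gG P(1) w(2)]
        syllable_prod_cong[of w "\<Psi> \<circ> \<iota>" "g \<circ> f" G \<tau>] P(2,3) w(2) by auto
    then have "\<Psi> x = syllable_prod G (g \<circ> f) \<tau> w \<otimes>\<^bsub>G\<^esub> g (f b)"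
      using hom_mult[OF P(1) s hom_in_carrier[OF \<iota>_hom w(3)]] P(2)[OF w(3)] xw by simp
    then show ?thesis using ne G(1) P(1) by metis
  qed
  show "\<exists>G F. \<C> G \<and> F \<in> hom E G \<and> F x \<noteq> \<one>\<^bsub>G\<^esub>"
  proof (cases "w = []")
    case True
    have gG0: "group G0" by (rule class_group[OF G0(1)])
    have h0: "f0 \<in> hom B1 G0" using G0(2) by (simp add: hnn_rep_def)
    have "b \<noteq> \<one>"
    proof
      assume "b = \<one>"
      then have "\<iota> b = \<one>\<^bsub>E\<^esub>" using hom_one[OF \<iota>_hom B.group_axioms E_group] by simp
      then show False using x(2) xw True by simp
    qed
    then have "f b \<noteq> \<one>\<^bsub>B1\<^esub>" using f1[of b] by simp
    then have "f0 (f b) \<noteq> \<one>\<^bsub>G0\<^esub>"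
      using inj_onD[OF G0(3), of "f b" "\<one>\<^bsub>B1\<^esub>"] hom_one[OF h0 gB1 gG0] w(3) by auto
    then show ?thesis
      using goal[OF G0(1,2)] True group.is_monoid[OF gG0] hom_in_carrier[OF h0 f.hom_closed[OF w(3)]]
      by (simp add: monoid.l_one)
  next
    case False
    let ?w = "map (\<lambda>(c, s). (f c, s)) w"
    have notin: "f c \<notin> f ` (if s then K else H)" if "c \<in> fst ` set w" "c \<notin> (if s then K else H)" for c s
    proof
      assume "f c \<in> f ` (if s then K else H)"
      then obtain y where y: "y \<in> (if s then K else H)" "f c = f y" by blast
      then have "c = y" using fe[of c y] that(1) by (cases s) auto
      then show False using y(1) that(2) by simp
    qed
    have red: "hnn_reduced (f ` H) (f ` K) ?w" by (rule hnn_reduced_map[OF w(1) notin])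
    have wB: "fst ` set ?w \<subseteq> carrier B1" using w(2) by auto
    obtain G g \<tau> where G: "\<C> G" "hnn_rep B1 (f ` H) \<phi>1 G g \<tau>" "q.separates G g \<tau> ?w"
      using q.reduced_word_separated[OF G0 red wB] False by auto
    have gG: "group G" and hg: "g \<in> hom B1 G" and t: "\<tau> \<in> carrier G" using G(2) by (auto simp: hnn_rep_def)
    interpret G: group G by (rule gG)
    interpret g: group_hom B1 G g using gB1 gG hg by (simp add: group_hom_def group_hom_axioms_def)
    have sw: "syllable_prod G (g \<circ> f) \<tau> w = syllable_prod G g \<tau> ?w" by (induction w) auto
    have sc: "syllable_prod G g \<tau> ?w \<in> carrier G" by (rule syllable_prod_closed[OF gG hg t wB])
    have "syllable_prod G g \<tau> ?w \<otimes>\<^bsub>G\<^esub> g (f b) \<noteq> \<one>\<^bsub>G\<^esub>"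
    proof
      assume "syllable_prod G g \<tau> ?w \<otimes>\<^bsub>G\<^esub> g (f b) = \<one>\<^bsub>G\<^esub>"
      then have "syllable_prod G g \<tau> ?w = inv\<^bsub>G\<^esub> (g (f b))"
        using sc w(3) G.inv_equality[of "syllable_prod G g \<tau> ?w" "g (f b)"] by simp
      then have "syllable_prod G g \<tau> ?w = g (inv\<^bsub>B1\<^esub> (f b))" using w(3) by simp
      moreover have "inv\<^bsub>B1\<^esub> (f b) \<in> carrier B1" using w(3) by simp
      ultimately show False using G(3) unfolding q.separates_def by blast
    qed
    then show ?thesis using goal[OF G(1,2)] sw by simp
  qed
qed

end

theorem corollary1:
  fixes B :: "'b monoid" and H K L :: "'b set" and \<phi> :: "'b \<Rightarrow> 'b"
    and \<C> :: "'u::infinite monoid \<Rightarrow> bool"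
  assumes "group B"
    and "H \<lhd> B" and "K \<lhd> B"
    and "\<phi> \<in> iso (B\<lparr>carrier := H\<rparr>) (B\<lparr>carrier := K\<rparr>)"
    and "L = H \<inter> K" and "\<phi> ` L = L"
    and "root_class \<C>" and "quotient_closed \<C>"
    and "finite H" and "finite K"
  shows "residually \<C> (hnn_extension B H \<phi>) \<longleftrightarrow>
    residually \<C> B \<and> in_class (hnn_U B H K \<phi>) \<C> \<and> in_class (hnn_V B L \<phi>) \<C>"
proof -
  interpret hnn_root_class B H K \<phi> \<C>
    using assms by (intro hnn_root_class.intro hnn_base.intro hnn_base_axioms.intro
        root_quotient_class.intro hnn_root_class_axioms.intro) auto
  show ?thesis using necessity sufficiency assms(5) by blast
qed

end
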